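(* Let $n,l\in\mathbb N$ (with $n,l\ge1$) and consider the two-dimensional convection–diffusion equation $$\partial_tu+\Bigl(\frac{\partial}{\partial x_1}+\frac{\partial}{\partial x_2}\Bigr)\Bigl(\frac1{l+1}u^{l+1}\Bigr)-\Bigl(\frac{\partial^2}{\partial x_1^2}-2\frac{\partial^2}{\partial x_1\partial x_2}+\frac{\partial^2}{\partial x_2^2}\Bigr)\Bigl(\frac1{n+1}|u|^nu\Bigr)=0,\qquad u=u(t,x_1,x_2),\ t>0.$$ Let $u_0\in L^1(\mathbb R^2)\cap L^\infty(\mathbb R^2)$ and let $u$ be the entropy solution with initial data $u|_{t=0}=u_0$. Put $$\alpha=\min\Bigl\{\frac1{2l},\frac1n\Bigr\},\qquad q_*=\frac{\alpha+12}{\alpha+6},\qquad s_*=\frac{\alpha}{6\alpha+72}.$$ Then for every $q\in(1,q_* )$ and every $s\in(0,2s_* )$, $$u\in W^{s,q}_{\mathrm{loc}}(\mathbb R_+\times\mathbb R^2).$$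
   Context: $\mathbb R_+=(0,\infty)$. $W^{s,q}$ ($0<s<1$) is the Sobolev–Slobodetskii space, with seminorm $\bigl(\iint|v(y)-v(z)|^q|y-z|^{-(3+sq)}\,dy\,dz\bigr)^{1/q}$ on $\mathbb R^3$; $v\in W^{s,q}_{\mathrm{loc}}(\mathbb R_+\times\mathbb R^2)$ means $\varphi v\in W^{s,q}(\mathbb R^3)$ for all $\varphi\in C_c^\infty(\mathbb R_+\times\mathbb R^2)$. Entropy solution. Let $D=\partial_{x_1}-\partial_{x_2}$, so the second-order operator in the equation is $D^2$. For $0\le\psi\in C(\mathbb R)$ put $\Sigma^\psi(\lambda)=\int_0^\lambda\sqrt{\psi(w)}\,|w|^{n/2}\,dw$ and $\Sigma=\Sigma^1$. A function $u\in L^\infty(\mathbb R_+\times\mathbb R^2)\cap L^\infty(\mathbb R_+;L^1(\mathbb R^2))$ is the (unique) entropy solution with initial data $u_0$ if $D\,\Sigma(u)\in L^2(\mathbb R_+\times\mathbb R^2)$, the chain rule $D\,\Sigma^\psi(u)=\sqrt{\psi(u)}\,D\,\Sigma(u)$ holds for all $0\le\psi\in C(\mathbb R)$, and, for every convex $S\in C^2(\mathbb R)$ with $Q'(\lambda)=S'(\lambda)\lambda^l$ and $R'(\lambda)=S'(\lambda)|\lambda|^n$, $$\partial_tS(u)+(\partial_{x_1}+\partial_{x_2})Q(u)-D^2R(u)\le-\bigl|D\,\Sigma^{S''}(u)\bigr|^2$$ in the sense of distributions on $[0,\infty)\times\mathbb R^2$ with initial data $S(u_0)$ (i.e. tested against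 nonnegative $\varphi\in C_c^\infty([0,\infty)\times\mathbb R^2)$, with the boundary term $\int S(u_0)\varphi(0,x)\,dx$). *)

theory Defs
  imports "HOL-Analysis.Analysis"
begin

section \<open>Smooth functions and test functions\<close>

definition dir_deriv :: "'a::euclidean_space \<Rightarrow> ('a \<Rightarrow> real) \<Rightarrow> 'a \<Rightarrow> real" where
  "dir_deriv v f x = frechet_derivative f (at x) v"

primrec Ck :: "nat \<Rightarrow> ('a::euclidean_space \<Rightarrow> real) \<Rightarrow> bool" where
  "Ck 0 f \<longleftrightarrow> continuous_on UNIV f"
| "Ck (Suc k) f \<longleftrightarrow> (\<forall>x. f differentiable (at x)) \<and> (\<forall>b\<in>Basis. Ck k (dir_deriv b f))"

definition Cinf_compact :: "('a::euclidean_space \<Rightarrow> real) set" where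
  "Cinf_compact = {\<phi>. (\<forall>k. Ck k \<phi>) \<and> compact (closure {x. \<phi> x \<noteq> 0})}"

definition test_functions :: "'a::euclidean_space set \<Rightarrow> ('a \<Rightarrow> real) set" where
  "test_functions U = {\<phi> \<in> Cinf_compact. closure {x. \<phi> x \<noteq> 0} \<subseteq> U}"


section \<open>Function spaces\<close>

text \<open>
  Functions stand for representatives of their almost-everywhere classes.  Functions on a subset
  \<open>U\<close> are total functions whose values outside \<open>U\<close> are irrelevant.
\<close>

definition in_Linf :: "'a measure \<Rightarrow> ('a \<Rightarrow> real) \<Rightarrow> bool" where
  "in_Linf M f \<longleftrightarrow> f \<in> borel_measurable M \<and> (\<exists>C. AE x in M. \<bar>f x\<bar> \<le> C)"

definition in_Lp :: "real \<Rightarrow> 'a measure \<Rightarrow> ('a \<Rightarrow> real) \<Rightarrow> bool" where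
  "in_Lp q M f \<longleftrightarrow> f \<in> borel_measurable M \<and> integrable M (\<lambda>x. \<bar>f x\<bar> powr q)"

definition locally_integrable_on :: "('a::euclidean_space \<Rightarrow> real) \<Rightarrow> 'a set \<Rightarrow> bool" where
  "locally_integrable_on f U \<longleftrightarrow> (\<forall>K. compact K \<and> K \<subseteq> U \<longrightarrow> f absolutely_integrable_on K)"

text \<open>\<open>g\<close> is the distributional derivative of \<open>f\<close> on the open set \<open>U\<close> in direction \<open>v\<close>.\<close>

definition weak_dir_deriv_on ::
  "'a::euclidean_space set \<Rightarrow> 'a \<Rightarrow> ('a \<Rightarrow> real) \<Rightarrow> ('a \<Rightarrow> real) \<Rightarrow> bool" where
  "weak_dir_deriv_on U v f g \<longleftrightarrow>
     locally_integrable_on f U \<and> locally_integrable_on g U \<and>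
     (\<forall>\<phi>\<in>test_functions U.
        (LINT x:U|lebesgue. f x * dir_deriv v \<phi> x) = - (LINT x:U|lebesgue. g x * \<phi> x))"

text \<open>
  The Sobolev--Slobodetskii space on the whole space, for \<open>0 < s < 1 \<le> q\<close>.
\<close>

definition in_Wsq :: "real \<Rightarrow> real \<Rightarrow> ('a::euclidean_space \<Rightarrow> real) \<Rightarrow> bool" where
  "in_Wsq s q v \<longleftrightarrow>
     in_Lp q lebesgue v \<and>
     (\<integral>\<^sup>+y. \<integral>\<^sup>+z. ennreal (\<bar>v y - v z\<bar> powr q * norm (y - z) powr (- (real DIM('a) + s * q)))
        \<partial>lebesgue \<partial>lebesgue) < \<infinity>"

definition in_Wsq_loc :: "real \<Rightarrow> real \<Rightarrow> 'a::euclidean_space set \<Rightarrow> ('a \<Rightarrow> real) \<Rightarrow> bool" where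
  "in_Wsq_loc s q U v \<longleftrightarrow> (\<forall>\<phi>\<in>test_functions U. in_Wsq s q (\<lambda>x. \<phi> x * v x))"


section \<open>Entropy solutions\<close>

text \<open>Points of time-space are triples \<open>(t, x\<^sub>1, x\<^sub>2)\<close>.\<close>

type_synonym txx = "real \<times> real \<times> real"

definition halfspace :: "txx set" where
  "halfspace = {0<..} \<times> UNIV"

abbreviation e_t :: txx where "e_t \<equiv> (1, 0, 0)"
abbreviation e_1 :: txx where "e_1 \<equiv> (0, 1, 0)"
abbreviation e_2 :: txx where "e_2 \<equiv> (0, 0, 1)"

text \<open>The direction of the operator \<open>D = \<partial>\<^sub>x\<^sub>1 - \<partial>\<^sub>x\<^sub>2\<close>.\<close>

abbreviation e_D :: txx where "e_D \<equiv> e_1 - e_2"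

definition Sigma_psi :: "nat \<Rightarrow> (real \<Rightarrow> real) \<Rightarrow> real \<Rightarrow> real" where
  "Sigma_psi n \<psi> a = (LBINT w=ereal 0..ereal a. sqrt (\<psi> w) * \<bar>w\<bar> powr (real n / 2))"

text \<open>
  Test functions in \<open>C\<^sub>c\<^sup>\<infinity>([0,\<infinity>) \<times> \<real>\<^sup>2)\<close> are the restrictions of elements of \<open>C\<^sub>c\<^sup>\<infinity>(\<real>\<^sup>3)\<close>; they need
  not vanish at \<open>t = 0\<close>.  The inequality is the distributional form of
  \<open>\<partial>\<^sub>t S(u) + (\<partial>\<^sub>x\<^sub>1 + \<partial>\<^sub>x\<^sub>2) Q(u) - D\<^sup>2 R(u) \<le> - h\<^sup>2\<close> with initial data \<open>S(u\<^sub>0)\<close>, all derivatives and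
  the initial term moved to the right.
\<close>

definition entropy_ineq ::
  "(real \<Rightarrow> real) \<Rightarrow> (real \<Rightarrow> real) \<Rightarrow> (real \<Rightarrow> real) \<Rightarrow> (txx \<Rightarrow> real) \<Rightarrow>
   (real \<times> real \<Rightarrow> real) \<Rightarrow> (txx \<Rightarrow> real) \<Rightarrow> bool" where
  "entropy_ineq S Q R h u0 u \<longleftrightarrow>
     (\<forall>\<phi>\<in>Cinf_compact. (\<forall>p. 0 \<le> fst p \<longrightarrow> 0 \<le> \<phi> p) \<longrightarrow>
        (LINT p:halfspace|lebesgue. (h p)\<^sup>2 * \<phi> p)
        \<le> (LINT p:halfspace|lebesgue.
             S (u p) * dir_deriv e_t \<phi> p
             + Q (u p) * (dir_deriv e_1 \<phi> p + dir_deriv e_2 \<phi> p)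
             + R (u p) * dir_deriv e_D (dir_deriv e_D \<phi>) p)
          + (LINT x|lebesgue. S (u0 x) * \<phi> (0, x)))"

text \<open>
  Here \<open>g\<close> is \<open>D \<Sigma>(u)\<close>, and \<open>h\<close> is \<open>D \<Sigma>\<^sup>\<psi>(u)\<close> for \<open>\<psi> = S''\<close>; both are unique almost everywhere.
\<close>

definition entropy_solution ::
  "nat \<Rightarrow> nat \<Rightarrow> (real \<times> real \<Rightarrow> real) \<Rightarrow> (txx \<Rightarrow> real) \<Rightarrow> bool" where
  "entropy_solution l n u0 u \<longleftrightarrow>
     in_Linf (lebesgue_on halfspace) u \<and>
     (\<exists>C. AE t in lebesgue_on {0<..}.
        integrable lebesgue (\<lambda>x. u (t, x)) \<and> (LINT x|lebesgue. \<bar>u (t, x)\<bar>) \<le> C) \<and>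
     (\<exists>g. in_Lp 2 (lebesgue_on halfspace) g \<and>
        weak_dir_deriv_on halfspace e_D (\<lambda>p. Sigma_psi n (\<lambda>_. 1) (u p)) g \<and>
        (\<forall>\<psi>. continuous_on UNIV \<psi> \<and> (\<forall>w. 0 \<le> \<psi> w) \<longrightarrow>
           weak_dir_deriv_on halfspace e_D (\<lambda>p. Sigma_psi n \<psi> (u p)) (\<lambda>p. sqrt (\<psi> (u p)) * g p))) \<and>
     (\<forall>S S' S'' Q R.
        convex_on UNIV S \<and>
        (\<forall>a. (S has_real_derivative S' a) (at a)) \<and>
        (\<forall>a. (S' has_real_derivative S'' a) (at a)) \<and>
        continuous_on UNIV S'' \<and>
        (\<forall>a. (Q has_real_derivative S' a * a ^ l) (at a)) \<and>
        (\<forall>a. (R has_real_derivative S' a * \<bar>a\<bar> ^ n) (at a)) \<longrightarrow>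
        (\<exists>h. weak_dir_deriv_on halfspace e_D (\<lambda>p. Sigma_psi n S'' (u p)) h \<and>
           entropy_ineq S Q R h u0 u))"

end

theory Submission
  imports Defs
begin

text \<open>
  Write \<open>\<partial>\<^sub>\<xi> = \<partial>\<^sub>x\<^sub>1 + \<partial>\<^sub>x\<^sub>2\<close>.  The proof is by compensated compactness with two power entropies, in the
  spirit of Tartar, and not by velocity averaging.

  Let \<open>S\<^sub>1, S\<^sub>2\<close> be the entropies with \<open>S\<^sub>1' = a\<^bsup>2n\<^esup>\<close> and \<open>S\<^sub>2' = a\<^bsup>2n+l\<^esup>\<close>, with fluxes \<open>Q\<^sub>1 = S\<^sub>2\<close> and
  \<open>Q\<^sub>2\<close>, \<open>Q\<^sub>2' = a\<^bsup>2n+2l\<^esup>\<close>.  A \<open>C\<^sup>2\<close> entropy is a difference of two convex ones, so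
  \<open>\<partial>\<^sub>t S\<^sub>i(u) + \<partial>\<^sub>\<xi> Q\<^sub>i(u) - D\<^sup>2 R\<^sub>i(u)\<close> is a signed measure that is finite on compact sets
  (\<open>balanced_entropy\<close>).  As \<open>S\<^sub>i'\<close> and \<open>Q\<^sub>i'\<close> vanish at \<open>0\<close> to the order \<open>2n\<close> at least, the chain rule gives
  \<open>D S\<^sub>i(u), D Q\<^sub>i(u), D R\<^sub>i(u) \<in> L\<^sup>2\<close>, although \<open>D u\<close> need not be square integrable
  (\<open>D_regular_comp\<close>).

  Let \<open>\<zeta>\<close> be a cutoff, and consider the correlation
  \<open>\<Psi>(z) = \<integral> (\<zeta> S\<^sub>1(u))(q + z) (\<zeta> Q\<^sub>2(u))(q) - (\<zeta> Q\<^sub>1(u))(q + z) (\<zeta> S\<^sub>2(u))(q) dq\<close>.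
  If a balance law is tested at the point \<open>p\<close> with \<open>\<zeta>(p) \<theta>(p - q)\<close> and the result is multiplied by
  \<open>\<zeta> S\<^sub>j(u)\<close> or \<open>\<zeta> Q\<^sub>j(u)\<close> at the point \<open>q\<close> and integrated over \<open>q\<close>, then the measure contributes at most a constant
  times \<open>\<integral> \<theta>\<close>; so do the second order terms, because one \<open>D\<close> can be moved to each of the two factors
  (\<open>balance_first\<close>, \<open>balance_second\<close>).  In the antisymmetric combination \<open>\<Psi>\<close> the remaining first
  order terms cancel, both when \<open>\<Psi>\<close> is differentiated in \<open>t\<close> and when it is differentiated in \<open>\<xi>\<close>
  (\<open>cross_bounded\<close>).  Thus all weak first derivatives of \<open>\<Psi>\<close> are bounded, and \<open>\<Psi>\<close> is Lipschitz.

  The second difference \<open>2 \<Psi>(0) - \<Psi>(z) - \<Psi>(-z)\<close> is the integral of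
  \<open>\<Delta>S\<^sub>1 \<Delta>Q\<^sub>2 - \<Delta>Q\<^sub>1 \<Delta>S\<^sub>2\<close> (with cutoffs), where \<open>\<Delta>\<close> is the difference between \<open>q + z\<close> and \<open>q\<close>.
  This is the deficit in the Cauchy--Schwarz inequality for \<open>1\<close> and \<open>a\<^sup>l\<close> with the weight \<open>a\<^bsup>2n\<^esup>\<close> on
  the interval between the two values of \<open>u\<close>, and it is at least \<open>c \<bar>\<Delta>u\<bar>\<^sup>N\<close> with \<open>N = 4n + 2l + 2\<close>
  (\<open>gap_lower\<close>).  Hence \<open>\<integral> \<bar>\<phi>u(q + z) - \<phi>u(q)\<bar>\<^sup>N dq \<le> C \<bar>z\<bar>\<close> for every test function \<open>\<phi>\<close>
  (\<open>local_Nikolskii\<close>), and \<open>\<phi>u\<close> lies in the Slobodetskii space with parameters \<open>s, q\<close> whenever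
  \<open>s < 1/N\<close> and \<open>1 \<le> q \<le> N\<close> (\<open>in_Wsq_if_Nikolskii\<close>).  This range contains the one of the theorem,
  since \<open>2 s\<^sub>* < 1/N\<close> and \<open>q\<^sub>* \<le> 2\<close>.
\<close>

section \<open>Smooth functions and test functions\<close>

definition smooth :: "('a::euclidean_space \<Rightarrow> real) \<Rightarrow> bool" where
  "smooth f \<longleftrightarrow> (\<forall>k. Ck k f)"

lemma dir_deriv_eq:
  assumes "(f has_derivative F) (at x)"
  shows "dir_deriv v f x = F v"
  using frechet_derivative_at[OF assms] by (simp add: dir_deriv_def)

lemma Ck_SucD: "Ck (Suc k) f \<Longrightarrow> Ck k f"
proof (induction k arbitrary: f)
  case 0
  then show ?case
    by (auto intro!: differentiable_imp_continuous_on simp: differentiable_on_def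
        intro: differentiable_at_withinI)
qed auto

text \<open>
  Smoothness by coinduction: a class of functions that is closed under partial derivatives consists
  of smooth functions.
\<close>

lemma Ck_coinduct:
  assumes step: "\<And>f. P f \<Longrightarrow> (\<forall>x. f differentiable (at x)) \<and> (\<forall>b\<in>Basis. P (dir_deriv b f))"
    and "P f"
  shows "smooth f"
proof -
  have "P f \<Longrightarrow> Ck k f" for k f
  proof (induction k arbitrary: f)
    case 0
    then show ?case using step[of f]
      by (auto intro!: differentiable_imp_continuous_on simp: differentiable_on_def
          intro: differentiable_at_withinI)
  next
    case (Suc k)
    then show ?case using step[of f] by auto
  qed
  with assms(2) show ?thesis by (simp add: smooth_def)
qed

lemma smooth_differentiable: "smooth f \<Longrightarrow> f differentiable (at x)"
  unfolding smooth_def by (metis Ck.simps(2))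

lemma smooth_has_derivative: "smooth f \<Longrightarrow> (f has_derivative (\<lambda>v. dir_deriv v f x)) (at x)"
  unfolding dir_deriv_def using smooth_differentiable[of f x]
  by (simp add: frechet_derivative_works)

lemma smooth_continuous: "smooth f \<Longrightarrow> continuous_on A f"
  unfolding smooth_def using Ck.simps(1) continuous_on_subset by blast

lemma smooth_dir_deriv_Basis: "smooth f \<Longrightarrow> b \<in> Basis \<Longrightarrow> smooth (dir_deriv b f)"
  unfolding smooth_def by (metis Ck.simps(2))

lemma Ck_const: "Ck k (\<lambda>_. c)"
proof (induction k arbitrary: c)
  case (Suc k)
  have "dir_deriv b (\<lambda>_. c) = (\<lambda>_. 0)" for b :: 'a
    by (rule ext, rule dir_deriv_eq[OF has_derivative_const])
  then show ?case using Suc by simp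
qed simp

lemma Ck_add: "Ck k f \<Longrightarrow> Ck k g \<Longrightarrow> Ck k (\<lambda>x. f x + g x)"
proof (induction k arbitrary: f g)
  case 0 then show ?case by (auto intro: continuous_intros)
next
  case (Suc k)
  have "dir_deriv b (\<lambda>x. f x + g x) = (\<lambda>x. dir_deriv b f x + dir_deriv b g x)" for b
  proof
    fix x
    have "(f has_derivative (\<lambda>v. dir_deriv v f x)) (at x)" "(g has_derivative (\<lambda>v. dir_deriv v g x)) (at x)"
      using Suc.prems unfolding dir_deriv_def by (auto simp: frechet_derivative_works)
    from dir_deriv_eq[OF has_derivative_add[OF this]]
    show "dir_deriv b (\<lambda>x. f x + g x) x = dir_deriv b f x + dir_deriv b g x" .
  qed
  then show ?case using Suc by auto
qed

lemma Ck_mult: "Ck k f \<Longrightarrow> Ck k g \<Longrightarrow> Ck k (\<lambda>x. f x * g x)"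
proof (induction k arbitrary: f g)
  case 0 then show ?case by (auto intro: continuous_intros)
next
  case (Suc k)
  have "dir_deriv b (\<lambda>x. f x * g x) = (\<lambda>x. f x * dir_deriv b g x + dir_deriv b f x * g x)" for b
  proof
    fix x
    have "(f has_derivative (\<lambda>v. dir_deriv v f x)) (at x)" "(g has_derivative (\<lambda>v. dir_deriv v g x)) (at x)"
      using Suc.prems unfolding dir_deriv_def by (auto simp: frechet_derivative_works)
    from dir_deriv_eq[OF has_derivative_mult[OF this]]
    show "dir_deriv b (\<lambda>x. f x * g x) x = f x * dir_deriv b g x + dir_deriv b f x * g x" .
  qed
  moreover have "Ck k f" "Ck k g" using Suc.prems Ck_SucD by blast+
  ultimately show ?case using Suc.prems by (simp add: Ck_add Suc.IH)
qed

lemma Ck_affine: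
  "Ck k f \<Longrightarrow> Ck k (\<lambda>x. f (c *\<^sub>R x + a))"
proof (induction k arbitrary: f)
  case 0 then show ?case
    by (auto intro!: continuous_on_compose2[of UNIV f] continuous_intros)
next
  case (Suc k)
  have D: "((\<lambda>x. f (c *\<^sub>R x + a)) has_derivative (\<lambda>v. c * dir_deriv v f (c *\<^sub>R x + a))) (at x)" for x
  proof -
    have f: "(f has_derivative (\<lambda>v. dir_deriv v f (c *\<^sub>R x + a))) (at (c *\<^sub>R x + a))"
      using Suc.prems unfolding dir_deriv_def by (auto simp: frechet_derivative_works)
    have "((\<lambda>x. f (c *\<^sub>R x + a)) has_derivative (\<lambda>v. dir_deriv (c *\<^sub>R v) f (c *\<^sub>R x + a))) (at x)"
      by (rule has_derivative_compose[of "\<lambda>x. c *\<^sub>R x + a" "\<lambda>v. c *\<^sub>R v" x UNIV f, OF _ f])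
         (auto intro!: derivative_eq_intros)
    moreover have "dir_deriv (c *\<^sub>R v) f (c *\<^sub>R x + a) = c * dir_deriv v f (c *\<^sub>R x + a)" for v
      using linear_cmul[OF has_derivative_linear[OF f]] by simp
    ultimately show ?thesis by simp
  qed
  have "dir_deriv b (\<lambda>x. f (c *\<^sub>R x + a)) = (\<lambda>x. c * dir_deriv b f (c *\<^sub>R x + a))" for b
    by (rule ext, rule dir_deriv_eq[OF D])
  moreover have "(\<lambda>x. f (c *\<^sub>R x + a)) differentiable (at x)" for x
    using D differentiable_def by blast
  ultimately show ?case using Suc.prems
    by (simp add: Ck_mult Ck_const Suc.IH)
qed

lemma Ck_compose:
  fixes g :: "real \<Rightarrow> real"
  shows "Ck k g \<Longrightarrow> Ck k w \<Longrightarrow> Ck k (\<lambda>x. g (w x))"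
proof (induction k arbitrary: g)
  case 0 then show ?case
    by (auto intro!: continuous_on_compose2[of UNIV g])
next
  case (Suc k)
  have D: "((\<lambda>x. g (w x)) has_derivative (\<lambda>v. dir_deriv 1 g (w x) * dir_deriv v w x)) (at x)" for x
  proof -
    have g: "(g has_derivative (\<lambda>v. dir_deriv v g (w x))) (at (w x))"
      using Suc.prems unfolding dir_deriv_def by (auto simp: frechet_derivative_works)
    have w: "(w has_derivative (\<lambda>v. dir_deriv v w x)) (at x)"
      using Suc.prems unfolding dir_deriv_def by (auto simp: frechet_derivative_works)
    have "(\<lambda>v. dir_deriv (dir_deriv v w x) g (w x)) = (\<lambda>v. dir_deriv 1 g (w x) * dir_deriv v w x)"
    proof
      fix v
      show "dir_deriv (dir_deriv v w x) g (w x) = dir_deriv 1 g (w x) * dir_deriv v w x"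
        using linear_cmul[OF has_derivative_linear[OF g], of "dir_deriv v w x" 1]
        by (simp only: real_scaleR_def mult_1_right mult.commute[of "dir_deriv 1 g (w x)"])
    qed
    with has_derivative_compose[OF w g] show ?thesis by simp
  qed
  have "dir_deriv b (\<lambda>x. g (w x)) = (\<lambda>x. dir_deriv 1 g (w x) * dir_deriv b w x)" for b
    by (rule ext, rule dir_deriv_eq[OF D])
  moreover have "Ck k w" using Suc.prems Ck_SucD by blast
  moreover have "(\<lambda>x. g (w x)) differentiable (at x)" for x
    using D differentiable_def by blast
  ultimately show ?case using Suc.prems
    by (simp add: Ck_mult Suc.IH)
qed

lemma smooth_const [simp]: "smooth (\<lambda>_. c)"
  by (simp add: smooth_def Ck_const)
lemma smooth_add: "smooth f \<Longrightarrow> smooth g \<Longrightarrow> smooth (\<lambda>x. f x + g x)"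
  by (simp add: smooth_def Ck_add)
lemma smooth_mult: "smooth f \<Longrightarrow> smooth g \<Longrightarrow> smooth (\<lambda>x. f x * g x)"
  by (simp add: smooth_def Ck_mult)
lemma smooth_affine: "smooth f \<Longrightarrow> smooth (\<lambda>x. f (c *\<^sub>R x + a))"
  by (simp add: smooth_def Ck_affine)
lemma smooth_compose:
  fixes g :: "real \<Rightarrow> real"
  shows "smooth g \<Longrightarrow> smooth w \<Longrightarrow> smooth (\<lambda>x. g (w x))"
  by (simp add: smooth_def Ck_compose)
lemma smooth_sum: "(\<And>i. i \<in> I \<Longrightarrow> smooth (f i)) \<Longrightarrow> smooth (\<lambda>x. \<Sum>i\<in>I. f i x)"
  by (induction I rule: infinite_finite_induct) (auto intro: smooth_add)
lemma smooth_reflect: "smooth f \<Longrightarrow> smooth (\<lambda>x. f (p - x))"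
  using smooth_affine[of f "-1" p] by simp
lemma smooth_translate: "smooth f \<Longrightarrow> smooth (\<lambda>x. f (x - p))"
  using smooth_affine[of f 1 "-p"] by simp

lemma smooth_inner: "smooth (\<lambda>x. x \<bullet> a)"
proof -
  have "dir_deriv b (\<lambda>x. x \<bullet> a) = (\<lambda>_. b \<bullet> a)" for b :: 'a
    by (rule ext, rule dir_deriv_eq) (auto intro!: derivative_eq_intros)
  moreover have "(\<lambda>x. x \<bullet> a) differentiable (at x)" for x :: 'a
    unfolding differentiable_def by (rule exI) (auto intro!: derivative_eq_intros)
  ultimately have "Ck k (\<lambda>x. x \<bullet> a)" for k
    by (cases k) (auto intro!: Ck_const continuous_intros)
  then show ?thesis by (simp add: smooth_def)
qed

lemma dir_deriv_add_vec: "smooth f \<Longrightarrow> dir_deriv (v + w) f x = dir_deriv v f x + dir_deriv w f x"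
  using linear_add[OF has_derivative_linear[OF smooth_has_derivative]] by blast

lemma dir_deriv_scaleR_vec: "smooth f \<Longrightarrow> dir_deriv (c *\<^sub>R v) f x = c * dir_deriv v f x"
  using linear_cmul[OF has_derivative_linear[OF smooth_has_derivative, of f x], of c v] by simp

text \<open>
  The definition of \<open>Ck\<close> iterates coordinate derivatives; other directions, such as \<open>e_D\<close>, are reached
  because the Frechet derivative is linear in the direction.
\<close>

lemma smooth_dir_deriv: 
  fixes f :: "'a::euclidean_space \<Rightarrow> real"
  assumes "smooth f" shows "smooth (dir_deriv v f)"
proof -
  have "dir_deriv v f x = (\<Sum>b\<in>Basis. (v \<bullet> b) * dir_deriv b f x)" for x
  proof -
    have "dir_deriv (\<Sum>b\<in>Basis. (v \<bullet> b) *\<^sub>R b) f x = (\<Sum>b\<in>Basis. (v \<bullet> b) * dir_deriv b f x)"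
      using linear_sum[OF has_derivative_linear[OF smooth_has_derivative[OF assms]], of "\<lambda>b. (v \<bullet> b) *\<^sub>R b" Basis x]
      by (simp add: dir_deriv_scaleR_vec[OF assms])
    then show ?thesis by (simp add: euclidean_representation)
  qed
  then have "dir_deriv v f = (\<lambda>x. \<Sum>b\<in>Basis. (v \<bullet> b) * dir_deriv b f x)" by blast
  then show ?thesis
    by (simp add: assms smooth_sum smooth_mult smooth_dir_deriv_Basis)
qed

lemma dir_deriv_mult:
  "smooth f \<Longrightarrow> smooth g \<Longrightarrow> dir_deriv v (\<lambda>x. f x * g x) x = dir_deriv v f x * g x + f x * dir_deriv v g x"
  by (simp add: dir_deriv_eq[OF has_derivative_mult[OF smooth_has_derivative smooth_has_derivative]])

lemma dir_deriv_add:
  "smooth f \<Longrightarrow> smooth g \<Longrightarrow> dir_deriv v (\<lambda>x. f x + g x) x = dir_deriv v f x + dir_deriv v g x"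
  by (simp add: dir_deriv_eq[OF has_derivative_add[OF smooth_has_derivative smooth_has_derivative]])

lemma dir_deriv_reflect:
  assumes "smooth f" shows "dir_deriv v (\<lambda>x. f (p - x)) x = - dir_deriv v f (p - x)"
proof -
  have "((\<lambda>x. f (p - x)) has_derivative (\<lambda>v. dir_deriv (-v) f (p - x))) (at x)"
    by (rule has_derivative_compose[of "\<lambda>x. p - x" "\<lambda>v. - v" x UNIV f, OF _ smooth_has_derivative[OF assms]])
       (auto intro!: derivative_eq_intros)
  from dir_deriv_eq[OF this] dir_deriv_scaleR_vec[OF assms, of "-1" v]
  show ?thesis by simp
qed

lemma dir_deriv_translate:
  assumes "smooth f" shows "dir_deriv v (\<lambda>x. f (x - p)) x = dir_deriv v f (x - p)"
proof -
  have "((\<lambda>x. f (x - p)) has_derivative (\<lambda>v. dir_deriv v f (x - p))) (at x)"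
    by (rule has_derivative_compose[of "\<lambda>x. x - p" "\<lambda>v. v" x UNIV f, OF _ smooth_has_derivative[OF assms]])
       (auto intro!: derivative_eq_intros)
  from dir_deriv_eq[OF this] show ?thesis by simp
qed

lemma Cinf_compact_iff: "\<phi> \<in> Cinf_compact \<longleftrightarrow> smooth \<phi> \<and> bounded {x. \<phi> x \<noteq> 0}"
  by (simp add: Cinf_compact_def smooth_def compact_closure)

lemma test_functions_iff: "\<phi> \<in> test_functions U \<longleftrightarrow> \<phi> \<in> Cinf_compact \<and> closure {x. \<phi> x \<noteq> 0} \<subseteq> U"
  by (simp add: test_functions_def)

lemma test_functions_UNIV: "test_functions UNIV = Cinf_compact"
  by (simp add: test_functions_def)

lemma test_functions_smooth: "\<phi> \<in> test_functions U \<Longrightarrow> smooth \<phi>"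
  by (simp add: test_functions_iff Cinf_compact_iff)

text \<open>
  Products and derivatives of test functions stay test functions because their supports do not grow.
\<close>

lemma test_functions_sub:
  assumes "\<phi> \<in> test_functions U" "smooth \<psi>" "{x. \<psi> x \<noteq> 0} \<subseteq> closure {x. \<phi> x \<noteq> 0}"
  shows "\<psi> \<in> test_functions U"
proof -
  have "closure {x. \<psi> x \<noteq> 0} \<subseteq> closure {x. \<phi> x \<noteq> 0}"
    using assms(3) closure_minimal by blast
  moreover have "bounded {x. \<psi> x \<noteq> 0}"
    using assms bounded_subset[OF bounded_closure assms(3)]
    by (auto simp: test_functions_iff Cinf_compact_iff)
  ultimately show ?thesis using assms by (auto simp: test_functions_iff Cinf_compact_iff)
qed

lemma test_functions_outside: "\<phi> \<in> test_functions U \<Longrightarrow> x \<notin> U \<Longrightarrow> \<phi> x = 0"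
  using closure_subset[of "{x. \<phi> x \<noteq> 0}"] by (auto simp: test_functions_iff)

lemma test_functions_mult: "\<phi> \<in> test_functions U \<Longrightarrow> smooth \<psi> \<Longrightarrow> (\<lambda>x. \<phi> x * \<psi> x) \<in> test_functions U"
  by (rule test_functions_sub[of \<phi>])
     (auto intro!: smooth_mult simp: test_functions_smooth intro: subsetD[OF closure_subset])

lemma test_functions_add:
  assumes "\<phi> \<in> test_functions U" "\<psi> \<in> test_functions U" shows "(\<lambda>x. \<phi> x + \<psi> x) \<in> test_functions U"
proof -
  have sub: "{x. \<phi> x + \<psi> x \<noteq> 0} \<subseteq> {x. \<phi> x \<noteq> 0} \<union> {x. \<psi> x \<noteq> 0}" by auto
  have "closure {x. \<phi> x + \<psi> x \<noteq> 0} \<subseteq> closure {x. \<phi> x \<noteq> 0} \<union> closure {x. \<psi> x \<noteq> 0}"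
    using closure_mono[OF sub] by (simp add: closure_Un)
  moreover have "bounded {x. \<phi> x + \<psi> x \<noteq> 0}"
    using assms bounded_subset[OF _ sub] by (auto simp: test_functions_iff Cinf_compact_iff)
  ultimately show ?thesis using assms
    by (auto simp: test_functions_iff Cinf_compact_iff intro: smooth_add)
qed

lemma test_functions_dir_deriv:
  assumes "\<phi> \<in> test_functions U" shows "dir_deriv v \<phi> \<in> test_functions U"
proof (rule test_functions_sub[OF assms smooth_dir_deriv])
  show "smooth \<phi>" using assms by (rule test_functions_smooth)
  show "{x. dir_deriv v \<phi> x \<noteq> 0} \<subseteq> closure {x. \<phi> x \<noteq> 0}"
  proof (rule ccontr)
    assume "\<not> ?thesis"
    then obtain x where x: "dir_deriv v \<phi> x \<noteq> 0" "x \<in> - closure {x. \<phi> x \<noteq> 0}" by auto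
    have "((\<lambda>_. 0) has_derivative (\<lambda>_. 0)) (at x)" by simp
    moreover have "0 = \<phi> y" if "y \<in> - closure {x. \<phi> x \<noteq> 0}" for y
      using that closure_subset[of "{x. \<phi> x \<noteq> 0}"] by auto
    ultimately have "(\<phi> has_derivative (\<lambda>_. 0)) (at x)"
      using has_derivative_transform_within_open[OF _ open_Compl[OF closed_closure] x(2)] by blast
    from dir_deriv_eq[OF this] x(1) show False by simp
  qed
qed

lemma Cinf_compact_smooth: "\<phi> \<in> Cinf_compact \<Longrightarrow> smooth \<phi>"
  by (simp add: Cinf_compact_iff)

lemma Cinf_compact_dir_deriv: "\<phi> \<in> Cinf_compact \<Longrightarrow> dir_deriv v \<phi> \<in> Cinf_compact"
  using test_functions_dir_deriv[of \<phi> UNIV] by (simp add: test_functions_UNIV)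

lemma Cinf_compact_translate:
  assumes "\<phi> \<in> Cinf_compact" shows "(\<lambda>x. \<phi> (x - p)) \<in> Cinf_compact"
proof -
  have "{x. \<phi> (x - p) \<noteq> 0} \<subseteq> (+) p ` {x. \<phi> x \<noteq> 0}"
  proof
    fix x assume "x \<in> {x. \<phi> (x - p) \<noteq> 0}"
    then show "x \<in> (+) p ` {x. \<phi> x \<noteq> 0}" by (intro image_eqI[of _ _ "x - p"]) auto
  qed
  then show ?thesis using assms
    by (auto simp: Cinf_compact_iff smooth_translate intro: bounded_subset[OF bounded_translation])
qed

lemma Cinf_compact_reflect:
  assumes "\<phi> \<in> Cinf_compact" shows "(\<lambda>x. \<phi> (p - x)) \<in> Cinf_compact"
proof -
  have "{x. \<phi> (p - x) \<noteq> 0} \<subseteq> (\<lambda>x. p - x) ` {x. \<phi> x \<noteq> 0}"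
  proof
    fix x assume "x \<in> {x. \<phi> (p - x) \<noteq> 0}"
    then show "x \<in> (\<lambda>x. p - x) ` {x. \<phi> x \<noteq> 0}" by (intro image_eqI[of _ _ "p - x"]) auto
  qed
  moreover have "bounded ((\<lambda>x. p - x) ` {x. \<phi> x \<noteq> 0})"
    using assms by (intro bounded_minus_comp) (auto simp: Cinf_compact_iff image_constant_conv)
  ultimately show ?thesis using assms
    by (auto simp: Cinf_compact_iff smooth_reflect intro: bounded_subset)
qed

section \<open>Bump functions and cutoffs\<close>

text \<open>
  The functions \<open>p(1/x) exp(-1/x)\<close>, extended by zero to \<open>x \<le> 0\<close>, form a class that is closed under
  differentiation.  Their smoothness thus follows from \<open>Ck_coinduct\<close> without a formula for the
  higher derivatives of \<open>exp(-1/x)\<close>.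
\<close>

definition flat_exp :: "real poly \<Rightarrow> real \<Rightarrow> real" where
  "flat_exp p x = (if x > 0 then poly p (1 / x) * exp (- (1 / x)) else 0)"

lemma poly_div_exp_tendsto_0: "((\<lambda>y. poly p y / exp y) \<longlongrightarrow> 0) (at_top :: real filter)"
proof -
  have "((\<lambda>y. \<Sum>i\<le>degree p. coeff p i * (y ^ i / exp y)) \<longlongrightarrow> (\<Sum>i\<le>degree p. coeff p i * 0)) (at_top :: real filter)"
    by (intro tendsto_intros tendsto_power_div_exp_0)
  moreover have "(\<Sum>i\<le>degree p. coeff p i * (y ^ i / exp y)) = poly p y / exp y" for y
    unfolding poly_altdef sum_divide_distrib by simp
  ultimately show ?thesis by simp
qed

text \<open>
  With \<open>y = 1/x\<close> the derivative of \<open>p(y) exp(-y)\<close> is \<open>y\<^sup>2 (p(y) - p'(y)) exp(-y)\<close>; at the origin the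
  difference quotient from the right is \<open>y p(y) exp(-y)\<close>, which tends to \<open>0\<close>.
\<close>

lemma flat_exp_has_derivative:
  "(flat_exp p has_real_derivative flat_exp ([:0, 0, 1:] * (p - pderiv p)) x) (at x)"
proof (cases x "0::real" rule: linorder_cases)
  case less
  have "((\<lambda>_. 0) has_real_derivative 0) (at x)" by simp
  then have "(flat_exp p has_real_derivative 0) (at x)"
    by (rule has_field_derivative_transform_within_open[of _ _ _ "{..<0}"])
       (use less in \<open>auto simp: flat_exp_def\<close>)
  then show ?thesis using less by (simp add: flat_exp_def)
next
  case greater
  have "((\<lambda>x. poly p (1 / x) * exp (- (1 / x))) has_real_derivative
     flat_exp ([:0, 0, 1:] * (p - pderiv p)) x) (at x)"
    using greater
    by (auto intro!: derivative_eq_intros simp: flat_exp_def field_simps power2_eq_square)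
  then show ?thesis
    by (rule has_field_derivative_transform_within_open[of _ _ _ "{0<..}"])
       (use greater in \<open>auto simp: flat_exp_def\<close>)
next
  case equal
  have "((\<lambda>h. flat_exp p h / h) \<longlongrightarrow> 0) (at 0)"
  proof (rule filterlim_split_at)
    show "((\<lambda>h. flat_exp p h / h) \<longlongrightarrow> 0) (at_left 0)"
      by (rule tendsto_eventually) (auto simp: eventually_at_filter flat_exp_def)
    have "((\<lambda>h. poly (pCons 0 p) (inverse h) / exp (inverse h)) \<longlongrightarrow> 0) (at_right (0::real))"
      by (rule filterlim_compose[OF poly_div_exp_tendsto_0 filterlim_inverse_at_top_right])
    then show "((\<lambda>h. flat_exp p h / h) \<longlongrightarrow> 0) (at_right 0)"
      by (rule Lim_transform_eventually)
         (auto simp: eventually_at_filter flat_exp_def exp_minus field_simps)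
  qed
  then show ?thesis using equal by (simp add: DERIV_def flat_exp_def)
qed

lemma smooth_flat_exp: "smooth (flat_exp p)"
proof (rule Ck_coinduct[of "\<lambda>f. \<exists>p. f = flat_exp p"])
  fix f assume "\<exists>p. f = flat_exp p"
  then obtain p where f: "f = flat_exp p" by blast
  have "dir_deriv 1 f = flat_exp ([:0, 0, 1:] * (p - pderiv p))"
  proof
    fix x
    show "dir_deriv 1 f x = flat_exp ([:0, 0, 1:] * (p - pderiv p)) x"
      unfolding f
      using dir_deriv_eq[OF flat_exp_has_derivative[unfolded has_field_derivative_def], of 1 p x] by simp
  qed
  moreover have "f differentiable (at x)" for x
    unfolding f using flat_exp_has_derivative[of p x]
    by (auto simp: has_field_derivative_def differentiable_def)
  ultimately show "(\<forall>x. f differentiable at x) \<and> (\<forall>b\<in>Basis. \<exists>p. dir_deriv b f = flat_exp p)"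
    by auto
qed auto

lemma exists_bump:
  fixes a :: "'a::euclidean_space"
  assumes "r > 0"
  obtains \<beta> where "\<beta> \<in> Cinf_compact" "\<And>x. 0 \<le> \<beta> x" "\<And>x. \<beta> x > 0 \<longleftrightarrow> x \<in> ball a r"
proof
  define w where "w x = r\<^sup>2 + (- 1) * (\<Sum>b\<in>Basis. (x \<bullet> b + - (a \<bullet> b)) * (x \<bullet> b + - (a \<bullet> b)))" for x
  define \<beta> where "\<beta> x = flat_exp 1 (w x)" for x
  have w: "w x = r\<^sup>2 - (dist a x)\<^sup>2" for x
  proof -
    have "(dist a x)\<^sup>2 = (x - a) \<bullet> (x - a)"
      by (metis dist_commute dist_norm power2_norm_eq_inner)
    also have "\<dots> = (\<Sum>b\<in>Basis. ((x - a) \<bullet> b) * ((x - a) \<bullet> b))" by (rule euclidean_inner)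
    finally show ?thesis by (simp add: inner_diff_left w_def)
  qed
  show pos: "\<beta> x > 0 \<longleftrightarrow> x \<in> ball a r" for x
    using assms power2_less_imp_less[of "dist a x" r] power_strict_mono[of "dist a x" r 2]
    by (auto simp: flat_exp_def \<beta>_def w)
  show nonneg: "0 \<le> \<beta> x" for x by (simp add: flat_exp_def \<beta>_def)
  have "{x. \<beta> x \<noteq> 0} \<subseteq> ball a r"
  proof
    fix x assume "x \<in> {x. \<beta> x \<noteq> 0}"
    then show "x \<in> ball a r" using pos[of x] nonneg[of x] by auto
  qed
  then have "bounded {x. \<beta> x \<noteq> 0}" using bounded_ball bounded_subset by blast
  moreover have "smooth w"
    unfolding w_def by (intro smooth_add smooth_mult smooth_sum smooth_inner smooth_const)
  then have "smooth \<beta>"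
    unfolding \<beta>_def by (rule smooth_compose[OF smooth_flat_exp])
  ultimately show "\<beta> \<in> Cinf_compact"
    by (simp add: Cinf_compact_iff)
qed

text \<open>
  The sets where the bumps are positive cover \<open>K\<close>, so a finite sum of bumps is positive on \<open>K\<close>, and
  dividing it by its minimum over \<open>K\<close> makes it at least \<open>1\<close> there.
\<close>

lemma exists_cutoff:
  fixes K :: "'a::euclidean_space set"
  assumes "compact K" "open U" "K \<subseteq> U"
  obtains \<zeta> where "\<zeta> \<in> test_functions U" "\<And>x. 0 \<le> \<zeta> x" "\<And>x. x \<in> K \<Longrightarrow> 1 \<le> \<zeta> x"
proof -
  have "\<exists>\<beta>. \<beta> \<in> test_functions U \<and> (\<forall>x. 0 \<le> \<beta> x) \<and> \<beta> a > 0" if "a \<in> K" for a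
  proof -
    have "a \<in> U" using that assms(3) by auto
    then obtain r where r: "r > 0" "cball a r \<subseteq> U"
      using assms(2) unfolding open_contains_cball by metis
    obtain \<beta> where \<beta>: "\<beta> \<in> Cinf_compact" "\<And>x. 0 \<le> \<beta> x" "\<And>x. \<beta> x > 0 \<longleftrightarrow> x \<in> ball a r"
      using exists_bump[OF r(1)] by blast
    have "{x. \<beta> x \<noteq> 0} \<subseteq> ball a r"
    proof
      fix x assume "x \<in> {x. \<beta> x \<noteq> 0}"
      then show "x \<in> ball a r" using \<beta>(2,3)[of x] by auto
    qed
    then have "closure {x. \<beta> x \<noteq> 0} \<subseteq> U"
      using r(2) by (meson ball_subset_cball closed_cball closure_minimal subset_trans)
    with \<beta> r(1) show ?thesis by (intro exI[of _ \<beta>]) (simp add: test_functions_iff)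
  qed
  then obtain \<beta> where \<beta>: "\<And>a. a \<in> K \<Longrightarrow> \<beta> a \<in> test_functions U" "\<And>a x. a \<in> K \<Longrightarrow> 0 \<le> \<beta> a x"
    "\<And>a. a \<in> K \<Longrightarrow> \<beta> a a > 0" by metis
  have cont: "continuous_on UNIV (\<beta> a)" if "a \<in> K" for a
    using \<beta>(1)[OF that] test_functions_smooth smooth_continuous by blast
  have op: "open {x. \<beta> a x > 0}" if "a \<in> K" for a
    using open_Collect_less[OF continuous_on_const cont[OF that]] by simp
  have "K \<subseteq> (\<Union>a\<in>K. {x. \<beta> a x > 0})" using \<beta>(3) by auto
  from compactE_image[OF assms(1) op this]
  obtain F where F: "F \<subseteq> K" "finite F" "K \<subseteq> (\<Union>a\<in>F. {x. \<beta> a x > 0})" .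
  define S where "S x = (\<Sum>a\<in>F. \<beta> a x)" for x
  have t0: "(\<lambda>_. 0) \<in> test_functions U" by (simp add: test_functions_iff Cinf_compact_iff)
  have s: "S \<in> test_functions U"
    unfolding S_def
    using F(2,1) by (induction F rule: finite_induct) (simp_all add: test_functions_add \<beta>(1) t0)
  have s0: "0 \<le> S x" for x using \<beta>(2) F unfolding S_def by (intro sum_nonneg) auto
  have spos: "S x > 0" if "x \<in> K" for x
  proof -
    obtain a where a: "a \<in> F" "\<beta> a x > 0" using \<open>x \<in> K\<close> F(3) by auto
    show ?thesis unfolding S_def by (rule sum_pos2[of F a "\<lambda>a. \<beta> a x", OF F(2) a]) (use \<beta>(2) F in auto)
  qed
  obtain m where m: "m > 0" "\<And>x. x \<in> K \<Longrightarrow> m \<le> S x"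
  proof (cases "K = {}")
    case True then show ?thesis using that[of 1] by auto
  next
    case False
    obtain x0 where "x0 \<in> K" "\<And>x. x \<in> K \<Longrightarrow> S x0 \<le> S x"
      using continuous_attains_inf[OF assms(1) False smooth_continuous[OF test_functions_smooth[OF s]]] by auto
    then show ?thesis using that[of "S x0"] spos by auto
  qed
  show ?thesis
  proof (rule that[of "\<lambda>x. S x * (1 / m)"])
    show "(\<lambda>x. S x * (1 / m)) \<in> test_functions U" by (rule test_functions_mult[OF s smooth_const])
  qed (use m s0 in \<open>auto simp: field_simps\<close>)
qed

section \<open>Bounded Borel functions and square integrable functions\<close>

definition bdd_borel :: "('a::euclidean_space \<Rightarrow> real) \<Rightarrow> bool" where
  "bdd_borel f \<longleftrightarrow> f \<in> borel_measurable borel \<and> (\<exists>C. \<forall>x. \<bar>f x\<bar> \<le> C)"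

definition L2 :: "('a::euclidean_space \<Rightarrow> real) \<Rightarrow> bool" where
  "L2 f \<longleftrightarrow> f \<in> borel_measurable borel \<and> integrable lborel (\<lambda>x. (f x)\<^sup>2)"

lemma bdd_borelI: "f \<in> borel_measurable borel \<Longrightarrow> (\<And>x. \<bar>f x\<bar> \<le> C) \<Longrightarrow> bdd_borel f"
  by (auto simp: bdd_borel_def)

lemma bdd_borel_measurable[measurable_dest]: "bdd_borel f \<Longrightarrow> f \<in> borel_measurable borel"
  by (simp add: bdd_borel_def)

lemma L2_measurable[measurable_dest]: "L2 f \<Longrightarrow> f \<in> borel_measurable borel"
  by (simp add: L2_def)

lemma bdd_borel_bound:
  assumes "bdd_borel f" obtains C where "C \<ge> 0" "\<And>x. \<bar>f x\<bar> \<le> C"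
proof -
  obtain C where C: "\<And>x. \<bar>f x\<bar> \<le> C" using assms by (auto simp: bdd_borel_def)
  have "0 \<le> C" using C[of undefined] by linarith
  then show ?thesis using that C by blast
qed

lemma bdd_borel_mult:
  assumes "bdd_borel f" "bdd_borel g" shows "bdd_borel (\<lambda>x. f x * g x)"
proof -
  obtain C D where "C \<ge> 0" "\<And>x. \<bar>f x\<bar> \<le> C" "D \<ge> 0" "\<And>x. \<bar>g x\<bar> \<le> D"
    using assms bdd_borel_bound by metis
  then show ?thesis using assms
    by (intro bdd_borelI[of _ "C * D"]) (auto simp: abs_mult intro!: mult_mono dest: bdd_borel_measurable)
qed

lemma bdd_borel_add:
  assumes "bdd_borel f" "bdd_borel g" shows "bdd_borel (\<lambda>x. f x + g x)"
proof -
  obtain C D where "C \<ge> 0" "\<And>x. \<bar>f x\<bar> \<le> C" "D \<ge> 0" "\<And>x. \<bar>g x\<bar> \<le> D"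
    using assms bdd_borel_bound by metis
  then show ?thesis using assms
    by (intro bdd_borelI[of _ "C + D"]) (auto intro!: order_trans[OF abs_triangle_ineq] add_mono dest: bdd_borel_measurable)
qed

lemma bdd_borel_const: "bdd_borel (\<lambda>_. c)"
  by (rule bdd_borelI[of _ "\<bar>c\<bar>"]) auto

lemma bdd_borel_minus: "bdd_borel f \<Longrightarrow> bdd_borel (\<lambda>x. - f x)"
  using bdd_borel_mult[OF bdd_borel_const[of "-1"]] by simp

lemma bdd_borel_diff: "bdd_borel f \<Longrightarrow> bdd_borel g \<Longrightarrow> bdd_borel (\<lambda>x. f x - g x)"
  using bdd_borel_add[OF _ bdd_borel_minus] by fastforce

lemma Cinf_compact_bdd_borel:
  assumes "\<phi> \<in> Cinf_compact" shows "bdd_borel \<phi>"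
proof -
  have c: "continuous_on A \<phi>" for A using assms smooth_continuous Cinf_compact_smooth by blast
  have "compact (closure {x. \<phi> x \<noteq> 0})" using assms by (simp add: Cinf_compact_def)
  from compact_continuous_image[OF c this]
  have "bounded (\<phi> ` closure {x. \<phi> x \<noteq> 0})" by (rule compact_imp_bounded)
  then obtain C where C: "\<And>x. x \<in> closure {x. \<phi> x \<noteq> 0} \<Longrightarrow> \<bar>\<phi> x\<bar> \<le> C"
    by (auto simp: bounded_iff)
  have "\<bar>\<phi> x\<bar> \<le> \<bar>C\<bar>" for x
  proof (cases "\<phi> x = 0")
    case False
    then have "x \<in> closure {x. \<phi> x \<noteq> 0}" using closure_subset[of "{x. \<phi> x \<noteq> 0}"] by auto
    then show ?thesis using C[of x] by linarith
  qed simp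
  then show ?thesis using borel_measurable_continuous_onI[OF c] by (rule_tac bdd_borelI) auto
qed

lemma integrable_bounded_support:
  fixes f :: "'a::euclidean_space \<Rightarrow> real"
  assumes "bdd_borel f" "bounded {x. f x \<noteq> 0}"
  shows "integrable lborel f"
proof -
  obtain C where C: "C \<ge> 0" "\<And>x. \<bar>f x\<bar> \<le> C" using assms bdd_borel_bound by metis
  let ?K = "closure {x. f x \<noteq> 0}"
  have K: "compact ?K" using assms by (simp add: compact_closure)
  show ?thesis
  proof (rule Bochner_Integration.integrable_bound)
    show "integrable lborel (\<lambda>x. indicator ?K x * C)"
      using K by (auto intro!: emeasure_compact_finite borel_compact integrable_mult_left)
    show "f \<in> borel_measurable lborel" using assms by (auto dest: bdd_borel_measurable)
    show "AE x in lborel. norm (f x) \<le> norm (indicator ?K x * C)"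
    proof (rule AE_I2)
      fix x show "norm (f x) \<le> norm (indicator ?K x * C)"
        using C closure_subset[of "{x. f x \<noteq> 0}"] by (cases "f x = 0") (auto simp: indicator_def)
    qed
  qed
qed

lemma integrable_bdd_mult_Cinf:
  assumes "bdd_borel h" "\<phi> \<in> Cinf_compact"
  shows "integrable lborel (\<lambda>x. h x * \<phi> x)"
  by (rule integrable_bounded_support[OF bdd_borel_mult[OF assms(1) Cinf_compact_bdd_borel[OF assms(2)]]])
     (rule bounded_subset[of "{x. \<phi> x \<noteq> 0}"], use assms in \<open>auto simp: Cinf_compact_iff\<close>)

lemma Cinf_compact_integrable: "\<phi> \<in> Cinf_compact \<Longrightarrow> integrable lborel \<phi>"
  using integrable_bdd_mult_Cinf[OF bdd_borel_const[of 1]] by simp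

lemma L2_bdd_mult:
  assumes "bdd_borel h" "L2 a" shows "L2 (\<lambda>x. h x * a x)"
proof -
  obtain C where C: "C \<ge> 0" "\<And>x. \<bar>h x\<bar> \<le> C" using assms bdd_borel_bound by metis
  have "integrable lborel (\<lambda>x. (h x * a x)\<^sup>2)"
  proof (rule Bochner_Integration.integrable_bound)
    show "integrable lborel (\<lambda>x. C\<^sup>2 * (a x)\<^sup>2)" using assms by (simp add: L2_def)
    show "(\<lambda>x. (h x * a x)\<^sup>2) \<in> borel_measurable lborel" using assms by (auto dest: bdd_borel_measurable L2_measurable)
    show "AE x in lborel. norm ((h x * a x)\<^sup>2) \<le> norm (C\<^sup>2 * (a x)\<^sup>2)"
      using C by (auto simp: power_mult_distrib abs_le_square_iff[symmetric] intro!: mult_right_mono)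
  qed
  then show ?thesis using assms by (auto simp: L2_def bdd_borel_def)
qed

lemma L2_add:
  assumes "L2 a" "L2 b" shows "L2 (\<lambda>x. a x + b x)"
proof -
  have "integrable lborel (\<lambda>x. (a x + b x)\<^sup>2)"
  proof (rule Bochner_Integration.integrable_bound)
    show "integrable lborel (\<lambda>x. 2 * (a x)\<^sup>2 + 2 * (b x)\<^sup>2)" using assms by (simp add: L2_def)
    show "(\<lambda>x. (a x + b x)\<^sup>2) \<in> borel_measurable lborel" using assms by (auto dest: L2_measurable)
    have "(a x + b x)\<^sup>2 \<le> 2 * (a x)\<^sup>2 + 2 * (b x)\<^sup>2" for x
      using zero_le_power2[of "a x - b x"] by (simp add: power2_eq_square algebra_simps)
    then show "AE x in lborel. norm ((a x + b x)\<^sup>2) \<le> norm (2 * (a x)\<^sup>2 + 2 * (b x)\<^sup>2)"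
      by auto
  qed
  then show ?thesis using assms by (auto simp: L2_def)
qed

lemma L2_uminus: "L2 a \<Longrightarrow> L2 (\<lambda>x. - a x)"
  using L2_bdd_mult[OF bdd_borel_const[of "-1"]] by simp

lemma L2_bounded_support:
  assumes "bdd_borel f" "bounded {x. f x \<noteq> 0}" shows "L2 f"
  using integrable_bounded_support[OF bdd_borel_mult[OF assms(1) assms(1)]] assms
  by (auto simp: L2_def power2_eq_square bdd_borel_def)

lemma Cinf_compact_L2: "\<phi> \<in> Cinf_compact \<Longrightarrow> L2 \<phi>"
  using L2_bounded_support Cinf_compact_bdd_borel Cinf_compact_iff by metis

lemma L2_mult_integrable:
  assumes "L2 a" "L2 b" shows "integrable lborel (\<lambda>x. a x * b x)"
proof (rule Bochner_Integration.integrable_bound)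
  show "integrable lborel (\<lambda>x. (a x)\<^sup>2 + (b x)\<^sup>2)" using assms by (simp add: L2_def)
  show "(\<lambda>x. a x * b x) \<in> borel_measurable lborel" using assms by (auto dest: L2_measurable)
  have "\<bar>a x * b x\<bar> \<le> (a x)\<^sup>2 + (b x)\<^sup>2" for x
  proof -
    have "2 * (\<bar>a x\<bar> * \<bar>b x\<bar>) \<le> (a x)\<^sup>2 + (b x)\<^sup>2"
      using zero_le_power2[of "\<bar>a x\<bar> - \<bar>b x\<bar>"] by (simp add: power2_diff)
    moreover have "0 \<le> \<bar>a x\<bar> * \<bar>b x\<bar>" by simp
    ultimately show ?thesis unfolding abs_mult by linarith
  qed
  then show "AE x in lborel. norm (a x * b x) \<le> norm ((a x)\<^sup>2 + (b x)\<^sup>2)"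
    by auto
qed

lemma lborel_distr_reflect: "distr lborel borel (\<lambda>x. p - x) = (lborel :: 'a::euclidean_space measure)"
  using lborel_affine[of "-1" p] by (simp add: density_1)

lemma lborel_distr_shift: "distr lborel borel (\<lambda>x. x + p) = (lborel :: 'a::euclidean_space measure)"
proof -
  have "(\<lambda>x. x + p) = (+) p" by (rule ext) (rule add.commute)
  then show ?thesis by (simp only: lborel_distr_plus)
qed

lemma lborel_integral_shift:
  fixes f :: "'a::euclidean_space \<Rightarrow> real"
  assumes "f \<in> borel_measurable borel" shows "(LINT x|lborel. f (x + p)) = (LINT x|lborel. f x)"
  using integral_distr[of "\<lambda>x. x + p" lborel borel f] assms by (simp add: lborel_distr_shift)

lemma lborel_integrable_shift:
  fixes f :: "'a::euclidean_space \<Rightarrow> real"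
  assumes "f \<in> borel_measurable borel" shows "integrable lborel (\<lambda>x. f (x + p)) \<longleftrightarrow> integrable lborel f"
  using integrable_distr_eq[of "\<lambda>x. x + p" lborel borel f] assms by (simp add: lborel_distr_shift)

lemma lborel_integral_reflect:
  fixes f :: "'a::euclidean_space \<Rightarrow> real"
  assumes "f \<in> borel_measurable borel" shows "(LINT x|lborel. f (p - x)) = (LINT x|lborel. f x)"
  using integral_distr[of "\<lambda>x. p - x" lborel borel f] assms by (simp add: lborel_distr_reflect)

lemma lborel_integrable_reflect:
  fixes f :: "'a::euclidean_space \<Rightarrow> real"
  assumes "f \<in> borel_measurable borel" shows "integrable lborel (\<lambda>x. f (p - x)) \<longleftrightarrow> integrable lborel f"
  using integrable_distr_eq[of "\<lambda>x. p - x" lborel borel f] assms by (simp add: lborel_distr_reflect)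

lemma nn_integral_lborel_shift:
  fixes f :: "'a::euclidean_space \<Rightarrow> ennreal"
  assumes "f \<in> borel_measurable borel" shows "(\<integral>\<^sup>+x. f (x + p) \<partial>lborel) = (\<integral>\<^sup>+x. f x \<partial>lborel)"
  using nn_integral_distr[of "\<lambda>x. x + p" lborel borel f] assms by (simp add: lborel_distr_shift)

section \<open>Difference quotients of test functions\<close>

lemma has_real_derivative_along:
  assumes "smooth F"
  shows "((\<lambda>t. F (x + t *\<^sub>R v)) has_real_derivative dir_deriv v F (x + t *\<^sub>R v)) (at t)"
proof -
  have "((\<lambda>t. F (x + t *\<^sub>R v)) has_derivative (\<lambda>s. dir_deriv (s *\<^sub>R v) F (x + t *\<^sub>R v))) (at t)"
    by (rule has_derivative_compose[of "\<lambda>t. x + t *\<^sub>R v" "\<lambda>s. s *\<^sub>R v" t UNIV F, OF _ smooth_has_derivative[OF assms]])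
       (auto intro!: derivative_eq_intros)
  moreover have "(\<lambda>s. dir_deriv (s *\<^sub>R v) F (x + t *\<^sub>R v)) = (*) (dir_deriv v F (x + t *\<^sub>R v))"
    by (rule ext) (simp add: dir_deriv_scaleR_vec[OF assms] mult.commute)
  ultimately show ?thesis by (simp add: has_field_derivative_def)
qed

lemma Cinf_compact_lipschitz_along:
  assumes "F \<in> Cinf_compact"
  obtains L where "L \<ge> 0" "\<And>x h. \<bar>F (x + h *\<^sub>R v) - F x\<bar> \<le> L * \<bar>h\<bar>"
proof -
  obtain L where L: "L \<ge> 0" "\<And>x. \<bar>dir_deriv v F x\<bar> \<le> L"
    using bdd_borel_bound[OF Cinf_compact_bdd_borel[OF Cinf_compact_dir_deriv[OF assms]]] by blast
  have sm: "smooth F" using assms Cinf_compact_smooth by blast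
  have pos: "\<bar>F (x + h *\<^sub>R v) - F x\<bar> \<le> L * h" if "h > 0" for x h
  proof -
    obtain z where "F (x + h *\<^sub>R v) - F (x + 0 *\<^sub>R v) = (h - 0) * dir_deriv v F (x + z *\<^sub>R v)"
      using MVT2[OF \<open>h > 0\<close>, of "\<lambda>t. F (x + t *\<^sub>R v)" "\<lambda>t. dir_deriv v F (x + t *\<^sub>R v)"]
        has_real_derivative_along[OF sm, of x v] by blast
    then show ?thesis using L(2)[of "x + z *\<^sub>R v"] that by (simp add: abs_mult mult.commute)
  qed
  have "\<bar>F (x + h *\<^sub>R v) - F x\<bar> \<le> L * \<bar>h\<bar>" for x h
  proof (cases h "0::real" rule: linorder_cases)
    case less
    then show ?thesis using pos[of "-h" "x + h *\<^sub>R v"] by (simp add: abs_minus_commute)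
  qed (use pos in auto)
  with L that show ?thesis by blast
qed

lemma Cinf_compact_lipschitz:
  fixes F :: "'a::euclidean_space \<Rightarrow> real"
  assumes "F \<in> Cinf_compact"
  obtains L where "L \<ge> 0" "\<And>x z. \<bar>F (x + z) - F x\<bar> \<le> L * norm z"
proof -
  have sm: "smooth F" using assms Cinf_compact_smooth by blast
  have "\<exists>C. \<forall>x. C \<ge> 0 \<and> \<bar>dir_deriv b F x\<bar> \<le> C" for b
    using bdd_borel_bound[OF Cinf_compact_bdd_borel[OF Cinf_compact_dir_deriv[OF assms]]] by metis
  then obtain C where C: "\<And>b x. C b \<ge> 0" "\<And>b x. \<bar>dir_deriv b F x\<bar> \<le> C b" by metis
  define L where "L = (\<Sum>b\<in>(Basis :: 'a set). C b)"
  have bd: "\<bar>dir_deriv z F x\<bar> \<le> L * norm z" for x z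
  proof -
    have "dir_deriv (\<Sum>b\<in>Basis. (z \<bullet> b) *\<^sub>R b) F x = (\<Sum>b\<in>Basis. (z \<bullet> b) * dir_deriv b F x)"
      using linear_sum[OF has_derivative_linear[OF smooth_has_derivative[OF sm]], of "\<lambda>b. (z \<bullet> b) *\<^sub>R b" Basis x]
      by (simp add: dir_deriv_scaleR_vec[OF sm])
    then have "\<bar>dir_deriv z F x\<bar> = \<bar>\<Sum>b\<in>Basis. (z \<bullet> b) * dir_deriv b F x\<bar>"
      by (simp add: euclidean_representation)
    also have "\<dots> \<le> (\<Sum>b\<in>Basis. norm z * C b)"
      by (intro order_trans[OF sum_abs] sum_mono)
         (auto simp: abs_mult intro!: mult_mono C Basis_le_norm)
    finally show ?thesis by (simp add: L_def sum_distrib_left mult.commute)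
  qed
  have "L \<ge> 0" unfolding L_def using C(1) by (simp add: sum_nonneg)
  moreover have "\<bar>F (x + z) - F x\<bar> \<le> L * norm z" for x z
  proof -
    obtain t where "F (x + 1 *\<^sub>R z) - F (x + 0 *\<^sub>R z) = (1 - 0) * dir_deriv z F (x + t *\<^sub>R z)"
      using MVT2[OF zero_less_one, of "\<lambda>t. F (x + t *\<^sub>R z)" "\<lambda>t. dir_deriv z F (x + t *\<^sub>R z)"]
        has_real_derivative_along[OF sm, of x z] by blast
    then show ?thesis using bd[of z "x + t *\<^sub>R z"] by simp
  qed
  ultimately show ?thesis using that by blast
qed

text \<open>
  Dominated convergence replaces differentiation under the integral sign: the difference quotients
  of a test function are uniformly bounded and live in a fixed ball.
\<close>

lemma difference_quotient_tendsto:
  fixes F :: "'a::euclidean_space \<Rightarrow> real"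
  assumes F: "F \<in> Cinf_compact" and H: "bdd_borel H"
  shows "((\<lambda>h. LINT y|lborel. H y * ((F (y + h *\<^sub>R v) - F y) / h)) \<longlongrightarrow>
    (LINT y|lborel. H y * dir_deriv v F y)) (at 0)"
  unfolding tendsto_at_iff_sequentially
proof (intro allI impI)
  fix X :: "nat \<Rightarrow> real"
  assume X: "\<forall>i. X i \<in> UNIV - {0}" "X \<longlonglongrightarrow> 0"
  have sm: "smooth F" using F Cinf_compact_smooth by blast
  obtain N where N: "\<And>i. i \<ge> N \<Longrightarrow> \<bar>X i\<bar> \<le> 1"
    using LIMSEQ_D[OF X(2), of 1] by (metis diff_zero less_imp_le real_norm_def zero_less_one)
  obtain L where L: "L \<ge> 0" "\<And>x h. \<bar>F (x + h *\<^sub>R v) - F x\<bar> \<le> L * \<bar>h\<bar>"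
    using Cinf_compact_lipschitz_along[OF F] by blast
  obtain C where C: "C \<ge> 0" "\<And>x. \<bar>H x\<bar> \<le> C" using H bdd_borel_bound by metis
  obtain R where R: "\<And>x. F x \<noteq> 0 \<Longrightarrow> norm x \<le> R"
    using F by (auto simp: Cinf_compact_iff bounded_iff)
  have Fm[measurable]: "F \<in> borel_measurable borel" using Cinf_compact_bdd_borel[OF F] by measurable
  note H[measurable]
  let ?K = "cball 0 (R + norm v) :: 'a set"
  have "(\<lambda>i. LINT y|lborel. H y * ((F (y + X (i + N) *\<^sub>R v) - F y) / X (i + N)))
    \<longlonglongrightarrow> (LINT y|lborel. H y * dir_deriv v F y)"
  proof (rule integral_dominated_convergence)
    show "(\<lambda>y. H y * dir_deriv v F y) \<in> borel_measurable lborel"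
      using Cinf_compact_bdd_borel[OF Cinf_compact_dir_deriv[OF F, of v]] by measurable
    show "(\<lambda>y. H y * ((F (y + X (i + N) *\<^sub>R v) - F y) / X (i + N))) \<in> borel_measurable lborel" for i
      by measurable
    show "integrable lborel (\<lambda>y. indicator ?K y * (C * L))"
      by (auto intro!: emeasure_lborel_cball_finite integrable_mult_left)
    show "AE y in lborel. norm (H y * ((F (y + X (i + N) *\<^sub>R v) - F y) / X (i + N))) \<le> indicator ?K y * (C * L)" for i
    proof (rule AE_I2)
      fix y
      have X0: "X (i + N) \<noteq> 0" "\<bar>X (i + N)\<bar> \<le> 1" using X(1) N by auto
      have "\<bar>(F (y + X (i + N) *\<^sub>R v) - F y) / X (i + N)\<bar> \<le> L"
        using L(2)[of y "X (i + N)"] X0 by (simp add: field_simps)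
      then have 1: "norm (H y * ((F (y + X (i + N) *\<^sub>R v) - F y) / X (i + N))) \<le> C * L"
        using C L by (auto simp only: real_norm_def abs_mult intro!: mult_mono)
      have "y \<in> ?K" if "F (y + X (i + N) *\<^sub>R v) - F y \<noteq> 0"
      proof -
        have Xv: "norm (X (i + N) *\<^sub>R v) \<le> norm v" using X0 by (simp add: mult_left_le_one_le)
        from that consider "F (y + X (i + N) *\<^sub>R v) \<noteq> 0" | "F y \<noteq> 0" by fastforce
        then have "norm y \<le> R + norm v"
        proof cases
          case 1
          from R[OF this] Xv show ?thesis
            using norm_triangle_ineq4[of "y + X (i + N) *\<^sub>R v" "X (i + N) *\<^sub>R v"] by simp
        next
          case 2
          from R[OF this] show ?thesis using norm_ge_zero[of v] by linarith
        qed
        then show ?thesis by simp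
      qed
      with 1 show "norm (H y * ((F (y + X (i + N) *\<^sub>R v) - F y) / X (i + N))) \<le> indicator ?K y * (C * L)"
        using C L by (cases "y \<in> ?K") (auto simp: indicator_def)
    qed
    show "AE y in lborel. (\<lambda>i. H y * ((F (y + X (i + N) *\<^sub>R v) - F y) / X (i + N))) \<longlonglongrightarrow> H y * dir_deriv v F y"
    proof (rule AE_I2)
      fix y
      have "((\<lambda>h. (F (y + h *\<^sub>R v) - F y) / h) \<longlongrightarrow> dir_deriv v F y) (at 0)"
        using has_real_derivative_along[OF sm, of y v 0] by (simp add: DERIV_def)
      then have "(\<lambda>i. (F (y + X i *\<^sub>R v) - F y) / X i) \<longlonglongrightarrow> dir_deriv v F y"
        using X unfolding tendsto_at_iff_sequentially comp_def by blast
      from LIMSEQ_ignore_initial_segment[OF this, of N]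
      show "(\<lambda>i. H y * ((F (y + X (i + N) *\<^sub>R v) - F y) / X (i + N))) \<longlonglongrightarrow> H y * dir_deriv v F y"
        by (rule tendsto_mult_left)
    qed
  qed
  from LIMSEQ_offset[of "\<lambda>i. LINT y|lborel. H y * ((F (y + X i *\<^sub>R v) - F y) / X i)", OF this]
  show "((\<lambda>h. LINT y|lborel. H y * ((F (y + h *\<^sub>R v) - F y) / h)) \<circ> X)
    \<longlonglongrightarrow> (LINT y|lborel. H y * dir_deriv v F y)" by (simp add: comp_def)
qed

text \<open>
  The integral of every difference quotient vanishes by translation invariance.  This is the only
  form of integration by parts that the proof uses.
\<close>

lemma integral_dir_deriv_zero:
  fixes F :: "'a::euclidean_space \<Rightarrow> real"
  assumes F: "F \<in> Cinf_compact"
  shows "(LINT y|lborel. dir_deriv v F y) = 0"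
proof -
  have Fm: "F \<in> borel_measurable borel" using Cinf_compact_bdd_borel[OF F] by measurable
  have i: "integrable lborel F" by (rule Cinf_compact_integrable[OF F])
  have "(LINT y|lborel. (F (y + h *\<^sub>R v) - F y) / h) = 0" for h
    using i lborel_integrable_shift[OF Fm] by (simp add: lborel_integral_shift[OF Fm])
  with difference_quotient_tendsto[OF F bdd_borel_const[of 1], of v]
  have "((\<lambda>h. 0) \<longlongrightarrow> (LINT y|lborel. dir_deriv v F y)) (at (0::real))" by (simp only: mult_1_left)
  from tendsto_unique[OF _ this tendsto_const] show ?thesis by simp
qed

section \<open>Continuity of translations in the mean\<close>

text \<open>
  A measurable function is almost everywhere the limit of continuous functions \<open>g n\<close>.  Truncating
  these at the bound of \<open>W\<close> makes them converge in \<open>L\<^sup>1\<close> on a ball, and for a single continuous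
  function the claim is uniform continuity.
\<close>

lemma translation_L1_continuous:
  fixes W :: "'a::euclidean_space \<Rightarrow> real"
  assumes W: "bdd_borel W" and bd: "bounded {x. W x \<noteq> 0}"
  shows "((\<lambda>z. LINT q|lborel. \<bar>W (q + z) - W q\<bar>) \<longlongrightarrow> 0) (at 0)"
proof -
  obtain C where C: "C \<ge> 0" "\<And>x. \<bar>W x\<bar> \<le> C" using W bdd_borel_bound by metis
  obtain R where R: "\<And>x. W x \<noteq> 0 \<Longrightarrow> norm x \<le> R" using bd by (auto simp: bounded_iff)
  note W[measurable]
  have "W \<in> borel_measurable (lebesgue_on UNIV)" 
    using bdd_borel_measurable[OF W] by (auto intro: measurable_completion simp: lebesgue_on_UNIV_eq)
  then have "W measurable_on UNIV"
    by (simp add: measurable_on_iff_borel_measurable)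
  \<comment> \<open>The definition of \<open>measurable_on\<close> provides continuous approximations almost everywhere.\<close>
  then obtain N g0 where N: "negligible N" and g0: "\<And>n. continuous_on UNIV (g0 n)"
    "\<And>x. x \<notin> N \<Longrightarrow> (\<lambda>n. g0 n x) \<longlonglongrightarrow> W x"
    by (auto simp: measurable_on_def)
  define g where "g n x = max (-C) (min C (g0 n x))" for n x
  have gc: "continuous_on A (g n)" for n A
    unfolding g_def using continuous_on_subset[OF g0(1)] by (auto intro!: continuous_intros)
  have gm[measurable]: "g n \<in> borel_measurable borel" for n
    using gc by (rule borel_measurable_continuous_onI)
  have gb: "\<bar>g n x\<bar> \<le> C" for n x using C(1) by (auto simp: g_def)
  have glim: "(\<lambda>n. g n x) \<longlonglongrightarrow> W x" if "x \<notin> N" for x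
  proof -
    have "(\<lambda>n. max (-C) (min C (g0 n x))) \<longlonglongrightarrow> max (-C) (min C (W x))"
      by (intro tendsto_intros g0 that)
    then show ?thesis using C(2)[of x] by (simp add: g_def abs_le_iff min_absorb2 max_absorb2)
  qed
  define B where "B = (cball 0 (R + 2) :: 'a set)"
  have Bm[measurable]: "B \<in> sets borel" by (simp add: B_def)
  have Bfin: "emeasure lborel B < \<infinity>" unfolding B_def by (rule emeasure_bounded_finite[OF bounded_cball])
  have "AE x in lebesgue. x \<notin> N"
    using N unfolding negligible_iff_null_sets by (rule AE_not_in)
  then have AEN: "AE x in lborel. x \<notin> N" by (simp only: AE_completion_iff)
  have Bi: "integrable lborel (\<lambda>q. indicator B q * (2 * C))"
    using Bfin by (auto intro!: integrable_mult_left)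
  have "(\<lambda>n. LINT q|lborel. indicator B q * \<bar>g n q - W q\<bar>) \<longlonglongrightarrow> (LINT q|(lborel :: 'a measure). 0 :: real)"
  proof (rule integral_dominated_convergence[where w="\<lambda>q. indicator B q * (2 * C)"])
    show "integrable lborel (\<lambda>q. indicator B q * (2 * C))" by (rule Bi)
    show "AE q in lborel. (\<lambda>n. indicator B q * \<bar>g n q - W q\<bar>) \<longlonglongrightarrow> (0 :: real)"
      using AEN
    proof eventually_elim
      case (elim q)
      have "(\<lambda>n. indicator B q * \<bar>g n q - W q\<bar>) \<longlonglongrightarrow> (indicator B q * 0 :: real)"
        by (intro tendsto_mult_left tendsto_rabs_zero LIM_zero glim elim)
      then show ?case by simp
    qed
    show "AE q in lborel. norm (indicator B q * \<bar>g n q - W q\<bar>) \<le> indicator B q * (2 * C)" for n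
    proof (rule AE_I2)
      fix q
      have "\<bar>g n q - W q\<bar> \<le> 2 * C" using gb[of n q] C(2)[of q] by linarith
      then show "norm (indicator B q * \<bar>g n q - W q\<bar>) \<le> indicator B q * (2 * C)"
        by (simp add: indicator_def)
    qed
  qed measurable
  then have lim0: "(\<lambda>n. LINT q|lborel. indicator B q * \<bar>g n q - W q\<bar>) \<longlonglongrightarrow> 0" by simp
  show ?thesis
  proof (rule LIM_I)
    fix e :: real assume e: "e > 0"
    obtain n where n: "(LINT q|lborel. indicator B q * \<bar>g n q - W q\<bar>) < e / 3"
      using LIMSEQ_D[OF lim0, of "e / 3"] e by force
    define m where "m = measure lborel B"
    have m0: "m \<ge> 0" by (simp add: m_def)
    have "uniformly_continuous_on (cball 0 (R + 3)) (g n)"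
      by (rule compact_uniformly_continuous[OF gc]) simp
    then obtain d where d: "d > 0" "\<And>x y. x \<in> cball 0 (R + 3) \<Longrightarrow> y \<in> cball 0 (R + 3) \<Longrightarrow> dist y x < d \<Longrightarrow> dist (g n y) (g n x) < e / (3 * (m + 1))"
      using e m0 unfolding uniformly_continuous_on_def by (metis zero_less_divide_iff mult_pos_pos add_nonneg_pos zero_less_numeral zero_less_one)
    show "\<exists>s>0. \<forall>z. z \<noteq> 0 \<and> norm (z - 0) < s \<longrightarrow> norm ((LINT q|lborel. \<bar>W (q + z) - W q\<bar>) - 0) < e"
    proof (intro exI[of _ "min d 1"] conjI allI impI)
      show "min d 1 > 0" using d by simp
      fix z :: 'a assume z: "z \<noteq> 0 \<and> norm (z - 0) < min d 1"
      let ?f1 = "\<lambda>q. indicator B q * \<bar>g n q - W q\<bar>"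
      have f1: "integrable lborel ?f1"
      proof (rule integrable_bounded_support)
        show "bdd_borel ?f1"
        proof (rule bdd_borelI[of _ "2 * C"])
          fix q
          have "\<bar>g n q - W q\<bar> \<le> 2 * C" using gb[of n q] C(2)[of q] by linarith
          then show "\<bar>?f1 q\<bar> \<le> 2 * C" using C(1) by (simp add: indicator_def)
        qed measurable
        show "bounded {x. ?f1 x \<noteq> 0}"
          by (rule bounded_subset[of B]) (auto simp: B_def indicator_def)
      qed
      have f1m: "?f1 \<in> borel_measurable borel" by measurable
      let ?f2 = "\<lambda>q. indicator B q * (e / (3 * (m + 1)))"
      have f2: "integrable lborel ?f2" using Bfin by (auto intro!: integrable_mult_left)
      have le: "\<bar>W (q + z) - W q\<bar> \<le> ?f1 (q + z) + ?f2 q + ?f1 q" for q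
      proof (cases "norm q \<le> R + 1")
        case True
        then have nz: "norm (q + z) \<le> R + 2" using z norm_triangle_ineq[of q z] by auto
        have "dist (g n (q + z)) (g n q) < e / (3 * (m + 1))"
        proof (rule d(2))
          show "q \<in> cball 0 (R + 3)" "q + z \<in> cball 0 (R + 3)" using True nz by simp_all
          show "dist (q + z) q < d" using z by (simp add: dist_norm)
        qed
        moreover have "?f1 (q + z) = \<bar>g n (q + z) - W (q + z)\<bar>" "?f2 q = e / (3 * (m + 1))" "?f1 q = \<bar>g n q - W q\<bar>"
          using True nz by (simp_all add: B_def indicator_def)
        ultimately show ?thesis unfolding dist_real_def by linarith
      next
        case False
        then have "W q = 0" using R[of q] by force
        moreover have "norm (q + z) > R" using False z norm_triangle_ineq4[of "q + z" z] by auto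
        then have "W (q + z) = 0" using R[of "q + z"] by force
        ultimately show ?thesis using e m0 by (auto simp: indicator_def)
      qed
      have "(LINT q|lborel. \<bar>W (q + z) - W q\<bar>) \<le> (LINT q|lborel. ?f1 (q + z) + ?f2 q + ?f1 q)"
      proof (rule integral_mono_AE')
        show "integrable lborel (\<lambda>q. ?f1 (q + z) + ?f2 q + ?f1 q)"
          using f1 f2 lborel_integrable_shift[OF f1m, of z] by auto
        show "AE q in lborel. 0 \<le> ?f1 (q + z) + ?f2 q + ?f1 q"
          using le by (intro AE_I2) (meson abs_ge_zero order_trans)
        show "AE q in lborel. \<bar>W (q + z) - W q\<bar> \<le> ?f1 (q + z) + ?f2 q + ?f1 q"
          using le by (intro AE_I2)
      qed
      also have "\<dots> = (LINT q|lborel. ?f1 (q + z)) + (LINT q|lborel. ?f2 q) + (LINT q|lborel. ?f1 q)"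
        using f1 f2 lborel_integrable_shift[OF f1m, of z] by simp
      also have "(LINT q|lborel. ?f1 (q + z)) = (LINT q|lborel. ?f1 q)"
        by (rule lborel_integral_shift[OF f1m])
      also have "(LINT q|lborel. ?f2 q) = m * (e / (3 * (m + 1)))"
        by (simp add: m_def)
      also have "m * (e / (3 * (m + 1))) \<le> e / 3"
        using e m0 by (simp add: field_simps)
      finally have "(LINT q|lborel. \<bar>W (q + z) - W q\<bar>) < e" using n by linarith
      moreover have "(LINT q|lborel. \<bar>W (q + z) - W q\<bar>) \<ge> 0" by simp
      ultimately show "norm ((LINT q|lborel. \<bar>W (q + z) - W q\<bar>) - 0) < e" by simp
    qed
  qed
qed

section \<open>Double integrals with a translation kernel\<close>

abbreviation lebesgue_pairs :: "('a::euclidean_space \<times> 'a) measure" where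
  "lebesgue_pairs \<equiv> lborel \<Otimes>\<^sub>M lborel"

lemma conv_integrable:
  fixes A k :: "'a::euclidean_space \<Rightarrow> real"
  assumes A: "integrable lborel A" and k: "integrable lborel k"
  shows "integrable lebesgue_pairs (\<lambda>(p, q). A p * k (p - q))"
    and "(LINT z|lebesgue_pairs. (case z of (p, q) \<Rightarrow> A p * k (p - q))) = (LINT p|lborel. A p) * (LINT q|lborel. k q)"
proof -
  have [measurable]: "A \<in> borel_measurable borel" "k \<in> borel_measurable borel"
    using borel_measurable_integrable[OF A] borel_measurable_integrable[OF k] by simp_all
  have kq: "integrable lborel (\<lambda>q. k (p - q))" for p using k by (simp add: lborel_integrable_reflect)
  have kn: "(LINT q|lborel. \<bar>k (p - q)\<bar>) = (LINT q|lborel. \<bar>k q\<bar>)" for p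
    by (rule lborel_integral_reflect) measurable
  have kk: "(LINT q|lborel. k (p - q)) = (LINT q|lborel. k q)" for p
    by (rule lborel_integral_reflect) measurable
  show i: "integrable lebesgue_pairs (\<lambda>(p, q). A p * k (p - q))"
  proof (rule lborel_pair.Fubini_integrable)
    show "(\<lambda>(p, q). A p * k (p - q)) \<in> borel_measurable lebesgue_pairs" by measurable
    show "integrable lborel (\<lambda>p. LINT q|lborel. norm (case (p, q) of (p, q) \<Rightarrow> A p * k (p - q)))"
      using A by (simp add: abs_mult kn)
    show "AE p in lborel. integrable lborel (\<lambda>q. case (p, q) of (p, q) \<Rightarrow> A p * k (p - q))"
      using kq by simp
  qed
  show "(LINT z|lebesgue_pairs. (case z of (p, q) \<Rightarrow> A p * k (p - q))) = (LINT p|lborel. A p) * (LINT q|lborel. k q)"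
    using lborel_pair.integral_fst[OF i] by (simp add: kk)
qed

lemma conv_integrable':
  fixes B k :: "'a::euclidean_space \<Rightarrow> real"
  assumes B: "integrable lborel B" and k: "integrable lborel k"
  shows "integrable lebesgue_pairs (\<lambda>(p, q). B q * k (p - q))"
    and "(LINT z|lebesgue_pairs. (case z of (p, q) \<Rightarrow> B q * k (p - q))) = (LINT p|lborel. B p) * (LINT q|lborel. k q)"
proof -
  have [measurable]: "B \<in> borel_measurable borel" "k \<in> borel_measurable borel"
    using borel_measurable_integrable[OF B] borel_measurable_integrable[OF k] by simp_all
  have k': "integrable lborel (\<lambda>q. k (0 - q))" by (subst lborel_integrable_reflect) (use k in auto)
  have i: "integrable lebesgue_pairs (\<lambda>(p, q). B p * k (q - p))"
    using conv_integrable(1)[OF B k'] by simp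
  then show i': "integrable lebesgue_pairs (\<lambda>(p, q). B q * k (p - q))"
    using lborel_pair.integrable_product_swap[OF i] by (simp add: case_prod_beta')
  have "(LINT z|lebesgue_pairs. (case z of (p, q) \<Rightarrow> B q * k (p - q))) = (LINT q|lborel. LINT p|lborel. B q * k (p - q))"
    by (rule lborel_pair.integral_snd[OF i', symmetric])
  also have "\<dots> = (LINT q|lborel. B q * (LINT p|lborel. k p))"
  proof -
    have "(LINT p|lborel. k (p - q)) = (LINT p|lborel. k p)" for q
      using lborel_integral_shift[of k "- q"] by simp
    then show ?thesis by simp
  qed
  finally show "(LINT z|lebesgue_pairs. (case z of (p, q) \<Rightarrow> B q * k (p - q))) = (LINT p|lborel. B p) * (LINT q|lborel. k q)"
    by simp
qed

text \<open>
  Young's inequality in the case of two square integrable factors, from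
  \<open>\<bar>a(p) b(q)\<bar> \<le> a(p)\<^sup>2 + b(q)\<^sup>2\<close>; the constant is not sharp.
\<close>

lemma Young_L2:
  fixes a b k :: "'a::euclidean_space \<Rightarrow> real"
  assumes a: "L2 a" and b: "L2 b" and k: "integrable lborel k"
  shows "integrable lebesgue_pairs (\<lambda>(p, q). a p * b q * k (p - q))"
    and "\<bar>LINT z|lebesgue_pairs. (case z of (p, q) \<Rightarrow> a p * b q * k (p - q))\<bar>
      \<le> ((LINT p|lborel. (a p)\<^sup>2) + (LINT p|lborel. (b p)\<^sup>2)) * (LINT p|lborel. \<bar>k p\<bar>)"
proof -
  have [measurable]: "k \<in> borel_measurable borel" using borel_measurable_integrable[OF k] by simp
  have [measurable]: "a \<in> borel_measurable borel" "b \<in> borel_measurable borel"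
    using a b by (auto dest: L2_measurable)
  have a2: "integrable lborel (\<lambda>p. (a p)\<^sup>2)" and b2: "integrable lborel (\<lambda>p. (b p)\<^sup>2)" using a b by (auto simp: L2_def)
  have ak: "integrable lborel (\<lambda>p. \<bar>k p\<bar>)" using k by simp
  let ?W = "\<lambda>(p, q). (a p)\<^sup>2 * \<bar>k (p - q)\<bar> + (b q)\<^sup>2 * \<bar>k (p - q)\<bar>"
  have W: "integrable lebesgue_pairs ?W"
    using Bochner_Integration.integrable_add[OF conv_integrable(1)[OF a2 ak] conv_integrable'(1)[OF b2 ak]]
    by (simp add: case_prod_beta')
  have le: "norm (case z of (p, q) \<Rightarrow> a p * b q * k (p - q)) \<le> ?W z" for z
  proof -
    obtain p q where z: "z = (p, q)" by (cases z)
    have "2 * (\<bar>a p\<bar> * \<bar>b q\<bar>) \<le> (a p)\<^sup>2 + (b q)\<^sup>2"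
      using zero_le_power2[of "\<bar>a p\<bar> - \<bar>b q\<bar>"] by (simp add: power2_diff)
    moreover have "0 \<le> \<bar>a p\<bar> * \<bar>b q\<bar>" by simp
    ultimately have "\<bar>a p\<bar> * \<bar>b q\<bar> \<le> (a p)\<^sup>2 + (b q)\<^sup>2" by linarith
    from mult_right_mono[OF this, of "\<bar>k (p - q)\<bar>"]
    show ?thesis by (simp add: z abs_mult algebra_simps)
  qed
  show i: "integrable lebesgue_pairs (\<lambda>(p, q). a p * b q * k (p - q))"
  proof (rule Bochner_Integration.integrable_bound[OF W])
    show "(\<lambda>(p, q). a p * b q * k (p - q)) \<in> borel_measurable lebesgue_pairs" by measurable
    show "AE z in lebesgue_pairs. norm (case z of (p, q) \<Rightarrow> a p * b q * k (p - q)) \<le> norm (?W z)"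
    proof (rule AE_I2)
      fix z show "norm (case z of (p, q) \<Rightarrow> a p * b q * k (p - q)) \<le> norm (?W z)"
        by (rule order_trans[OF le]) (simp add: case_prod_beta')
    qed
  qed
  have "\<bar>LINT z|lebesgue_pairs. (case z of (p, q) \<Rightarrow> a p * b q * k (p - q))\<bar>
      \<le> (LINT z|lebesgue_pairs. norm (case z of (p, q) \<Rightarrow> a p * b q * k (p - q)))"
    using integral_norm_bound[of lebesgue_pairs "\<lambda>(p, q). a p * b q * k (p - q)"] by simp
  also have "\<dots> \<le> (LINT z|lebesgue_pairs. ?W z)"
    by (rule integral_mono[OF integrable_norm[OF i] W le])
  also have "\<dots> = (LINT z|lebesgue_pairs. (case z of (p, q) \<Rightarrow> (a p)\<^sup>2 * \<bar>k (p - q)\<bar>))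
     + (LINT z|lebesgue_pairs. (case z of (p, q) \<Rightarrow> (b q)\<^sup>2 * \<bar>k (p - q)\<bar>))"
    using Bochner_Integration.integral_add[OF conv_integrable(1)[OF a2 ak] conv_integrable'(1)[OF b2 ak]]
    by (simp add: case_prod_beta')
  also have "\<dots> = ((LINT p|lborel. (a p)\<^sup>2) + (LINT p|lborel. (b p)\<^sup>2)) * (LINT p|lborel. \<bar>k p\<bar>)"
    unfolding conv_integrable(2)[OF a2 ak] conv_integrable'(2)[OF b2 ak] by (simp add: algebra_simps)
  finally show "\<bar>LINT z|lebesgue_pairs. (case z of (p, q) \<Rightarrow> a p * b q * k (p - q))\<bar>
      \<le> ((LINT p|lborel. (a p)\<^sup>2) + (LINT p|lborel. (b p)\<^sup>2)) * (LINT p|lborel. \<bar>k p\<bar>)" .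
qed

section \<open>Lipschitz bounds from weak derivatives\<close>

lemma exists_mollifier:
  fixes r :: real
  assumes "r > 0"
  obtains \<rho> :: "'a::euclidean_space \<Rightarrow> real" where "\<rho> \<in> Cinf_compact" "\<And>x. 0 \<le> \<rho> x" "\<And>x. \<rho> x \<noteq> 0 \<Longrightarrow> norm x < r"
    "(LINT x|lborel. \<rho> x) = 1"
proof -
  obtain \<beta> :: "'a \<Rightarrow> real" where \<beta>: "\<beta> \<in> Cinf_compact" "\<And>x. 0 \<le> \<beta> x" "\<And>x. \<beta> x > 0 \<longleftrightarrow> x \<in> ball 0 r"
    using exists_bump[OF assms, of 0] by metis
  have i: "integrable lborel \<beta>" by (rule Cinf_compact_integrable[OF \<beta>(1)])
  define m where "m = (LINT x|lborel. \<beta> x)"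
  have "m \<ge> 0" unfolding m_def using \<beta>(2) by simp
  moreover have "m \<noteq> 0"
  proof
    assume "m = 0"
    then have "AE x in lborel. \<beta> x = 0"
      using integral_nonneg_eq_0_iff_AE[OF i] \<beta>(2) by (simp add: m_def)
    then have "AE x in lborel. x \<notin> ball (0 :: 'a) r" 
    proof eventually_elim
      fix x assume "\<beta> x = 0"
      then show "x \<notin> ball 0 r" using \<beta>(3)[of x] by auto
    qed
    then have "ball (0::'a) r \<in> null_sets lborel" by (simp add: AE_iff_null_sets)
    then have "negligible (ball (0::'a) r)" by (simp add: negligible_iff_null_sets null_sets_completionI)
    then show False using open_not_negligible[OF open_ball, of "0 :: 'a" r] assms by auto
  qed
  ultimately have m: "m > 0" by simp
  have \<rho>: "(\<lambda>x. \<beta> x * (1 / m)) \<in> Cinf_compact"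
    using test_functions_mult[of \<beta> UNIV "\<lambda>_. 1 / m"] \<beta>(1) by (simp add: test_functions_UNIV)
  show ?thesis
  proof (rule that[OF \<rho>])
    show "(LINT x|lborel. \<beta> x * (1 / m)) = 1" using m by (simp add: m_def)
    show "norm x < r" if "\<beta> x * (1 / m) \<noteq> 0" for x
      using that \<beta>(2)[of x] \<beta>(3)[of x] by (auto simp: less_eq_real_def)
  qed (use \<beta>(2) m in auto)
qed

lemma mollified_close:
  fixes \<Psi> :: "'a::euclidean_space \<Rightarrow> real"
  assumes \<Psi>: "bdd_borel \<Psi>" and c: "\<And>y. norm (y - x) < r \<Longrightarrow> \<bar>\<Psi> y - \<Psi> x\<bar> \<le> e"
    and \<rho>: "\<rho> \<in> Cinf_compact" "\<And>x. 0 \<le> \<rho> x" "\<And>x. \<rho> x \<noteq> 0 \<Longrightarrow> norm x < r" "(LINT x|lborel. \<rho> x) = 1"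
  shows "\<bar>(LINT y|lborel. \<Psi> y * \<rho> (y - x)) - \<Psi> x\<bar> \<le> e"
proof -
  have [measurable]: "\<rho> \<in> borel_measurable borel" using Cinf_compact_bdd_borel[OF \<rho>(1)] by (rule bdd_borel_measurable)
  have t: "(\<lambda>y. \<rho> (y - x)) \<in> Cinf_compact" by (rule Cinf_compact_translate[OF \<rho>(1)])
  have i: "integrable lborel (\<lambda>y. \<Psi> y * \<rho> (y - x))" by (rule integrable_bdd_mult_Cinf[OF \<Psi> t])
  have j: "integrable lborel (\<lambda>y. \<rho> (y - x))" by (rule Cinf_compact_integrable[OF t])
  have one: "(LINT y|lborel. \<rho> (y - x)) = 1"
    using lborel_integral_shift[of \<rho> "- x"] \<rho>(4) by simp
  have "(LINT y|lborel. \<Psi> y * \<rho> (y - x)) - \<Psi> x = (LINT y|lborel. (\<Psi> y - \<Psi> x) * \<rho> (y - x))"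
    using i j one by (simp add: left_diff_distrib)
  also have "\<bar>\<dots>\<bar> \<le> (LINT y|lborel. norm ((\<Psi> y - \<Psi> x) * \<rho> (y - x)))"
    using integral_norm_bound[of lborel "\<lambda>y. (\<Psi> y - \<Psi> x) * \<rho> (y - x)"] by simp
  also have "\<dots> \<le> (LINT y|lborel. e * \<rho> (y - x))"
  proof (rule integral_mono)
    show "integrable lborel (\<lambda>y. norm ((\<Psi> y - \<Psi> x) * \<rho> (y - x)))"
      using i j by (intro integrable_norm) (simp add: left_diff_distrib)
    show "norm ((\<Psi> y - \<Psi> x) * \<rho> (y - x)) \<le> e * \<rho> (y - x)" for y
      using c[of y] \<rho>(2,3)[of "y - x"] by (cases "\<rho> (y - x) = 0") (auto simp: abs_mult intro!: mult_right_mono)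
  qed (use j in simp)
  also have "\<dots> = e" using one by simp
  finally show ?thesis .
qed

text \<open>
  The hypothesis says that the distributional derivative of \<open>\<Psi>\<close> along \<open>v\<close> is bounded by \<open>C\<close>.  Along the
  segment from \<open>0\<close> to \<open>v\<close> the mollified function \<open>\<sigma> \<mapsto> \<integral> \<Psi>(y) \<rho>(y - \<sigma>v) dy\<close> is differentiable with
  derivative at most \<open>C \<integral> \<rho> = C\<close>, and at both ends it is close to \<open>\<Psi>\<close>, which is continuous.
\<close>

lemma lipschitz_from_weak_derivative:
  fixes \<Psi> :: "'a::euclidean_space \<Rightarrow> real"
  assumes \<Psi>: "bdd_borel \<Psi>" and cont: "continuous_on UNIV \<Psi>"
    and bd: "\<And>\<theta>. \<theta> \<in> Cinf_compact \<Longrightarrow> (\<And>x. 0 \<le> \<theta> x) \<Longrightarrow>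
      \<bar>LINT y|lborel. \<Psi> y * dir_deriv v \<theta> y\<bar> \<le> C * (LINT y|lborel. \<theta> y)"
  shows "\<bar>\<Psi> v - \<Psi> 0\<bar> \<le> C"
proof (rule field_le_epsilon)
  fix e :: real assume "e > 0"
  then have e: "e / 2 > 0" by simp
  have "isCont \<Psi> x" for x using cont by (simp add: continuous_on_eq_continuous_at)
  then have "\<exists>r>0. \<forall>y. norm (y - x) < r \<longrightarrow> \<bar>\<Psi> y - \<Psi> x\<bar> \<le> e / 2" for x
    using e unfolding continuous_at_eps_delta dist_norm real_norm_def by (meson less_imp_le)
  then obtain r0 r1 where r: "r0 > 0" "\<And>y. norm (y - 0) < r0 \<Longrightarrow> \<bar>\<Psi> y - \<Psi> 0\<bar> \<le> e / 2"
    "r1 > 0" "\<And>y. norm (y - v) < r1 \<Longrightarrow> \<bar>\<Psi> y - \<Psi> v\<bar> \<le> e / 2" by metis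
  have "min r0 r1 > 0" using r by simp
  from exists_mollifier[OF this]
  obtain \<rho> :: "'a \<Rightarrow> real" where \<rho>: "\<rho> \<in> Cinf_compact" "\<And>x. 0 \<le> \<rho> x" "\<And>x. \<rho> x \<noteq> 0 \<Longrightarrow> norm x < min r0 r1"
    "(LINT x|lborel. \<rho> x) = 1" by blast
  have \<rho>m[measurable]: "\<rho> \<in> borel_measurable borel" using Cinf_compact_bdd_borel[OF \<rho>(1)] by (rule bdd_borel_measurable)
  define m where "m \<sigma> = (LINT y|lborel. \<Psi> y * \<rho> (y - \<sigma> *\<^sub>R v))" for \<sigma>
  define m' where "m' \<sigma> = (LINT y|lborel. \<Psi> y * dir_deriv (- v) (\<lambda>y. \<rho> (y - \<sigma> *\<^sub>R v)) y)" for \<sigma>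
  have m': "(m has_real_derivative m' \<sigma>) (at \<sigma>)" for \<sigma>
  proof -
    have F: "(\<lambda>y. \<rho> (y - \<sigma> *\<^sub>R v)) \<in> Cinf_compact" for \<sigma> by (rule Cinf_compact_translate[OF \<rho>(1)])
    have i: "integrable lborel (\<lambda>y. \<Psi> y * \<rho> (y - \<sigma> *\<^sub>R v))" for \<sigma> by (rule integrable_bdd_mult_Cinf[OF \<Psi> F])
    have "(LINT y|lborel. \<Psi> y * ((\<rho> (y + h *\<^sub>R (- v) - \<sigma> *\<^sub>R v) - \<rho> (y - \<sigma> *\<^sub>R v)) / h)) = (m (\<sigma> + h) - m \<sigma>) / h" for h
    proof -
      have "y + h *\<^sub>R (- v) - \<sigma> *\<^sub>R v = y - (\<sigma> + h) *\<^sub>R v" for y by (simp add: algebra_simps)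
      then have "(LINT y|lborel. \<Psi> y * ((\<rho> (y + h *\<^sub>R (- v) - \<sigma> *\<^sub>R v) - \<rho> (y - \<sigma> *\<^sub>R v)) / h))
        = (LINT y|lborel. (\<Psi> y * \<rho> (y - (\<sigma> + h) *\<^sub>R v) - \<Psi> y * \<rho> (y - \<sigma> *\<^sub>R v)) / h)"
        by (simp only: right_diff_distrib times_divide_eq_right)
      then show ?thesis using i[of "\<sigma> + h"] i[of \<sigma>] by (simp add: m_def)
    qed
    with difference_quotient_tendsto[OF F[of \<sigma>] \<Psi>, of "- v"]
    show ?thesis by (simp only: DERIV_def m'_def)
  qed
  have m'b: "\<bar>m' \<sigma>\<bar> \<le> C" for \<sigma>
  proof -
    have F: "(\<lambda>y. \<rho> (y - \<sigma> *\<^sub>R v)) \<in> Cinf_compact" by (rule Cinf_compact_translate[OF \<rho>(1)])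
    have "dir_deriv (- v) (\<lambda>y. \<rho> (y - \<sigma> *\<^sub>R v)) y = - dir_deriv v (\<lambda>y. \<rho> (y - \<sigma> *\<^sub>R v)) y" for y
      using dir_deriv_scaleR_vec[OF Cinf_compact_smooth[OF F], of "-1" v y] by simp
    then have "\<bar>m' \<sigma>\<bar> = \<bar>LINT y|lborel. \<Psi> y * dir_deriv v (\<lambda>y. \<rho> (y - \<sigma> *\<^sub>R v)) y\<bar>"
      by (simp add: m'_def)
    also have "\<dots> \<le> C * (LINT y|lborel. \<rho> (y - \<sigma> *\<^sub>R v))" by (rule bd[OF F \<rho>(2)])
    also have "\<dots> = C" using lborel_integral_shift[of \<rho> "- (\<sigma> *\<^sub>R v)"] \<rho>(4) by simp
    finally show ?thesis .
  qed
  obtain z where "m 1 - m 0 = (1 - 0) * m' z" using MVT2[OF zero_less_one, of m m'] m' by blast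
  then have "\<bar>m 1 - m 0\<bar> \<le> C" using m'b by simp
  moreover have "\<bar>m 1 - \<Psi> v\<bar> \<le> e / 2"
    using mollified_close[OF \<Psi>, of v r1 "e / 2" \<rho>] r \<rho> by (simp add: m_def)
  moreover have "\<bar>m 0 - \<Psi> 0\<bar> \<le> e / 2"
    using mollified_close[OF \<Psi>, of 0 r0 "e / 2" \<rho>] r \<rho> by (simp add: m_def)
  ultimately show "\<bar>\<Psi> v - \<Psi> 0\<bar> \<le> C + e" by linarith
qed

section \<open>Pairing two functions through a kernel\<close>

text \<open>
  This is \<open>\<integral>\<integral> F(p) K(q) \<kappa>(p - q) dp dq\<close>.  All bilinear terms of the proof have this form, where \<open>\<kappa>\<close>
  is a test function or one of its derivatives.
\<close>

definition pairing :: "('a::euclidean_space \<Rightarrow> real) \<Rightarrow> ('a \<Rightarrow> real) \<Rightarrow> ('a \<Rightarrow> real) \<Rightarrow> real" where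
  "pairing F K \<kappa> = (LINT z|lebesgue_pairs. F (fst z) * K (snd z) * \<kappa> (fst z - snd z))"

lemma pairing_bound:
  assumes "L2 F" "L2 K" "integrable lborel \<kappa>"
  shows "\<bar>pairing F K \<kappa>\<bar> \<le> ((LINT p|lborel. (F p)\<^sup>2) + (LINT p|lborel. (K p)\<^sup>2)) * (LINT p|lborel. \<bar>\<kappa> p\<bar>)"
  using Young_L2(2)[OF assms] by (simp add: pairing_def case_prod_beta')

lemma pairing_snd:
  assumes "L2 F" "L2 K" "integrable lborel \<kappa>"
  shows "(LINT q|lborel. K q * (LINT p|lborel. F p * \<kappa> (p - q))) = pairing F K \<kappa>"
proof -
  have "(LINT q|lborel. LINT p|lborel. F p * K q * \<kappa> (p - q)) = pairing F K \<kappa>"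
    using lborel_pair.integral_snd[OF Young_L2(1)[OF assms]] by (simp add: pairing_def case_prod_beta')
  moreover have "(LINT p|lborel. F p * K q * \<kappa> (p - q)) = K q * (LINT p|lborel. F p * \<kappa> (p - q))" for q
    by (subst integral_mult_right_zero[symmetric]) (simp add: ac_simps)
  ultimately show ?thesis by simp
qed

lemma pairing_fst:
  assumes "L2 F" "L2 K" "integrable lborel \<kappa>"
  shows "(LINT p|lborel. F p * (LINT q|lborel. K q * \<kappa> (p - q))) = pairing F K \<kappa>"
proof -
  have "(LINT p|lborel. LINT q|lborel. F p * K q * \<kappa> (p - q)) = pairing F K \<kappa>"
    using lborel_pair.integral_fst[OF Young_L2(1)[OF assms]] by (simp add: pairing_def case_prod_beta')
  moreover have "(LINT q|lborel. F p * K q * \<kappa> (p - q)) = F p * (LINT q|lborel. K q * \<kappa> (p - q))" for p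
    by (subst integral_mult_right_zero[symmetric]) (simp add: ac_simps)
  ultimately show ?thesis by simp
qed

lemma pairing_uminus_kernel: "pairing F K (\<lambda>p. - \<kappa> p) = - pairing F K \<kappa>"
  by (simp add: pairing_def)

lemma pairing_swap:
  assumes "L2 F" "L2 K" "integrable lborel \<kappa>"
  shows "pairing F K \<kappa> = pairing K F (\<lambda>z. \<kappa> (- z))"
proof -
  have [measurable]: "\<kappa> \<in> borel_measurable borel" using borel_measurable_integrable[OF assms(3)] by simp
  have k: "integrable lborel (\<lambda>z. \<kappa> (- z))"
    using lborel_integrable_reflect[of \<kappa> 0] assms(3) by simp
  show ?thesis
    using pairing_fst[OF assms] pairing_snd[OF assms(2,1) k] by simp
qed

section \<open>Localised weak derivatives and entropy balances\<close>

definition weakD :: "'a::euclidean_space set \<Rightarrow> 'a \<Rightarrow> ('a \<Rightarrow> real) \<Rightarrow> ('a \<Rightarrow> real) \<Rightarrow> bool" where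
  "weakD V d A a \<longleftrightarrow> (\<forall>\<phi>\<in>test_functions V.
     (LINT p|lborel. A p * dir_deriv d \<phi> p) = - (LINT p|lborel. a p * \<phi> p))"

text \<open>
  The integrand in the weak form of \<open>\<partial>\<^sub>t A + \<partial>\<^sub>x B - \<partial>\<^sub>d\<^sup>2 R\<close>, with all derivatives on the test function.
  The three directions are arbitrary vectors here; they will be \<open>e_t\<close>, \<open>e_1 + e_2\<close> and \<open>e_D\<close>.
\<close>

definition dual_op ::
  "'a::euclidean_space \<Rightarrow> 'a \<Rightarrow> 'a \<Rightarrow> ('a \<Rightarrow> real) \<Rightarrow> ('a \<Rightarrow> real) \<Rightarrow> ('a \<Rightarrow> real) \<Rightarrow> ('a \<Rightarrow> real) \<Rightarrow> 'a \<Rightarrow> real" where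
  "dual_op t x d A B R \<phi> p =
     A p * dir_deriv t \<phi> p + B p * dir_deriv x \<phi> p + R p * dir_deriv d (dir_deriv d \<phi>) p"

definition dissipative where
  "dissipative V t x d A B R \<longleftrightarrow> bdd_borel A \<and> bdd_borel B \<and> bdd_borel R \<and>
     (\<forall>\<phi>\<in>test_functions V. (\<forall>p. 0 \<le> \<phi> p) \<longrightarrow> 0 \<le> (LINT p|lborel. dual_op t x d A B R \<phi> p))"

locale cutoff =
  fixes V :: "'a::euclidean_space set" and \<zeta> :: "'a \<Rightarrow> real" and t x d :: 'a
  assumes \<zeta>: "\<zeta> \<in> test_functions V" and \<zeta>0: "\<And>p. 0 \<le> \<zeta> p"
begin

lemma \<zeta>C: "\<zeta> \<in> Cinf_compact" using \<zeta> by (simp add: test_functions_iff)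
lemma \<zeta>s: "smooth \<zeta>" using \<zeta> by (rule test_functions_smooth)

lemma loc_test: "smooth \<psi> \<Longrightarrow> (\<lambda>p. \<zeta> p * \<psi> p) \<in> test_functions V"
  by (rule test_functions_mult[OF \<zeta>])

lemma test_Cinf: "\<phi> \<in> test_functions V \<Longrightarrow> \<phi> \<in> Cinf_compact" by (simp add: test_functions_iff)

lemma loc_L2: "bdd_borel A \<Longrightarrow> L2 (\<lambda>p. A p * \<zeta> p)"
  by (rule L2_bdd_mult[OF _ Cinf_compact_L2[OF \<zeta>C]])

text \<open>
  After multiplication with a cutoff, the weak derivative on \<open>V\<close> becomes one on the whole space, and
  the function \<open>\<psi>\<close> needs no compact support any more.
\<close>

lemma weak_local:
  assumes A: "bdd_borel A" "L2 a" "weakD V d A a" and \<psi>: "smooth \<psi>"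
  shows "(LINT p|lborel. (A p * \<zeta> p) * dir_deriv d \<psi> p)
    = - (LINT p|lborel. (\<zeta> p * a p + A p * dir_deriv d \<zeta> p) * \<psi> p)"
proof -
  have t1: "(\<lambda>p. \<zeta> p * dir_deriv d \<psi> p) \<in> Cinf_compact"
    by (rule test_Cinf[OF loc_test[OF smooth_dir_deriv[OF \<psi>]]])
  have t2: "(\<lambda>p. dir_deriv d \<zeta> p * \<psi> p) \<in> Cinf_compact"
    by (rule test_Cinf[OF test_functions_mult[OF test_functions_dir_deriv[OF \<zeta>] \<psi>]])
  have t3: "(\<lambda>p. \<zeta> p * \<psi> p) \<in> Cinf_compact" by (rule test_Cinf[OF loc_test[OF \<psi>]])
  note i1 = integrable_bdd_mult_Cinf[OF A(1) t1] and i2 = integrable_bdd_mult_Cinf[OF A(1) t2]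
  have i3: "integrable lborel (\<lambda>p. a p * (\<zeta> p * \<psi> p))"
    by (rule L2_mult_integrable[OF A(2) Cinf_compact_L2[OF t3]])
  have "(LINT p|lborel. A p * dir_deriv d (\<lambda>p. \<zeta> p * \<psi> p) p) = - (LINT p|lborel. a p * (\<zeta> p * \<psi> p))"
    using A(3) loc_test[OF \<psi>] by (simp add: weakD_def)
  also have "(LINT p|lborel. A p * dir_deriv d (\<lambda>p. \<zeta> p * \<psi> p) p)
     = (LINT p|lborel. A p * (dir_deriv d \<zeta> p * \<psi> p) + A p * (\<zeta> p * dir_deriv d \<psi> p))"
    by (simp add: dir_deriv_mult[OF \<zeta>s \<psi>] distrib_left)
  also have "\<dots> = (LINT p|lborel. A p * (dir_deriv d \<zeta> p * \<psi> p)) + (LINT p|lborel. A p * (\<zeta> p * dir_deriv d \<psi> p))"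
    by (rule Bochner_Integration.integral_add[OF i2 i1])
  finally have "(LINT p|lborel. A p * (\<zeta> p * dir_deriv d \<psi> p))
     = - ((LINT p|lborel. a p * (\<zeta> p * \<psi> p)) + (LINT p|lborel. A p * (dir_deriv d \<zeta> p * \<psi> p)))" by linarith
  also have "\<dots> = - (LINT p|lborel. a p * (\<zeta> p * \<psi> p) + A p * (dir_deriv d \<zeta> p * \<psi> p))"
    by (simp only: Bochner_Integration.integral_add[OF i3 i2])
  finally show ?thesis by (simp add: algebra_simps)
qed

lemma weak_local_L2:
  assumes "bdd_borel A" "L2 a"
  shows "L2 (\<lambda>p. \<zeta> p * a p + A p * dir_deriv d \<zeta> p)"
  by (intro L2_add L2_bdd_mult assms Cinf_compact_bdd_borel[OF \<zeta>C] Cinf_compact_L2 Cinf_compact_dir_deriv \<zeta>C)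

lemma dir_deriv_loc:
  assumes "smooth \<psi>"
  shows "dir_deriv v (\<lambda>p. \<zeta> p * \<psi> p) = (\<lambda>p. dir_deriv v \<zeta> p * \<psi> p + \<zeta> p * dir_deriv v \<psi> p)"
  by (rule ext) (simp add: dir_deriv_mult[OF \<zeta>s assms])

lemma dual_op_loc:
  assumes "smooth \<psi>"
  shows "dual_op t x d A B R (\<lambda>p. \<zeta> p * \<psi> p) p =
    dual_op t x d A B R \<zeta> p * \<psi> p + (A p * \<zeta> p) * dir_deriv t \<psi> p + (B p * \<zeta> p) * dir_deriv x \<psi> p
    + (2 * R p * dir_deriv d \<zeta> p) * dir_deriv d \<psi> p + (R p * \<zeta> p) * dir_deriv d (dir_deriv d \<psi>) p"
proof -
  have "dir_deriv d (\<lambda>p. dir_deriv d \<zeta> p * \<psi> p + \<zeta> p * dir_deriv d \<psi> p) p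
    = (dir_deriv d (dir_deriv d \<zeta>) p * \<psi> p + dir_deriv d \<zeta> p * dir_deriv d \<psi> p)
     + (dir_deriv d \<zeta> p * dir_deriv d \<psi> p + \<zeta> p * dir_deriv d (dir_deriv d \<psi>) p)"
    by (subst dir_deriv_add) (simp_all add: dir_deriv_mult smooth_mult smooth_dir_deriv \<zeta>s assms)
  then show ?thesis unfolding dual_op_def dir_deriv_loc[OF assms] by (simp add: algebra_simps)
qed

lemma dual_op_bounded:
  assumes "bdd_borel A" "bdd_borel B" "bdd_borel R"
  shows "bdd_borel (dual_op t x d A B R \<zeta>)" "bounded {p. dual_op t x d A B R \<zeta> p \<noteq> 0}"
proof -
  have D: "dir_deriv v \<zeta> \<in> Cinf_compact" "dir_deriv d (dir_deriv d \<zeta>) \<in> Cinf_compact" for v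
    by (intro Cinf_compact_dir_deriv \<zeta>C)+
  show "bdd_borel (dual_op t x d A B R \<zeta>)"
    unfolding dual_op_def[abs_def]
    by (intro bdd_borel_add bdd_borel_mult assms Cinf_compact_bdd_borel D)
  have "bounded ({p. dir_deriv t \<zeta> p \<noteq> 0} \<union> {p. dir_deriv x \<zeta> p \<noteq> 0} \<union> {p. dir_deriv d (dir_deriv d \<zeta>) p \<noteq> 0})"
    using D by (simp add: Cinf_compact_iff)
  then show "bounded {p. dual_op t x d A B R \<zeta> p \<noteq> 0}"
    by (rule bounded_subset) (auto simp: dual_op_def)
qed

lemma translate_smooth: "\<theta> \<in> Cinf_compact \<Longrightarrow> smooth (\<lambda>p. \<theta> (p - q))"
  by (intro smooth_translate Cinf_compact_smooth)

lemma dual_op_loc_translate: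
  assumes "\<theta> \<in> Cinf_compact"
  shows "dual_op t x d A B R (\<lambda>p. \<zeta> p * \<theta> (p - q)) p =
    dual_op t x d A B R \<zeta> p * \<theta> (p - q) + (A p * \<zeta> p) * dir_deriv t \<theta> (p - q) + (B p * \<zeta> p) * dir_deriv x \<theta> (p - q)
    + (2 * R p * dir_deriv d \<zeta> p) * dir_deriv d \<theta> (p - q) + (R p * \<zeta> p) * dir_deriv d (dir_deriv d \<theta>) (p - q)"
proof -
  have s: "smooth \<theta>" by (rule Cinf_compact_smooth[OF assms])
  have 1: "dir_deriv v (\<lambda>p. \<theta> (p - q)) = (\<lambda>p. dir_deriv v \<theta> (p - q))" for v
    by (rule ext) (rule dir_deriv_translate[OF s])
  have 2: "dir_deriv d (\<lambda>p. dir_deriv d \<theta> (p - q)) p = dir_deriv d (dir_deriv d \<theta>) (p - q)"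
    by (rule dir_deriv_translate[OF smooth_dir_deriv[OF s]])
  show ?thesis unfolding dual_op_loc[OF translate_smooth[OF assms]] 1 2 by simp
qed

text \<open>
  Here the production measure is estimated.  Tested with the nonnegative functions
  \<open>p \<mapsto> \<zeta>(p) \<theta>(p - q)\<close> it gives numbers \<open>m(q) \<ge> 0\<close>, so a bounded weight \<open>k(q)\<close> costs only its supremum
  \<open>M\<close>.  The integral of \<open>m\<close> is computed exactly: integrating over \<open>q\<close> first turns \<open>\<theta>(p - q)\<close> into its
  mass and all its derivatives into zero, which leaves the measure tested with \<open>\<zeta>\<close>.
\<close>

lemma dissipative_bound:
  assumes D: "dissipative V t x d A B R" and k: "bdd_borel k" and M: "\<And>q. \<bar>k q\<bar> \<le> M"
    and \<theta>: "\<theta> \<in> Cinf_compact" "\<And>p. 0 \<le> \<theta> p"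
  shows "integrable lborel (\<lambda>q. k q * (LINT p|lborel. dual_op t x d A B R (\<lambda>p. \<zeta> p * \<theta> (p - q)) p))"
    and "\<bar>LINT q|lborel. k q * (LINT p|lborel. dual_op t x d A B R (\<lambda>p. \<zeta> p * \<theta> (p - q)) p)\<bar>
    \<le> M * (LINT p|lborel. dual_op t x d A B R \<zeta> p) * (LINT p|lborel. \<theta> p)" (is "\<bar>LINT q|lborel. k q * ?m q\<bar> \<le> ?b")
proof -
  have b: "bdd_borel A" "bdd_borel B" "bdd_borel R" using D by (auto simp: dissipative_def)
  have m0: "0 \<le> ?m q" for q
    using D loc_test[OF translate_smooth[OF \<theta>(1)], of q] \<zeta>0 \<theta>(2) by (auto simp: dissipative_def)
  have i\<theta>: "integrable lborel \<theta>" "integrable lborel (dir_deriv v \<theta>)" "integrable lborel (dir_deriv d (dir_deriv d \<theta>))" for v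
    by (intro Cinf_compact_integrable Cinf_compact_dir_deriv \<theta>)+
  have z: "(LINT p|lborel. dir_deriv v \<theta> p) = 0" "(LINT p|lborel. dir_deriv d (dir_deriv d \<theta>) p) = 0" for v
    by (intro integral_dir_deriv_zero Cinf_compact_dir_deriv \<theta>)+
  note j0 = conv_integrable[OF integrable_bounded_support[OF dual_op_bounded[OF b]] i\<theta>(1)]
  note j1 = conv_integrable[OF integrable_bdd_mult_Cinf[OF b(1) \<zeta>C] i\<theta>(2)[of t]]
  note j2 = conv_integrable[OF integrable_bdd_mult_Cinf[OF b(2) \<zeta>C] i\<theta>(2)[of x]]
  note j3 = conv_integrable[OF integrable_bdd_mult_Cinf[OF bdd_borel_mult[OF bdd_borel_const[of 2] b(3)] Cinf_compact_dir_deriv[OF \<zeta>C]] i\<theta>(2)[of d], of d]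
  note j4 = conv_integrable[OF integrable_bdd_mult_Cinf[OF b(3) \<zeta>C] i\<theta>(3)]
  have eq: "(\<lambda>(p, q). dual_op t x d A B R (\<lambda>p. \<zeta> p * \<theta> (p - q)) p) =
    (\<lambda>z. (case z of (p, q) \<Rightarrow> dual_op t x d A B R \<zeta> p * \<theta> (p - q)) + (case z of (p, q) \<Rightarrow> (A p * \<zeta> p) * dir_deriv t \<theta> (p - q))
      + (case z of (p, q) \<Rightarrow> (B p * \<zeta> p) * dir_deriv x \<theta> (p - q)) + (case z of (p, q) \<Rightarrow> (2 * R p * dir_deriv d \<zeta> p) * dir_deriv d \<theta> (p - q))
      + (case z of (p, q) \<Rightarrow> (R p * \<zeta> p) * dir_deriv d (dir_deriv d \<theta>) (p - q)))"
    by (rule ext) (simp add: case_prod_beta' dual_op_loc_translate[OF \<theta>(1)])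
  have int: "integrable lebesgue_pairs (\<lambda>(p, q). dual_op t x d A B R (\<lambda>p. \<zeta> p * \<theta> (p - q)) p)"
    unfolding eq by (intro Bochner_Integration.integrable_add j0(1) j1(1) j2(1) j3(1) j4(1))
  have val: "(LINT z|lebesgue_pairs. (case z of (p, q) \<Rightarrow> dual_op t x d A B R (\<lambda>p. \<zeta> p * \<theta> (p - q)) p))
     = (LINT p|lborel. dual_op t x d A B R \<zeta> p) * (LINT p|lborel. \<theta> p)"
    unfolding eq
    by (simp only: Bochner_Integration.integral_add Bochner_Integration.integrable_add j0(1) j1(1) j2(1) j3(1) j4(1)
        j0(2) j1(2) j2(2) j3(2) j4(2) z mult_zero_right add_0_right)
  have mi: "integrable lborel ?m" by (rule lborel_pair.integrable_snd[OF int])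
  have mv: "(LINT q|lborel. ?m q) = (LINT p|lborel. dual_op t x d A B R \<zeta> p) * (LINT p|lborel. \<theta> p)"
    using lborel_pair.integral_snd[OF int] val by simp
  show km: "integrable lborel (\<lambda>q. k q * ?m q)"
  proof (rule Bochner_Integration.integrable_bound[of _ "\<lambda>q. M * ?m q"])
    show "integrable lborel (\<lambda>q. M * ?m q)" using mi by simp
    show "(\<lambda>q. k q * ?m q) \<in> borel_measurable lborel"
      using borel_measurable_integrable[OF mi] bdd_borel_measurable[OF k] by measurable
    show "AE q in lborel. norm (k q * ?m q) \<le> norm (M * ?m q)"
    proof (rule AE_I2)
      fix q
      have "\<bar>k q\<bar> \<le> \<bar>M\<bar>" using M[of q] by linarith
      then show "norm (k q * ?m q) \<le> norm (M * ?m q)" by (simp add: abs_mult mult_right_mono)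
    qed
  qed
  have "\<bar>LINT q|lborel. k q * ?m q\<bar> \<le> (LINT q|lborel. norm (k q * ?m q))"
    using integral_norm_bound[of lborel "\<lambda>q. k q * ?m q"] by simp
  also have "\<dots> \<le> (LINT q|lborel. M * ?m q)"
  proof (rule integral_mono)
    show "integrable lborel (\<lambda>q. norm (k q * ?m q))" using km by (rule integrable_norm)
    show "norm (k q * ?m q) \<le> M * ?m q" for q
      using M[of q] m0[of q] by (simp add: abs_mult mult_right_mono)
  qed (use mi in simp)
  also have "\<dots> = M * (LINT p|lborel. dual_op t x d A B R \<zeta> p) * (LINT p|lborel. \<theta> p)"
    using mv by simp
  finally show "\<bar>LINT q|lborel. k q * ?m q\<bar> \<le> ?b" .
qed

end

section \<open>Functionals bounded by the mass of the test function\<close>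

text \<open>
  A bounded function whose distributional derivative in the degenerate direction \<open>d\<close> is square
  integrable.
\<close>

definition D_regular where
  "D_regular V d A \<longleftrightarrow> bdd_borel A \<and> (\<exists>a. L2 a \<and> weakD V d A a)"

text \<open>
  A difference of two dissipative triples: the balance law holds up to a signed measure that is
  finite on compact sets.
\<close>

definition balanced where
  "balanced V t x d A B R \<longleftrightarrow> (\<exists>A1 B1 R1 A2 B2 R2.
     dissipative V t x d A1 B1 R1 \<and> dissipative V t x d A2 B2 R2 \<and>
     A = (\<lambda>p. A1 p - A2 p) \<and> B = (\<lambda>p. B1 p - B2 p) \<and> R = (\<lambda>p. R1 p - R2 p))"

text \<open>
  Only nonnegative \<open>\<theta>\<close> occur, so the bound is by the \<open>L\<^sup>1\<close> norm of \<open>\<theta>\<close> and is insensitive to how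
  concentrated \<open>\<theta>\<close> is.
\<close>

definition mass_bounded :: "(('a::euclidean_space \<Rightarrow> real) \<Rightarrow> real) \<Rightarrow> bool" where
  "mass_bounded f \<longleftrightarrow> (\<exists>C. \<forall>\<theta>\<in>Cinf_compact. (\<forall>p. 0 \<le> \<theta> p) \<longrightarrow> \<bar>f \<theta>\<bar> \<le> C * (LINT p|lborel. \<theta> p))"

lemma mass_boundedI:
  "(\<And>\<theta>. \<theta> \<in> Cinf_compact \<Longrightarrow> (\<And>p. 0 \<le> \<theta> p) \<Longrightarrow> \<bar>f \<theta>\<bar> \<le> C * (LINT p|lborel. \<theta> p)) \<Longrightarrow> mass_bounded f"
  by (auto simp: mass_bounded_def)

lemma mass_bounded_add:
  assumes "mass_bounded f" "mass_bounded g" shows "mass_bounded (\<lambda>\<theta>. f \<theta> + g \<theta>)"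
proof -
  obtain C D where "\<And>\<theta>. \<theta> \<in> Cinf_compact \<Longrightarrow> (\<forall>p. 0 \<le> \<theta> p) \<Longrightarrow> \<bar>f \<theta>\<bar> \<le> C * (LINT p|lborel. \<theta> p)"
    "\<And>\<theta>. \<theta> \<in> Cinf_compact \<Longrightarrow> (\<forall>p. 0 \<le> \<theta> p) \<Longrightarrow> \<bar>g \<theta>\<bar> \<le> D * (LINT p|lborel. \<theta> p)"
    using assms unfolding mass_bounded_def by metis
  then show ?thesis
    by (intro mass_boundedI[of _ "C + D"]) (fastforce simp: distrib_right intro: order_trans[OF abs_triangle_ineq] add_mono)
qed

lemma mass_bounded_scale:
  assumes "mass_bounded f" shows "mass_bounded (\<lambda>\<theta>. c * f \<theta>)"
proof -
  obtain C where "\<And>\<theta>. \<theta> \<in> Cinf_compact \<Longrightarrow> (\<forall>p. 0 \<le> \<theta> p) \<Longrightarrow> \<bar>f \<theta>\<bar> \<le> C * (LINT p|lborel. \<theta> p)"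
    using assms unfolding mass_bounded_def by metis
  then show ?thesis
    by (intro mass_boundedI[of _ "\<bar>c\<bar> * C"]) (simp add: abs_mult mult.assoc mult_left_mono)
qed

lemma mass_bounded_uminus: "mass_bounded f \<Longrightarrow> mass_bounded (\<lambda>\<theta>. - f \<theta>)"
  using mass_bounded_scale[of f "-1"] by simp

lemma mass_bounded_diff: "mass_bounded f \<Longrightarrow> mass_bounded g \<Longrightarrow> mass_bounded (\<lambda>\<theta>. f \<theta> - g \<theta>)"
  using mass_bounded_add[OF _ mass_bounded_uminus] by fastforce

lemma mass_bounded_cong:
  assumes "mass_bounded f" "\<And>\<theta>. \<theta> \<in> Cinf_compact \<Longrightarrow> (\<And>p. 0 \<le> \<theta> p) \<Longrightarrow> g \<theta> = f \<theta>"
  shows "mass_bounded g"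
  using assms unfolding mass_bounded_def by fastforce

lemma mass_bounded_pairing:
  assumes "L2 F" "L2 K" shows "mass_bounded (\<lambda>\<theta>. pairing F K \<theta>)"
proof (rule mass_boundedI[of _ "(LINT p|lborel. (F p)\<^sup>2) + (LINT p|lborel. (K p)\<^sup>2)"])
  fix \<theta> :: "'a \<Rightarrow> real" assume \<theta>: "\<theta> \<in> Cinf_compact" "\<And>p. 0 \<le> \<theta> p"
  show "\<bar>pairing F K \<theta>\<bar> \<le> ((LINT p|lborel. (F p)\<^sup>2) + (LINT p|lborel. (K p)\<^sup>2)) * (LINT p|lborel. \<theta> p)"
    using pairing_bound[OF assms Cinf_compact_integrable[OF \<theta>(1)]] \<theta>(2) by simp
qed

lemma mass_bounded_reflect:
  assumes "mass_bounded f" shows "mass_bounded (\<lambda>\<theta>. f (\<lambda>z. \<theta> (- z)))"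
proof -
  obtain C where C: "\<And>\<theta>. \<theta> \<in> Cinf_compact \<Longrightarrow> (\<forall>p. 0 \<le> \<theta> p) \<Longrightarrow> \<bar>f \<theta>\<bar> \<le> C * (LINT p|lborel. \<theta> p)"
    using assms unfolding mass_bounded_def by metis
  show ?thesis
  proof (rule mass_boundedI[of _ C])
    fix \<theta> :: "'a \<Rightarrow> real" assume \<theta>: "\<theta> \<in> Cinf_compact" "\<And>p. 0 \<le> \<theta> p"
    have "(\<lambda>z. \<theta> (0 - z)) \<in> Cinf_compact" by (rule Cinf_compact_reflect[OF \<theta>(1)])
    then have "\<bar>f (\<lambda>z. \<theta> (- z))\<bar> \<le> C * (LINT p|lborel. \<theta> (- p))" using C[of "\<lambda>z. \<theta> (- z)"] \<theta>(2) by simp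
    then show "\<bar>f (\<lambda>z. \<theta> (- z))\<bar> \<le> C * (LINT p|lborel. \<theta> p)"
      using lborel_integral_reflect[OF bdd_borel_measurable[OF Cinf_compact_bdd_borel[OF \<theta>(1)]], of 0] by simp
  qed
qed

lemma pairing_snd_integrable:
  assumes "L2 F" "L2 K" "integrable lborel \<kappa>"
  shows "integrable lborel (\<lambda>q. K q * (LINT p|lborel. F p * \<kappa> (p - q)))"
proof -
  have "integrable lborel (\<lambda>q. LINT p|lborel. F p * K q * \<kappa> (p - q))"
    using lborel_pair.integrable_snd[OF Young_L2(1)[OF assms]] .
  moreover have "(LINT p|lborel. F p * K q * \<kappa> (p - q)) = K q * (LINT p|lborel. F p * \<kappa> (p - q))" for q
    by (subst integral_mult_right_zero[symmetric]) (simp add: ac_simps)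
  ultimately show ?thesis by simp
qed

context cutoff
begin

lemma inner_integrable:
  assumes "L2 F" "\<kappa> \<in> Cinf_compact" shows "integrable lborel (\<lambda>p. F p * \<kappa> (p - q))"
  by (rule L2_mult_integrable[OF assms(1) Cinf_compact_L2[OF Cinf_compact_translate[OF assms(2)]]])

text \<open>
  The second order term is harmless because its two derivatives in the direction \<open>d\<close> can be
  distributed: one falls on \<open>R\<close>, and the other one, which acts on \<open>\<theta>(p - q)\<close>, is a derivative in \<open>q\<close>
  up to the sign and falls on \<open>c\<close>.  What remains is a pairing of \<open>L\<^sup>2\<close> functions with kernel \<open>\<theta>\<close>.
\<close>

lemma diffusion_bounded:
  assumes R: "D_regular V d R" and c: "D_regular V d c"
  shows "mass_bounded (\<lambda>\<theta>. LINT q|lborel. (c q * \<zeta> q) *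
    (LINT p|lborel. R p * dir_deriv d (dir_deriv d (\<lambda>p. \<zeta> p * \<theta> (p - q))) p))"
proof -
  obtain r where r: "L2 r" "weakD V d R r" using R by (auto simp: D_regular_def)
  obtain c' where c': "L2 c'" "weakD V d c c'" using c by (auto simp: D_regular_def)
  have cb: "bdd_borel c" using c by (simp add: D_regular_def)
  let ?K = "\<lambda>q. c q * \<zeta> q"
  let ?c = "\<lambda>p. \<zeta> p * c' p + c p * dir_deriv d \<zeta> p"
  have LK: "L2 ?K" by (rule loc_L2[OF cb])
  have Lc: "L2 ?c" by (rule weak_local_L2[OF cb c'(1)])
  have L1: "L2 (\<lambda>p. dir_deriv d \<zeta> p * r p)"
    by (rule L2_bdd_mult[OF Cinf_compact_bdd_borel[OF Cinf_compact_dir_deriv[OF \<zeta>C]] r(1)])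
  have L0: "L2 (\<lambda>p. \<zeta> p * r p)"
    by (rule L2_bdd_mult[OF Cinf_compact_bdd_borel[OF \<zeta>C] r(1)])
  have "mass_bounded (\<lambda>\<theta>. - (pairing (\<lambda>p. dir_deriv d \<zeta> p * r p) ?K \<theta> + pairing (\<lambda>p. \<zeta> p * r p) ?c \<theta>))"
    by (intro mass_bounded_uminus mass_bounded_add mass_bounded_pairing L0 L1 LK Lc)
  then show ?thesis
  proof (rule mass_bounded_cong)
    fix \<theta> :: "'a \<Rightarrow> real" assume \<theta>: "\<theta> \<in> Cinf_compact"
    have s: "smooth \<theta>" by (rule Cinf_compact_smooth[OF \<theta>])
    have D\<theta>: "dir_deriv d \<theta> \<in> Cinf_compact" by (rule Cinf_compact_dir_deriv[OF \<theta>])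
    note i\<theta> = Cinf_compact_integrable[OF \<theta>] Cinf_compact_integrable[OF D\<theta>]
    have tr: "dir_deriv d (\<lambda>p. \<theta> (p - q)) = (\<lambda>p. dir_deriv d \<theta> (p - q))" for q
      by (rule ext) (rule dir_deriv_translate[OF s])
    have inner: "(LINT p|lborel. R p * dir_deriv d (dir_deriv d (\<lambda>p. \<zeta> p * \<theta> (p - q))) p)
      = - ((LINT p|lborel. (dir_deriv d \<zeta> p * r p) * \<theta> (p - q)) + (LINT p|lborel. (\<zeta> p * r p) * dir_deriv d \<theta> (p - q)))" for q
    proof -
      have "(LINT p|lborel. R p * dir_deriv d (dir_deriv d (\<lambda>p. \<zeta> p * \<theta> (p - q))) p)
        = - (LINT p|lborel. r p * dir_deriv d (\<lambda>p. \<zeta> p * \<theta> (p - q)) p)"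
        using r(2) test_functions_dir_deriv[OF loc_test[OF translate_smooth[OF \<theta>]]] by (simp add: weakD_def)
      also have "(LINT p|lborel. r p * dir_deriv d (\<lambda>p. \<zeta> p * \<theta> (p - q)) p)
        = (LINT p|lborel. (dir_deriv d \<zeta> p * r p) * \<theta> (p - q) + (\<zeta> p * r p) * dir_deriv d \<theta> (p - q))"
        unfolding dir_deriv_loc[OF translate_smooth[OF \<theta>]] tr by (simp add: algebra_simps)
      also have "\<dots> = (LINT p|lborel. (dir_deriv d \<zeta> p * r p) * \<theta> (p - q)) + (LINT p|lborel. (\<zeta> p * r p) * dir_deriv d \<theta> (p - q))"
        by (rule Bochner_Integration.integral_add[OF inner_integrable[OF L1 \<theta>] inner_integrable[OF L0 D\<theta>]])
      finally show ?thesis .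
    qed
    have "(LINT q|lborel. ?K q * (LINT p|lborel. R p * dir_deriv d (dir_deriv d (\<lambda>p. \<zeta> p * \<theta> (p - q))) p))
      = (LINT q|lborel. - (?K q * (LINT p|lborel. (dir_deriv d \<zeta> p * r p) * \<theta> (p - q))
        + ?K q * (LINT p|lborel. (\<zeta> p * r p) * dir_deriv d \<theta> (p - q))))"
      unfolding inner by (simp add: algebra_simps)
    also have "\<dots> = - (pairing (\<lambda>p. dir_deriv d \<zeta> p * r p) ?K \<theta> + pairing (\<lambda>p. \<zeta> p * r p) ?K (dir_deriv d \<theta>))"
      unfolding integral_minus Bochner_Integration.integral_add[OF pairing_snd_integrable[OF L1 LK i\<theta>(1)] pairing_snd_integrable[OF L0 LK i\<theta>(2)]]
        pairing_snd[OF L1 LK i\<theta>(1)] pairing_snd[OF L0 LK i\<theta>(2)] by simp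
    also have "pairing (\<lambda>p. \<zeta> p * r p) ?K (dir_deriv d \<theta>) = pairing (\<lambda>p. \<zeta> p * r p) ?c \<theta>"
    proof -
      have "(LINT q|lborel. ?K q * dir_deriv d \<theta> (p - q)) = (LINT q|lborel. ?c q * \<theta> (p - q))" for p
        using weak_local[OF cb c' smooth_reflect[OF s, of p]] by (simp add: dir_deriv_reflect[OF s])
      then show ?thesis
        unfolding pairing_fst[OF L0 LK i\<theta>(2), symmetric] pairing_fst[OF L0 Lc i\<theta>(1), symmetric] by simp
    qed
    finally show "(LINT q|lborel. ?K q * (LINT p|lborel. R p * dir_deriv d (dir_deriv d (\<lambda>p. \<zeta> p * \<theta> (p - q))) p))
      = - (pairing (\<lambda>p. dir_deriv d \<zeta> p * r p) ?K \<theta> + pairing (\<lambda>p. \<zeta> p * r p) ?c \<theta>)" .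
  qed
qed

lemma dual_op_integrable:
  assumes "bdd_borel A" "bdd_borel B" "bdd_borel R" "\<phi> \<in> Cinf_compact"
  shows "integrable lborel (dual_op t x d A B R \<phi>)"
  unfolding dual_op_def[abs_def]
  by (intro Bochner_Integration.integrable_add integrable_bdd_mult_Cinf Cinf_compact_dir_deriv assms)

text \<open>
  The balance law tested in its own variable \<open>p\<close> with \<open>\<zeta>(p) \<theta>(p - q)\<close> and weighted by \<open>c(q) \<zeta>(q)\<close>:
  production and diffusion are bounded by the mass of \<open>\<theta>\<close>, hence so is the transport part.
\<close>

lemma balance_first:
  assumes bal: "balanced V t x d A B R" and R: "D_regular V d R" and c: "D_regular V d c"
  shows "mass_bounded (\<lambda>\<theta>. pairing (\<lambda>p. A p * \<zeta> p) (\<lambda>q. c q * \<zeta> q) (dir_deriv t \<theta>)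
     + pairing (\<lambda>p. B p * \<zeta> p) (\<lambda>q. c q * \<zeta> q) (dir_deriv x \<theta>))"
proof -
  obtain A1 B1 R1 A2 B2 R2 where d1: "dissipative V t x d A1 B1 R1" and d2: "dissipative V t x d A2 B2 R2"
    and eq: "A = (\<lambda>p. A1 p - A2 p)" "B = (\<lambda>p. B1 p - B2 p)" "R = (\<lambda>p. R1 p - R2 p)"
    using bal by (auto simp: balanced_def)
  have b1: "bdd_borel A1" "bdd_borel B1" "bdd_borel R1" using d1 by (auto simp: dissipative_def)
  have b2: "bdd_borel A2" "bdd_borel B2" "bdd_borel R2" using d2 by (auto simp: dissipative_def)
  have b: "bdd_borel A" "bdd_borel B" "bdd_borel R" unfolding eq by (intro bdd_borel_diff b1 b2)+
  have cb: "bdd_borel c" using c by (simp add: D_regular_def)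
  let ?K = "\<lambda>q. c q * \<zeta> q"
  have Kb: "bdd_borel ?K" by (rule bdd_borel_mult[OF cb Cinf_compact_bdd_borel[OF \<zeta>C]])
  obtain M where M: "\<And>q. \<bar>?K q\<bar> \<le> M" using bdd_borel_bound[OF Kb] by blast
  have LK: "L2 ?K" by (rule loc_L2[OF cb])
  let ?A0 = "\<lambda>p. A p * dir_deriv t \<zeta> p + B p * dir_deriv x \<zeta> p"
  have L0: "L2 ?A0"
    by (intro L2_add L2_bdd_mult b Cinf_compact_L2 Cinf_compact_dir_deriv \<zeta>C)
  note LA = loc_L2[OF b(1)] and LB = loc_L2[OF b(2)]
  let ?m = "\<lambda>A B R \<theta> q. LINT p|lborel. dual_op t x d A B R (\<lambda>p. \<zeta> p * \<theta> (p - q)) p"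
  let ?E = "\<lambda>\<theta> q. LINT p|lborel. R p * dir_deriv d (dir_deriv d (\<lambda>p. \<zeta> p * \<theta> (p - q))) p"
  \<comment> \<open>The two production measures, tested at \<open>p\<close> and weighted in \<open>q\<close>.\<close>
  have m1: "mass_bounded (\<lambda>\<theta>. LINT q|lborel. ?K q * ?m A1 B1 R1 \<theta> q)"
    using dissipative_bound(2)[OF d1 Kb M] by (intro mass_boundedI) blast
  have m2: "mass_bounded (\<lambda>\<theta>. LINT q|lborel. ?K q * ?m A2 B2 R2 \<theta> q)"
    using dissipative_bound(2)[OF d2 Kb M] by (intro mass_boundedI) blast
  have "mass_bounded (\<lambda>\<theta>. (LINT q|lborel. ?K q * ?m A1 B1 R1 \<theta> q) - (LINT q|lborel. ?K q * ?m A2 B2 R2 \<theta> q)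
    - pairing ?A0 ?K \<theta> - (LINT q|lborel. ?K q * ?E \<theta> q))"
    by (intro mass_bounded_diff m1 m2 mass_bounded_pairing L0 LK diffusion_bounded R c)
  then show ?thesis
  proof (rule mass_bounded_cong)
    fix \<theta> :: "'a \<Rightarrow> real" assume \<theta>: "\<theta> \<in> Cinf_compact" "\<And>p. 0 \<le> \<theta> p"
    have s: "smooth \<theta>" by (rule Cinf_compact_smooth[OF \<theta>(1)])
    have D: "dir_deriv v \<theta> \<in> Cinf_compact" for v by (rule Cinf_compact_dir_deriv[OF \<theta>(1)])
    note i0 = Cinf_compact_integrable[OF \<theta>(1)] and i1 = Cinf_compact_integrable[OF D]
    have \<phi>: "(\<lambda>p. \<zeta> p * \<theta> (p - q)) \<in> Cinf_compact" for q
      by (rule test_Cinf[OF loc_test[OF translate_smooth[OF \<theta>(1)]]])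
    have tr: "dir_deriv v (\<lambda>p. \<theta> (p - q)) = (\<lambda>p. dir_deriv v \<theta> (p - q))" for q v
      by (rule ext) (rule dir_deriv_translate[OF s])
    have lin: "?m A B R \<theta> q = ?m A1 B1 R1 \<theta> q - ?m A2 B2 R2 \<theta> q" for q
      unfolding Bochner_Integration.integral_diff[OF dual_op_integrable[OF b1 \<phi>] dual_op_integrable[OF b2 \<phi>], symmetric]
      by (rule Bochner_Integration.integral_cong) (simp_all add: dual_op_def eq algebra_simps)
    have split: "?m A B R \<theta> q = (LINT p|lborel. ?A0 p * \<theta> (p - q)) + (LINT p|lborel. (A p * \<zeta> p) * dir_deriv t \<theta> (p - q))
       + (LINT p|lborel. (B p * \<zeta> p) * dir_deriv x \<theta> (p - q)) + ?E \<theta> q" for q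
    proof -
      have iE: "integrable lborel (\<lambda>p. R p * dir_deriv d (dir_deriv d (\<lambda>p. \<zeta> p * \<theta> (p - q))) p)"
        by (intro integrable_bdd_mult_Cinf b Cinf_compact_dir_deriv \<phi>)
      have "?m A B R \<theta> q = (LINT p|lborel. ?A0 p * \<theta> (p - q) + (A p * \<zeta> p) * dir_deriv t \<theta> (p - q)
         + (B p * \<zeta> p) * dir_deriv x \<theta> (p - q) + R p * dir_deriv d (dir_deriv d (\<lambda>p. \<zeta> p * \<theta> (p - q))) p)"
        by (rule Bochner_Integration.integral_cong)
          (simp_all add: dual_op_def dir_deriv_mult[OF \<zeta>s translate_smooth[OF \<theta>(1)]] tr algebra_simps)
      then show ?thesis
        by (simp only: Bochner_Integration.integral_add Bochner_Integration.integrable_add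
            inner_integrable[OF L0 \<theta>(1)] inner_integrable[OF LA D] inner_integrable[OF LB D] iE)
    qed
    note k1 = dissipative_bound(1)[OF d1 Kb M \<theta>] and k2 = dissipative_bound(1)[OF d2 Kb M \<theta>]
    have "?K q * ?E \<theta> q = ?K q * ?m A1 B1 R1 \<theta> q - ?K q * ?m A2 B2 R2 \<theta> q - ?K q * (LINT p|lborel. ?A0 p * \<theta> (p - q))
       - ?K q * (LINT p|lborel. (A p * \<zeta> p) * dir_deriv t \<theta> (p - q)) - ?K q * (LINT p|lborel. (B p * \<zeta> p) * dir_deriv x \<theta> (p - q))" for q
    proof -
      have "?E \<theta> q = ?m A1 B1 R1 \<theta> q - ?m A2 B2 R2 \<theta> q - (LINT p|lborel. ?A0 p * \<theta> (p - q))
       - (LINT p|lborel. (A p * \<zeta> p) * dir_deriv t \<theta> (p - q)) - (LINT p|lborel. (B p * \<zeta> p) * dir_deriv x \<theta> (p - q))"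
        using split[of q] lin[of q] by linarith
      then show ?thesis by (simp only: right_diff_distrib)
    qed
    then have "(LINT q|lborel. ?K q * ?E \<theta> q) = (LINT q|lborel. ?K q * ?m A1 B1 R1 \<theta> q - ?K q * ?m A2 B2 R2 \<theta> q
       - ?K q * (LINT p|lborel. ?A0 p * \<theta> (p - q))
       - ?K q * (LINT p|lborel. (A p * \<zeta> p) * dir_deriv t \<theta> (p - q)) - ?K q * (LINT p|lborel. (B p * \<zeta> p) * dir_deriv x \<theta> (p - q)))"
      by (simp only:)
    also have "\<dots> = (LINT q|lborel. ?K q * ?m A1 B1 R1 \<theta> q) - (LINT q|lborel. ?K q * ?m A2 B2 R2 \<theta> q) - pairing ?A0 ?K \<theta>
       - pairing (\<lambda>p. A p * \<zeta> p) ?K (dir_deriv t \<theta>) - pairing (\<lambda>p. B p * \<zeta> p) ?K (dir_deriv x \<theta>)"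
      by (simp only: Bochner_Integration.integral_diff Bochner_Integration.integrable_diff k1 k2
          pairing_snd_integrable[OF L0 LK i0] pairing_snd_integrable[OF LA LK i1] pairing_snd_integrable[OF LB LK i1]
          pairing_snd[OF L0 LK i0] pairing_snd[OF LA LK i1] pairing_snd[OF LB LK i1])
    finally show "pairing (\<lambda>p. A p * \<zeta> p) ?K (dir_deriv t \<theta>) + pairing (\<lambda>p. B p * \<zeta> p) ?K (dir_deriv x \<theta>)
      = (LINT q|lborel. ?K q * ?m A1 B1 R1 \<theta> q) - (LINT q|lborel. ?K q * ?m A2 B2 R2 \<theta> q) - pairing ?A0 ?K \<theta> - (LINT q|lborel. ?K q * ?E \<theta> q)"
      by linarith
  qed
qed

text \<open>
  The same estimate with the balance law in the second variable.  The weight \<open>\<zeta>(p) \<zeta>(q)\<close> is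
  symmetric, so this is \<open>balance_first\<close> for the reflected kernel \<open>z \<mapsto> \<theta>(-z)\<close>.
\<close>

lemma balance_second:
  assumes bal: "balanced V t x d A B R" and R: "D_regular V d R" and c: "D_regular V d c"
    and A: "bdd_borel A" and B: "bdd_borel B"
  shows "mass_bounded (\<lambda>\<theta>. pairing (\<lambda>p. c p * \<zeta> p) (\<lambda>q. A q * \<zeta> q) (dir_deriv t \<theta>)
     + pairing (\<lambda>p. c p * \<zeta> p) (\<lambda>q. B q * \<zeta> q) (dir_deriv x \<theta>))"
proof -
  have cb: "bdd_borel c" using c by (simp add: D_regular_def)
  note L = loc_L2[OF cb] loc_L2[OF A] loc_L2[OF B]
  show ?thesis
  proof (rule mass_bounded_cong[OF mass_bounded_uminus[OF mass_bounded_reflect[OF balance_first[OF bal R c]]]])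
    fix \<theta> :: "'a \<Rightarrow> real" assume \<theta>: "\<theta> \<in> Cinf_compact"
    have D: "integrable lborel (dir_deriv v \<theta>)" for v
      by (intro Cinf_compact_integrable Cinf_compact_dir_deriv \<theta>)
    have r: "dir_deriv v (\<lambda>z. \<theta> (- z)) = (\<lambda>z. - dir_deriv v \<theta> (- z))" for v
      using dir_deriv_reflect[OF Cinf_compact_smooth[OF \<theta>], of v 0] by (auto intro!: ext)
    show "pairing (\<lambda>p. c p * \<zeta> p) (\<lambda>q. A q * \<zeta> q) (dir_deriv t \<theta>) + pairing (\<lambda>p. c p * \<zeta> p) (\<lambda>q. B q * \<zeta> q) (dir_deriv x \<theta>)
      = - (pairing (\<lambda>p. A p * \<zeta> p) (\<lambda>q. c q * \<zeta> q) (dir_deriv t (\<lambda>z. \<theta> (- z)))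
        + pairing (\<lambda>p. B p * \<zeta> p) (\<lambda>q. c q * \<zeta> q) (dir_deriv x (\<lambda>z. \<theta> (- z))))"
      unfolding r pairing_uminus_kernel using pairing_swap[OF L(1,2) D] pairing_swap[OF L(1,3) D] by simp
  qed
qed

definition cross where
  "cross A1 B1 A2 B2 \<kappa> = pairing (\<lambda>p. A1 p * \<zeta> p) (\<lambda>q. B2 q * \<zeta> q) \<kappa> - pairing (\<lambda>p. B1 p * \<zeta> p) (\<lambda>q. A2 q * \<zeta> q) \<kappa>"

text \<open>
  The cancellation on which everything rests.  For the derivative in \<open>t\<close>, the law for \<open>(A1, B1)\<close> with
  weight \<open>B2\<close> and the law for \<open>(A2, B2)\<close> with weight \<open>B1\<close> both contain \<open>B1(p) B2(q) \<partial>\<^sub>x\<theta>(p - q)\<close>; for the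
  derivative in \<open>x\<close>, the weights \<open>A2\<close> and \<open>A1\<close> produce \<open>A1(p) A2(q) \<partial>\<^sub>t\<theta>(p - q)\<close> twice.  In both cases
  the difference is the antisymmetric form \<open>cross\<close>.  In the direction \<open>d\<close> a single weak derivative
  suffices.
\<close>

lemma cross_bounded:
  assumes 1: "balanced V t x d A1 B1 R1" "D_regular V d A1" "D_regular V d B1" "D_regular V d R1"
    and 2: "balanced V t x d A2 B2 R2" "D_regular V d A2" "D_regular V d B2" "D_regular V d R2"
  shows "mass_bounded (\<lambda>\<theta>. cross A1 B1 A2 B2 (dir_deriv t \<theta>))"
    and "mass_bounded (\<lambda>\<theta>. cross A1 B1 A2 B2 (dir_deriv x \<theta>))"
    and "mass_bounded (\<lambda>\<theta>. cross A1 B1 A2 B2 (dir_deriv d \<theta>))"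
proof -
  have b: "bdd_borel A1" "bdd_borel B1" "bdd_borel A2" "bdd_borel B2"
    using 1 2 by (auto simp: D_regular_def)
  show "mass_bounded (\<lambda>\<theta>. cross A1 B1 A2 B2 (dir_deriv t \<theta>))"
    by (rule mass_bounded_cong[OF mass_bounded_diff[OF balance_first[OF 1(1,4) 2(3)] balance_second[OF 2(1,4) 1(3) b(3,4)]]])
       (simp add: cross_def)
  show "mass_bounded (\<lambda>\<theta>. cross A1 B1 A2 B2 (dir_deriv x \<theta>))"
    by (rule mass_bounded_cong[OF mass_bounded_diff[OF balance_second[OF 2(1,4) 1(2) b(3,4)] balance_first[OF 1(1,4) 2(2)]]])
       (simp add: cross_def)
  have D: "mass_bounded (\<lambda>\<theta>. pairing (\<lambda>p. F p * \<zeta> p) (\<lambda>q. K q * \<zeta> q) (dir_deriv d \<theta>))"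
    if F: "D_regular V d F" and K: "bdd_borel K" for F K
  proof -
    obtain f where f: "L2 f" "weakD V d F f" and Fb: "bdd_borel F" using F by (auto simp: D_regular_def)
    let ?f = "\<lambda>p. \<zeta> p * f p + F p * dir_deriv d \<zeta> p"
    note Lf = weak_local_L2[OF Fb f(1)]
    show ?thesis
    proof (rule mass_bounded_cong[OF mass_bounded_uminus[OF mass_bounded_pairing[OF Lf loc_L2[OF K]]]])
      fix \<theta> :: "'a \<Rightarrow> real" assume \<theta>: "\<theta> \<in> Cinf_compact"
      note i0 = Cinf_compact_integrable[OF \<theta>] and i1 = Cinf_compact_integrable[OF Cinf_compact_dir_deriv[OF \<theta>]]
      have "(LINT p|lborel. F p * \<zeta> p * dir_deriv d \<theta> (p - q)) = - (LINT p|lborel. ?f p * \<theta> (p - q))" for q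
        using weak_local[OF Fb f translate_smooth[OF \<theta>, of q]]
        by (simp add: dir_deriv_translate[OF Cinf_compact_smooth[OF \<theta>]])
      then show "pairing (\<lambda>p. F p * \<zeta> p) (\<lambda>q. K q * \<zeta> q) (dir_deriv d \<theta>) = - pairing ?f (\<lambda>q. K q * \<zeta> q) \<theta>"
        unfolding pairing_snd[OF loc_L2[OF Fb] loc_L2[OF K] i1, symmetric] pairing_snd[OF Lf loc_L2[OF K] i0, symmetric]
        by simp
    qed
  qed
  show "mass_bounded (\<lambda>\<theta>. cross A1 B1 A2 B2 (dir_deriv d \<theta>))"
    unfolding cross_def by (intro mass_bounded_diff D 1 2 b)
qed

end

section \<open>Correlation functions\<close>

definition correlation :: "('a::euclidean_space \<Rightarrow> real) \<Rightarrow> ('a \<Rightarrow> real) \<Rightarrow> 'a \<Rightarrow> real" where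
  "correlation F K z = (LINT q|lborel. F (q + z) * K q)"

lemma shifted_product_integrable:
  assumes F: "bdd_borel F" and K: "bdd_borel K" "bounded {q. K q \<noteq> 0}"
  shows "integrable lborel (\<lambda>q. F (q + z) * K q)"
proof (rule integrable_bounded_support)
  have "bdd_borel (\<lambda>q. F (q + z))"
    using F bdd_borel_measurable[OF F] by (auto simp: bdd_borel_def)
  then show "bdd_borel (\<lambda>q. F (q + z) * K q)" by (rule bdd_borel_mult[OF _ K(1)])
  show "bounded {q. F (q + z) * K q \<noteq> 0}" by (rule bounded_subset[OF K(2)]) auto
qed

text \<open>
  Continuity of the correlation is what allows the weak bounds on its derivatives to be read
  pointwise in \<open>lipschitz_from_weak_derivative\<close>.
\<close>

lemma correlation_continuous:
  assumes F: "bdd_borel F" "bounded {q. F q \<noteq> 0}" and K: "bdd_borel K" "bounded {q. K q \<noteq> 0}"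
  shows "continuous_on UNIV (correlation F K)"
proof -
  obtain M where M: "M \<ge> 0" "\<And>q. \<bar>K q\<bar> \<le> M" using bdd_borel_bound[OF K(1)] by blast
  have [measurable]: "F \<in> borel_measurable borel" using F(1) by (rule bdd_borel_measurable)
  have iF: "integrable lborel F" by (rule integrable_bounded_support[OF F])
  have iFz: "integrable lborel (\<lambda>q. F (q + z))" for z using iF by (simp add: lborel_integrable_shift)
  have le: "\<bar>correlation F K z - correlation F K z0\<bar> \<le> M * (LINT q|lborel. \<bar>F (q + (z - z0)) - F q\<bar>)" for z z0
  proof -
    have "correlation F K z - correlation F K z0 = (LINT q|lborel. (F (q + z) - F (q + z0)) * K q)"
      unfolding correlation_def left_diff_distrib
      by (rule Bochner_Integration.integral_diff[OF shifted_product_integrable[OF F(1) K] shifted_product_integrable[OF F(1) K], symmetric])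
    also have "\<bar>\<dots>\<bar> \<le> (LINT q|lborel. norm ((F (q + z) - F (q + z0)) * K q))"
      using integral_norm_bound[of lborel "\<lambda>q. (F (q + z) - F (q + z0)) * K q"] by simp
    also have "\<dots> \<le> (LINT q|lborel. M * \<bar>F (q + z) - F (q + z0)\<bar>)"
    proof (rule integral_mono)
      show "integrable lborel (\<lambda>q. norm ((F (q + z) - F (q + z0)) * K q))"
        by (intro integrable_norm) (simp add: left_diff_distrib shifted_product_integrable[OF F(1) K])
      show "norm ((F (q + z) - F (q + z0)) * K q) \<le> M * \<bar>F (q + z) - F (q + z0)\<bar>" for q
        using M(2)[of q] by (simp add: abs_mult mult.commute mult_right_mono)
    qed (use iFz in simp)
    also have "\<dots> = M * (LINT q|lborel. \<bar>F (q + z) - F (q + z0)\<bar>)" by simp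
    also have "(LINT q|lborel. \<bar>F (q + z) - F (q + z0)\<bar>) = (LINT q|lborel. \<bar>F (q + (z - z0)) - F q\<bar>)"
      using lborel_integral_shift[of "\<lambda>q. \<bar>F (q + (z - z0)) - F q\<bar>" z0] by (simp add: algebra_simps)
    finally show ?thesis .
  qed
  have "isCont (correlation F K) z0" for z0
  proof -
    have "((\<lambda>h. M * (LINT q|lborel. \<bar>F (q + h) - F q\<bar>)) \<longlongrightarrow> M * 0) (at 0)"
      by (intro tendsto_mult_left translation_L1_continuous F)
    then have lim: "((\<lambda>h. M * (LINT q|lborel. \<bar>F (q + h) - F q\<bar>)) \<longlongrightarrow> 0) (at 0)" by simp
    have "((\<lambda>h. correlation F K (z0 + h) - correlation F K z0) \<longlongrightarrow> 0) (at 0)"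
    proof (rule Lim_null_comparison[OF always_eventually lim], intro allI)
      fix h
      show "norm (correlation F K (z0 + h) - correlation F K z0) \<le> M * (LINT q|lborel. \<bar>F (q + h) - F q\<bar>)"
        using le[of "z0 + h" z0] by simp
    qed
    then show ?thesis by (simp add: isCont_iff LIM_zero_iff)
  qed
  then show ?thesis by (simp add: continuous_on_eq_continuous_at)
qed

lemma correlation_bdd_borel:
  assumes F: "bdd_borel F" "bounded {q. F q \<noteq> 0}" and K: "bdd_borel K" "bounded {q. K q \<noteq> 0}"
  shows "bdd_borel (correlation F K)"
proof -
  obtain M where M: "M \<ge> 0" "\<And>q. \<bar>F q\<bar> \<le> M" using bdd_borel_bound[OF F(1)] by blast
  have iK: "integrable lborel K" by (rule integrable_bounded_support[OF K])
  show ?thesis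
  proof (rule bdd_borelI[of _ "M * (LINT q|lborel. \<bar>K q\<bar>)"])
    show "correlation F K \<in> borel_measurable borel"
      by (rule borel_measurable_continuous_onI[OF correlation_continuous[OF assms]])
    fix z
    have "\<bar>correlation F K z\<bar> \<le> (LINT q|lborel. norm (F (q + z) * K q))"
      unfolding correlation_def using integral_norm_bound[of lborel "\<lambda>q. F (q + z) * K q"] by simp
    also have "\<dots> \<le> (LINT q|lborel. M * \<bar>K q\<bar>)"
      using M iK by (intro integral_mono integrable_norm shifted_product_integrable[OF F(1) K])
        (auto simp: abs_mult mult_right_mono)
    finally show "\<bar>correlation F K z\<bar> \<le> M * (LINT q|lborel. \<bar>K q\<bar>)" by simp
  qed
qed

lemma pairing_eq_correlation:
  assumes F: "bdd_borel F" "bounded {q. F q \<noteq> 0}" and K: "bdd_borel K" "bounded {q. K q \<noteq> 0}"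
    and \<kappa>: "integrable lborel \<kappa>"
  shows "pairing F K \<kappa> = (LINT z|lborel. correlation F K z * \<kappa> z)"
proof -
  have [measurable]: "F \<in> borel_measurable borel" "K \<in> borel_measurable borel" "\<kappa> \<in> borel_measurable borel"
    using F K bdd_borel_measurable borel_measurable_integrable[OF \<kappa>] by auto
  obtain M where M: "M \<ge> 0" "\<And>q. \<bar>F q\<bar> \<le> M" using bdd_borel_bound[OF F(1)] by blast
  have iK: "integrable lborel K" by (rule integrable_bounded_support[OF K])
  note L = L2_bounded_support[OF F] L2_bounded_support[OF K]
  have i\<kappa>: "integrable lborel (\<lambda>z. F (q + z) * \<kappa> z)" for q
    by (rule Bochner_Integration.integrable_bound[of _ "\<lambda>z. M * \<kappa> z"])
       (use \<kappa> M in \<open>auto simp: abs_mult mult_right_mono\<close>)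
  have i: "integrable lebesgue_pairs (\<lambda>(q, z). K q * (F (q + z) * \<kappa> z))"
  proof (rule Bochner_Integration.integrable_bound)
    show "integrable lebesgue_pairs (\<lambda>(q, z). (M * \<bar>K q\<bar>) * \<bar>\<kappa> z\<bar>)"
    proof (rule lborel_pair.Fubini_integrable)
      show "integrable lborel (\<lambda>q. LINT z|lborel. norm (case (q, z) of (q, z) \<Rightarrow> (M * \<bar>K q\<bar>) * \<bar>\<kappa> z\<bar>))"
        using iK by (simp add: abs_mult)
      show "AE q in lborel. integrable lborel (\<lambda>z. case (q, z) of (q, z) \<Rightarrow> (M * \<bar>K q\<bar>) * \<bar>\<kappa> z\<bar>)"
        using \<kappa> by simp
    qed measurable
    show "AE w in lebesgue_pairs. norm (case w of (q, z) \<Rightarrow> K q * (F (q + z) * \<kappa> z)) \<le> norm (case w of (q, z) \<Rightarrow> (M * \<bar>K q\<bar>) * \<bar>\<kappa> z\<bar>)"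
    proof (rule AE_I2)
      fix w :: "'a \<times> 'a"
      obtain q z where w: "w = (q, z)" by (cases w)
      have "\<bar>F (q + z)\<bar> * (\<bar>K q\<bar> * \<bar>\<kappa> z\<bar>) \<le> M * (\<bar>K q\<bar> * \<bar>\<kappa> z\<bar>)" by (rule mult_right_mono[OF M(2)]) simp
      then show "norm (case w of (q, z) \<Rightarrow> K q * (F (q + z) * \<kappa> z)) \<le> norm (case w of (q, z) \<Rightarrow> (M * \<bar>K q\<bar>) * \<bar>\<kappa> z\<bar>)"
        using M(1) by (simp add: w abs_mult algebra_simps)
    qed
  qed measurable
  have "pairing F K \<kappa> = (LINT q|lborel. K q * (LINT p|lborel. F p * \<kappa> (p - q)))"
    by (rule pairing_snd[OF L \<kappa>, symmetric])
  also have "\<dots> = (LINT q|lborel. LINT z|lborel. K q * (F (q + z) * \<kappa> z))"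
  proof (rule Bochner_Integration.integral_cong[OF refl])
    fix q
    have "(LINT p|lborel. F p * \<kappa> (p - q)) = (LINT z|lborel. F (z + q) * \<kappa> (z + q - q))"
      by (rule lborel_integral_shift[symmetric]) measurable
    then show "K q * (LINT p|lborel. F p * \<kappa> (p - q)) = (LINT z|lborel. K q * (F (q + z) * \<kappa> z))"
      by (simp add: add.commute)
  qed
  also have "\<dots> = (LINT z|lborel. LINT q|lborel. K q * (F (q + z) * \<kappa> z))"
    by (rule lborel_pair.Fubini_integral[symmetric]) (use i in simp)
  also have "\<dots> = (LINT z|lborel. correlation F K z * \<kappa> z)"
  proof (rule Bochner_Integration.integral_cong[OF refl])
    fix z
    show "(LINT q|lborel. K q * (F (q + z) * \<kappa> z)) = correlation F K z * \<kappa> z"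
      unfolding correlation_def integral_mult_left_zero[symmetric] by (simp add: ac_simps)
  qed
  finally show ?thesis .
qed

text \<open>
  A product of two increments is a second difference of the correlation at \<open>0\<close>; the shifted diagonal
  terms agree by translation invariance.
\<close>

lemma correlation_difference:
  assumes F: "bdd_borel F" "bounded {q. F q \<noteq> 0}" and K: "bdd_borel K" "bounded {q. K q \<noteq> 0}"
  shows "integrable lborel (\<lambda>q. (F (q + z) - F q) * (K (q + z) - K q))"
    and "(LINT q|lborel. (F (q + z) - F q) * (K (q + z) - K q)) = 2 * correlation F K 0 - correlation F K z - correlation F K (- z)"
proof -
  have [measurable]: "F \<in> borel_measurable borel" "K \<in> borel_measurable borel"
    using F K bdd_borel_measurable by auto
  have i1: "integrable lborel (\<lambda>q. F (q + z) * K q)" and i2: "integrable lborel (\<lambda>q. F q * K q)"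
    using shifted_product_integrable[OF F(1) K, of z] shifted_product_integrable[OF F(1) K, of 0] by simp_all
  have i3: "integrable lborel (\<lambda>q. F (q + z) * K (q + z))"
    using i2 lborel_integrable_shift[of "\<lambda>q. F q * K q" z] by simp
  have i4: "integrable lborel (\<lambda>q. F q * K (q + z))"
    using shifted_product_integrable[OF K(1) F, of z] by (simp add: mult.commute)
  have eq: "(\<lambda>q. (F (q + z) - F q) * (K (q + z) - K q)) =
     (\<lambda>q. F (q + z) * K (q + z) + F q * K q - F (q + z) * K q - F q * K (q + z))"
    by (rule ext) (simp add: algebra_simps)
  show "integrable lborel (\<lambda>q. (F (q + z) - F q) * (K (q + z) - K q))"
    unfolding eq by (intro Bochner_Integration.integrable_diff Bochner_Integration.integrable_add i1 i2 i3 i4)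
  have c1: "(LINT q|lborel. F (q + z) * K (q + z)) = correlation F K 0"
    using lborel_integral_shift[of "\<lambda>q. F q * K q" z] by (simp add: correlation_def)
  have c2: "(LINT q|lborel. F q * K (q + z)) = correlation F K (- z)"
    using lborel_integral_shift[of "\<lambda>q. F (q + - z) * K q" z] by (simp add: correlation_def)
  have c3: "(LINT q|lborel. F q * K q) = correlation F K 0" "(LINT q|lborel. F (q + z) * K q) = correlation F K z"
    by (simp_all add: correlation_def)
  have "(LINT q|lborel. (F (q + z) - F q) * (K (q + z) - K q)) = correlation F K 0 + correlation F K 0 - correlation F K z - correlation F K (- z)"
    unfolding eq by (simp only: Bochner_Integration.integral_diff Bochner_Integration.integral_add
        Bochner_Integration.integrable_diff Bochner_Integration.integrable_add i1 i2 i3 i4 c1 c2 c3)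
  then show "(LINT q|lborel. (F (q + z) - F q) * (K (q + z) - K q)) = 2 * correlation F K 0 - correlation F K z - correlation F K (- z)"
    by linarith
qed

section \<open>The commutator estimate\<close>

context cutoff
begin

lemma loc_bdd: "bdd_borel A \<Longrightarrow> bdd_borel (\<lambda>p. A p * \<zeta> p)"
  by (rule bdd_borel_mult[OF _ Cinf_compact_bdd_borel[OF \<zeta>C]])

lemma loc_bounded_support: "bounded {p. A p * \<zeta> p \<noteq> 0}"
  by (rule bounded_subset[of "{p. \<zeta> p \<noteq> 0}"]) (use \<zeta>C in \<open>auto simp: Cinf_compact_iff\<close>)

text \<open>
  The antisymmetric correlation \<open>\<Psi>\<close> has bounded weak derivatives in three spanning directions, so it is
  Lipschitz, and so are its second differences at \<open>0\<close>.
\<close>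

lemma commutator_estimate:
  assumes 1: "balanced V t x d A1 B1 R1" "D_regular V d A1" "D_regular V d B1" "D_regular V d R1"
    and 2: "balanced V t x d A2 B2 R2" "D_regular V d A2" "D_regular V d B2" "D_regular V d R2"
    and span: "\<And>v. \<exists>\<alpha> \<beta> \<gamma>. v = \<alpha> *\<^sub>R t + \<beta> *\<^sub>R x + \<gamma> *\<^sub>R d \<and> \<bar>\<alpha>\<bar> \<le> norm v \<and> \<bar>\<beta>\<bar> \<le> norm v \<and> \<bar>\<gamma>\<bar> \<le> norm v"
  shows "\<exists>C. \<forall>z. (LINT q|lborel.
      (A1 (q + z) * \<zeta> (q + z) - A1 q * \<zeta> q) * (B2 (q + z) * \<zeta> (q + z) - B2 q * \<zeta> q)
    - (B1 (q + z) * \<zeta> (q + z) - B1 q * \<zeta> q) * (A2 (q + z) * \<zeta> (q + z) - A2 q * \<zeta> q)) \<le> C * norm z"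
proof -
  note cb = cross_bounded[OF 1 2]
  have b: "bdd_borel A1" "bdd_borel B1" "bdd_borel A2" "bdd_borel B2"
    using 1 2 by (auto simp: D_regular_def)
  obtain Ct Cx Cd where C:
    "\<And>\<theta>. \<theta> \<in> Cinf_compact \<Longrightarrow> (\<forall>p. 0 \<le> \<theta> p) \<Longrightarrow> \<bar>cross A1 B1 A2 B2 (dir_deriv t \<theta>)\<bar> \<le> Ct * (LINT p|lborel. \<theta> p)"
    "\<And>\<theta>. \<theta> \<in> Cinf_compact \<Longrightarrow> (\<forall>p. 0 \<le> \<theta> p) \<Longrightarrow> \<bar>cross A1 B1 A2 B2 (dir_deriv x \<theta>)\<bar> \<le> Cx * (LINT p|lborel. \<theta> p)"
    "\<And>\<theta>. \<theta> \<in> Cinf_compact \<Longrightarrow> (\<forall>p. 0 \<le> \<theta> p) \<Longrightarrow> \<bar>cross A1 B1 A2 B2 (dir_deriv d \<theta>)\<bar> \<le> Cd * (LINT p|lborel. \<theta> p)"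
    using cb(1)[unfolded mass_bounded_def] cb(2)[unfolded mass_bounded_def] cb(3)[unfolded mass_bounded_def] by blast
  define C where "C = \<bar>Ct\<bar> + \<bar>Cx\<bar> + \<bar>Cd\<bar>"
  let ?A1 = "\<lambda>p. A1 p * \<zeta> p" and ?B1 = "\<lambda>p. B1 p * \<zeta> p" and ?A2 = "\<lambda>p. A2 p * \<zeta> p" and ?B2 = "\<lambda>p. B2 p * \<zeta> p"
  note lb = loc_bdd[OF b(1)] loc_bounded_support[of A1] loc_bdd[OF b(4)] loc_bounded_support[of B2]
  note lb' = loc_bdd[OF b(2)] loc_bounded_support[of B1] loc_bdd[OF b(3)] loc_bounded_support[of A2]
  define \<Psi> where "\<Psi> z = correlation ?A1 ?B2 z - correlation ?B1 ?A2 z" for z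
  have \<Psi>b: "bdd_borel \<Psi>" unfolding \<Psi>_def[abs_def] by (intro bdd_borel_diff correlation_bdd_borel lb lb')
  have \<Psi>c: "continuous_on UNIV \<Psi>" unfolding \<Psi>_def[abs_def] by (intro continuous_on_diff correlation_continuous lb lb')
  have \<Psi>J: "(LINT y|lborel. \<Psi> y * \<kappa> y) = cross A1 B1 A2 B2 \<kappa>" if "\<kappa> \<in> Cinf_compact" for \<kappa>
  proof -
    note k = Cinf_compact_integrable[OF that]
    have "(LINT y|lborel. \<Psi> y * \<kappa> y) = (LINT y|lborel. correlation ?A1 ?B2 y * \<kappa> y - correlation ?B1 ?A2 y * \<kappa> y)"
      by (simp add: \<Psi>_def left_diff_distrib)
    also have "\<dots> = (LINT y|lborel. correlation ?A1 ?B2 y * \<kappa> y) - (LINT y|lborel. correlation ?B1 ?A2 y * \<kappa> y)"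
      by (intro Bochner_Integration.integral_diff integrable_bdd_mult_Cinf correlation_bdd_borel lb lb' that)
    finally show ?thesis
      unfolding cross_def pairing_eq_correlation[OF lb k] pairing_eq_correlation[OF lb' k] .
  qed
  have lip: "\<bar>\<Psi> v - \<Psi> 0\<bar> \<le> C * norm v" for v
  proof (rule lipschitz_from_weak_derivative[OF \<Psi>b \<Psi>c])
    fix \<theta> :: "'a \<Rightarrow> real" assume \<theta>: "\<theta> \<in> Cinf_compact" "\<And>x. 0 \<le> \<theta> x"
    obtain \<alpha> \<beta> \<gamma> where v: "v = \<alpha> *\<^sub>R t + \<beta> *\<^sub>R x + \<gamma> *\<^sub>R d" "\<bar>\<alpha>\<bar> \<le> norm v" "\<bar>\<beta>\<bar> \<le> norm v" "\<bar>\<gamma>\<bar> \<le> norm v"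
      using span[of v] by blast
    have s: "smooth \<theta>" by (rule Cinf_compact_smooth[OF \<theta>(1)])
    have D: "dir_deriv w \<theta> \<in> Cinf_compact" for w by (rule Cinf_compact_dir_deriv[OF \<theta>(1)])
    have i: "integrable lborel (\<lambda>y. \<Psi> y * dir_deriv w \<theta> y)" for w by (rule integrable_bdd_mult_Cinf[OF \<Psi>b D])
    have "(LINT y|lborel. \<Psi> y * dir_deriv v \<theta> y) =
      (LINT y|lborel. \<alpha> * (\<Psi> y * dir_deriv t \<theta> y) + \<beta> * (\<Psi> y * dir_deriv x \<theta> y) + \<gamma> * (\<Psi> y * dir_deriv d \<theta> y))"
      unfolding v(1) by (rule Bochner_Integration.integral_cong)
        (simp_all add: dir_deriv_add_vec[OF s] dir_deriv_scaleR_vec[OF s] algebra_simps)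
    also have "\<dots> = \<alpha> * cross A1 B1 A2 B2 (dir_deriv t \<theta>) + \<beta> * cross A1 B1 A2 B2 (dir_deriv x \<theta>) + \<gamma> * cross A1 B1 A2 B2 (dir_deriv d \<theta>)"
      using i by (simp add: \<Psi>J[OF D])
    finally have eq: "(LINT y|lborel. \<Psi> y * dir_deriv v \<theta> y) = \<dots>" .
    let ?I = "LINT p|lborel. \<theta> p"
    have I0: "?I \<ge> 0" using \<theta>(2) by simp
    have t3: "\<bar>a * c\<bar> \<le> norm v * (\<bar>K\<bar> * ?I)" if "\<bar>a\<bar> \<le> norm v" "\<bar>c\<bar> \<le> K * ?I" for a c K
    proof -
      have "\<bar>c\<bar> \<le> \<bar>K\<bar> * ?I" using that(2) I0 by (meson abs_ge_self mult_right_mono order_trans)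
      then show ?thesis unfolding abs_mult using that(1) by (intro mult_mono) auto
    qed
    have "\<bar>\<alpha> * cross A1 B1 A2 B2 (dir_deriv t \<theta>)\<bar> \<le> norm v * (\<bar>Ct\<bar> * ?I)"
      by (rule t3[OF v(2) C(1)]) (use \<theta> in auto)
    moreover have "\<bar>\<beta> * cross A1 B1 A2 B2 (dir_deriv x \<theta>)\<bar> \<le> norm v * (\<bar>Cx\<bar> * ?I)"
      by (rule t3[OF v(3) C(2)]) (use \<theta> in auto)
    moreover have "\<bar>\<gamma> * cross A1 B1 A2 B2 (dir_deriv d \<theta>)\<bar> \<le> norm v * (\<bar>Cd\<bar> * ?I)"
      by (rule t3[OF v(4) C(3)]) (use \<theta> in auto)
    ultimately have "\<bar>LINT y|lborel. \<Psi> y * dir_deriv v \<theta> y\<bar> \<le> norm v * (\<bar>Ct\<bar> * ?I) + norm v * (\<bar>Cx\<bar> * ?I) + norm v * (\<bar>Cd\<bar> * ?I)"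
      unfolding eq by linarith
    then show "\<bar>LINT y|lborel. \<Psi> y * dir_deriv v \<theta> y\<bar> \<le> C * norm v * ?I" by (simp add: C_def algebra_simps)
  qed
  have "(LINT q|lborel. (?A1 (q + z) - ?A1 q) * (?B2 (q + z) - ?B2 q) - (?B1 (q + z) - ?B1 q) * (?A2 (q + z) - ?A2 q))
     \<le> (2 * C) * norm z" for z
  proof -
    have "(LINT q|lborel. (?A1 (q + z) - ?A1 q) * (?B2 (q + z) - ?B2 q) - (?B1 (q + z) - ?B1 q) * (?A2 (q + z) - ?A2 q))
      = (\<Psi> 0 - \<Psi> z) + (\<Psi> 0 - \<Psi> (- z))"
      unfolding Bochner_Integration.integral_diff[OF correlation_difference(1)[OF lb] correlation_difference(1)[OF lb']]
        correlation_difference(2)[OF lb] correlation_difference(2)[OF lb'] by (simp add: \<Psi>_def)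
    then show ?thesis using lip[of z] lip[of "- z"] by simp
  qed
  then show ?thesis by blast
qed

end

section \<open>The Cauchy--Schwarz deficit of two power entropies\<close>

definition pow_prim :: "nat \<Rightarrow> real \<Rightarrow> real" where
  "pow_prim m a = a ^ (m + 1) / real (m + 1)"

lemma pow_prim_deriv: "(pow_prim m has_real_derivative a ^ m) (at a)"
  using DERIV_cdivide[OF DERIV_pow[of "m + 1" a UNIV], of "real (m + 1)"]
  by (simp add: pow_prim_def[abs_def])

text \<open>
  With \<open>k = 2n\<close> this is \<open>\<Delta>S\<^sub>1 \<Delta>Q\<^sub>2 - (\<Delta>S\<^sub>2)\<^sup>2\<close>, that is, the Cauchy--Schwarz deficit
  \<open>\<integral> a\<^sup>k da \<cdot> \<integral> a\<^bsup>k+2l\<^esup> da - (\<integral> a\<^bsup>k+l\<^esup> da)\<^sup>2\<close> on the interval from \<open>v\<close> to \<open>w\<close>.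
\<close>

definition gap :: "nat \<Rightarrow> nat \<Rightarrow> real \<Rightarrow> real \<Rightarrow> real" where
  "gap k l v w = (pow_prim k w - pow_prim k v) * (pow_prim (k + 2 * l) w - pow_prim (k + 2 * l) v)
     - (pow_prim (k + l) w - pow_prim (k + l) v)\<^sup>2"

text \<open>
  The integral of \<open>a\<^sup>k (a\<^sup>l - w\<^sup>l)\<^sup>2\<close> from \<open>v\<close> to \<open>x\<close>, expanded.  Up to the factor \<open>w\<^sup>k\<close>, its value at
  \<open>x = w\<close> is the derivative of the deficit in the endpoint \<open>w\<close>.
\<close>

definition gap' :: "nat \<Rightarrow> nat \<Rightarrow> real \<Rightarrow> real \<Rightarrow> real \<Rightarrow> real" where
  "gap' k l v w x = (pow_prim (k + 2 * l) x - pow_prim (k + 2 * l) v) + w ^ (2 * l) * (pow_prim k x - pow_prim k v)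
     - 2 * w ^ l * (pow_prim (k + l) x - pow_prim (k + l) v)"

lemma gap'_deriv: "(gap' k l v w has_real_derivative x ^ k * (x ^ l - w ^ l)\<^sup>2) (at x)"
proof -
  have "(gap' k l v w has_real_derivative (x ^ (k + 2 * l) - 0 + w ^ (2 * l) * (x ^ k - 0) - 2 * w ^ l * (x ^ (k + l) - 0))) (at x)"
    unfolding gap'_def[abs_def] by (intro DERIV_diff DERIV_add DERIV_cmult pow_prim_deriv DERIV_const)
  moreover have "x ^ (k + 2 * l) - 0 + w ^ (2 * l) * (x ^ k - 0) - 2 * w ^ l * (x ^ (k + l) - 0) = x ^ k * (x ^ l - w ^ l)\<^sup>2"
    by (simp add: power_add power_mult power2_eq_square algebra_simps)
  ultimately show ?thesis by simp
qed

lemma gap_deriv: "((\<lambda>w. gap k l v w) has_real_derivative w ^ k * gap' k l v w w) (at w)"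
proof -
  have "((\<lambda>w. gap k l v w) has_real_derivative
     ((w ^ k - 0) * (pow_prim (k + 2 * l) w - pow_prim (k + 2 * l) v) + (w ^ (k + 2 * l) - 0) * (pow_prim k w - pow_prim k v))
     - of_nat 2 * ((w ^ (k + l) - 0) * (pow_prim (k + l) w - pow_prim (k + l) v) ^ (2 - Suc 0))) (at w)"
    unfolding gap_def by (intro DERIV_diff DERIV_mult DERIV_power pow_prim_deriv DERIV_const)
  moreover have "((w ^ k - 0) * (pow_prim (k + 2 * l) w - pow_prim (k + 2 * l) v) + (w ^ (k + 2 * l) - 0) * (pow_prim k w - pow_prim k v))
     - of_nat 2 * ((w ^ (k + l) - 0) * (pow_prim (k + l) w - pow_prim (k + l) v) ^ (2 - Suc 0)) = w ^ k * gap' k l v w w"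
    unfolding gap'_def by (simp add: power_add power_mult power2_eq_square algebra_simps)
  ultimately show ?thesis by simp
qed

lemma gap'_mono:
  assumes "even k" "x \<le> y" shows "gap' k l v w x \<le> gap' k l v w y"
proof (rule DERIV_nonneg_imp_nondecreasing[OF assms(2)])
  fix a
  have "0 \<le> a ^ k * (a ^ l - w ^ l)\<^sup>2" using assms(1) by (simp add: zero_le_even_power)
  then show "\<exists>y. (gap' k l v w has_real_derivative y) (at a) \<and> 0 \<le> y" using gap'_deriv by blast
qed

lemma gap_mono:
  assumes "even k" "v \<le> y" "y \<le> w" shows "gap k l v y \<le> gap k l v w"
proof (rule DERIV_nonneg_imp_nondecreasing[OF assms(3)])
  fix x assume x: "y \<le> x" "x \<le> w"
  have "gap' k l v x v \<le> gap' k l v x x" by (rule gap'_mono) (use assms x in auto)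
  then have "0 \<le> gap' k l v x x" by (simp add: gap'_def)
  then have "0 \<le> x ^ k * gap' k l v x x" using assms(1) by (intro mult_nonneg_nonneg zero_le_even_power) auto
  then show "\<exists>d. ((\<lambda>w. gap k l v w) has_real_derivative d) (at x) \<and> 0 \<le> d" using gap_deriv by blast
qed

lemma power_superadditive:
  fixes a b :: real assumes "0 \<le> a" "0 \<le> b" "1 \<le> l" shows "a ^ l + b ^ l \<le> (a + b) ^ l"
  using assms(3)
proof (induction l rule: dec_induct)
  case (step n)
  have "a ^ Suc n + b ^ Suc n \<le> (a + b) * (a ^ n + b ^ n)"
    using assms by (simp add: algebra_simps)
  also have "\<dots> \<le> (a + b) * (a + b) ^ n" using step assms by (intro mult_left_mono) auto
  finally show ?case by simp
qed simp

text \<open>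
  On the middle third of the interval both \<open>x\<close> and \<open>w - x\<close> are at least a third of the length, so the
  integrand \<open>x\<^sup>k (x\<^sup>l - w\<^sup>l)\<^sup>2\<close> is bounded below by the corresponding power.
\<close>

lemma gap'_lower:
  assumes "even k" "1 \<le> l" "0 \<le> v" "v < w"
  shows "((w - v) / 3) ^ (k + 2 * l + 1) \<le> gap' k l v w w"
proof -
  define L where "L = w - v"
  have L: "L > 0" using assms by (simp add: L_def)
  have "v + L / 3 < v + 2 * L / 3" using L by simp
  from MVT2[OF this, of "gap' k l v w" "\<lambda>x. x ^ k * (x ^ l - w ^ l)\<^sup>2"] gap'_deriv
  obtain x where x: "v + L / 3 < x" "x < v + 2 * L / 3"
    "gap' k l v w (v + 2 * L / 3) - gap' k l v w (v + L / 3) = (v + 2 * L / 3 - (v + L / 3)) * (x ^ k * (x ^ l - w ^ l)\<^sup>2)" by blast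
  have "w = v + L" by (simp add: L_def)
  then have xw: "L / 3 \<le> w - x" "x \<le> w" using x(2) L by linarith+
  have "(L / 3) ^ k \<le> x ^ k" by (rule power_mono) (use x assms L in auto)
  moreover have "((L / 3) ^ l)\<^sup>2 \<le> (x ^ l - w ^ l)\<^sup>2"
  proof -
    have "(L / 3) ^ l \<le> (w - x) ^ l"  by (rule power_mono[OF xw(1)]) (use L in simp)
    also have "\<dots> \<le> w ^ l - x ^ l"
      using power_superadditive[of x "w - x" l] x(1) xw(2) assms(2,3) L by simp
    finally have "(L / 3) ^ l \<le> w ^ l - x ^ l" .
    then have "((L / 3) ^ l)\<^sup>2 \<le> (w ^ l - x ^ l)\<^sup>2" by (rule power_mono) (use L in simp)
    then show ?thesis by (simp add: power2_commute)
  qed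
  ultimately have "(L / 3) ^ k * ((L / 3) ^ l)\<^sup>2 \<le> x ^ k * (x ^ l - w ^ l)\<^sup>2"
    using L assms(1) by (intro mult_mono zero_le_even_power) auto
  then have "(L / 3) * ((L / 3) ^ k * ((L / 3) ^ l)\<^sup>2) \<le> (L / 3) * (x ^ k * (x ^ l - w ^ l)\<^sup>2)"
    using L by (intro mult_left_mono) auto
  also have "\<dots> = gap' k l v w (v + 2 * L / 3) - gap' k l v w (v + L / 3)" unfolding x(3) by simp
  also have "\<dots> \<le> gap' k l v w w - gap' k l v w v"
    using L by (intro diff_mono gap'_mono assms(1)) (auto simp: L_def field_simps)
  also have "gap' k l v w v = 0" by (simp add: gap'_def)
  finally have "(L / 3) * ((L / 3) ^ k * ((L / 3) ^ l)\<^sup>2) \<le> gap' k l v w w" by simp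
  moreover have "(L / 3) * ((L / 3) ^ k * ((L / 3) ^ l)\<^sup>2) = (L / 3) ^ (k + 2 * l + 1)"
    unfolding power_add power_even_eq power_one_right by (simp only: ac_simps)
  ultimately have "(L / 3) ^ (k + 2 * l + 1) \<le> gap' k l v w w" by metis
  then show ?thesis by (simp only: L_def)
qed

text \<open>
  On the right half of the interval, the derivative of the deficit in its right endpoint is bounded
  below by \<open>gap'_lower\<close>.
\<close>

lemma gap_lower_nonneg:
  assumes "even k" "1 \<le> l" "0 \<le> v" "v \<le> w"
  shows "((w - v) / 6) ^ (2 * k + 2 * l + 2) \<le> gap k l v w"
proof (cases "v = w")
  case True then show ?thesis by (simp add: gap_def)
next
  case False
  define L where "L = w - v"
  have L: "L > 0" using assms False by (simp add: L_def)
  have "v + L / 2 < w" using L by (simp add: L_def field_simps)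
  from MVT2[OF this, of "\<lambda>w. gap k l v w" "\<lambda>w. w ^ k * gap' k l v w w"] gap_deriv
  obtain y where y: "v + L / 2 < y" "y < w" "gap k l v w - gap k l v (v + L / 2) = (w - (v + L / 2)) * (y ^ k * gap' k l v y y)" by blast
  have "(L / 6) ^ k \<le> y ^ k" by (rule power_mono) (use y assms L in auto)
  moreover have "(L / 6) ^ (k + 2 * l + 1) \<le> gap' k l v y y"
  proof -
    have "(L / 6) ^ (k + 2 * l + 1) \<le> ((y - v) / 3) ^ (k + 2 * l + 1)" by (rule power_mono) (use y L in auto)
    also have "\<dots> \<le> gap' k l v y y" by (rule gap'_lower) (use assms y L in auto)
    finally show ?thesis .
  qed
  ultimately have yk: "(L / 6) ^ k * (L / 6) ^ (k + 2 * l + 1) \<le> y ^ k * gap' k l v y y"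
    by (rule mult_mono) (use L assms(1) in \<open>simp_all add: zero_le_even_power\<close>)
  have "(L / 6) * ((L / 6) ^ k * (L / 6) ^ (k + 2 * l + 1)) \<le> (w - (v + L / 2)) * (y ^ k * gap' k l v y y)"
  proof (rule mult_mono)
    have "w = v + L" by (simp add: L_def)
    then show "L / 6 \<le> w - (v + L / 2)" "0 \<le> w - (v + L / 2)" using L by linarith+
  qed (use L yk in simp_all)
  also have "\<dots> \<le> gap k l v w"
  proof -
    have "gap k l v v \<le> gap k l v (v + L / 2)" by (rule gap_mono) (use assms L in auto)
    then show ?thesis unfolding y(3)[symmetric] by (simp add: gap_def)
  qed
  finally have "(L / 6) * ((L / 6) ^ k * (L / 6) ^ (k + 2 * l + 1)) \<le> gap k l v w" .
  moreover have "(L / 6) * ((L / 6) ^ k * (L / 6) ^ (k + 2 * l + 1)) = (L / 6) ^ (Suc (k + (k + 2 * l + 1)))"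
    by (simp only: power_Suc power_add)
  moreover have "Suc (k + (k + 2 * l + 1)) = 2 * k + 2 * l + 2" by simp
  ultimately have "(L / 6) ^ (2 * k + 2 * l + 2) \<le> gap k l v w" by metis
  then show ?thesis by (simp only: L_def)
qed

lemma gap_commute: "gap k l v w = gap k l w v"
  by (simp add: gap_def power2_eq_square algebra_simps)

lemma gap_minus:
  assumes "even k" shows "gap k l (- v) (- w) = gap k l v w"
proof -
  have 1: "pow_prim k (- a) = - pow_prim k a" "pow_prim (k + 2 * l) (- a) = - pow_prim (k + 2 * l) a" for a
    using assms by (auto simp: pow_prim_def)
  show ?thesis
  proof (cases "even l")
    case True
    then have "pow_prim (k + l) (- a) = - pow_prim (k + l) a" for a using assms by (auto simp: pow_prim_def)
    then show ?thesis unfolding gap_def 1 by (simp add: power2_eq_square algebra_simps)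
  next
    case False
    then have "pow_prim (k + l) (- a) = pow_prim (k + l) a" for a using assms by (auto simp: pow_prim_def)
    then show ?thesis unfolding gap_def 1 by (simp add: algebra_simps)
  qed
qed

text \<open>
  The deficit does not decrease when the interval grows.  Therefore an interval around \<open>0\<close> may be
  replaced by the longer of its two parts, which carries at least half of the length; the reflection
  symmetry then puts it on the positive half line.
\<close>

lemma gap_lower:
  assumes "even k" "1 \<le> l"
  shows "(\<bar>w - v\<bar> / 12) ^ (2 * k + 2 * l + 2) \<le> gap k l v w"
proof -
  let ?N = "2 * k + 2 * l + 2"
  have ord: "(\<bar>w - v\<bar> / 12) ^ ?N \<le> gap k l v w" if "v \<le> w" for v w
  proof -
    have pm: "(\<bar>w - v\<bar> / 12) ^ ?N \<le> (c / 6) ^ ?N" if "\<bar>w - v\<bar> \<le> 2 * c" for c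
      by (rule power_mono) (use that in auto)
    consider "0 \<le> v" | "w \<le> 0" | "v < 0" "0 < w" by linarith
    then show ?thesis
    proof cases
      case 1
      have "(\<bar>w - v\<bar> / 12) ^ ?N \<le> ((w - v) / 6) ^ ?N" by (rule pm) (use that in auto)
      then show ?thesis using gap_lower_nonneg[OF assms 1 that] by linarith
    next
      case 2
      have "(\<bar>w - v\<bar> / 12) ^ ?N \<le> ((- v - - w) / 6) ^ ?N" by (rule pm) (use that in auto)
      then show ?thesis using gap_lower_nonneg[OF assms, of "- w" "- v"] 2 that gap_minus[OF assms(1), of l w v] gap_commute[of k l w v] by simp
    next
      case 3
      show ?thesis
      proof (cases "w \<le> - v")
        case True
        have "(\<bar>w - v\<bar> / 12) ^ ?N \<le> ((- v - 0) / 6) ^ ?N" by (rule pm) (use True 3 in auto)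
        also have "\<dots> \<le> gap k l 0 (- v)" by (rule gap_lower_nonneg[OF assms]) (use 3 in auto)
        also have "\<dots> = gap k l v 0" using gap_minus[OF assms(1), of l 0 v] gap_commute[of k l 0 v] by simp
        also have "\<dots> \<le> gap k l v w" by (rule gap_mono[OF assms(1)]) (use 3 in auto)
        finally show ?thesis .
      next
        case False
        have "(\<bar>w - v\<bar> / 12) ^ ?N \<le> ((w - 0) / 6) ^ ?N" by (rule pm) (use False 3 in auto)
        also have "\<dots> \<le> gap k l 0 w" by (rule gap_lower_nonneg[OF assms]) (use 3 in auto)
        also have "\<dots> = gap k l (- w) 0" using gap_minus[OF assms(1), of l 0 w] gap_commute[of k l 0 "- w"] by simp
        also have "\<dots> \<le> gap k l (- w) (- v)" by (rule gap_mono[OF assms(1)]) (use 3 in auto)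
        also have "\<dots> = gap k l v w" using gap_minus[OF assms(1), of l w v] gap_commute[of k l w v] by simp
        finally show ?thesis .
      qed
    qed
  qed
  show ?thesis
  proof (cases "v \<le> w")
    case True then show ?thesis by (rule ord)
  next
    case False
    then show ?thesis using ord[of w v] gap_commute[of k l v w] by (simp add: abs_minus_commute)
  qed
qed

section \<open>Integrability of powers of the distance\<close>

lemma term_le_suminf_ennreal: "f j \<le> (\<Sum>i. f i)" for f :: "nat \<Rightarrow> ennreal"
  using sum_le_suminf[of f "{j}"] by simp

text \<open>
  Dyadic decomposition: where \<open>2\<^bsup>-j-1\<^esup> < \<bar>w\<bar> \<le> 2\<^bsup>-j\<^esup>\<close> the integrand is at most \<open>K 2\<^bsup>-j(\<beta>-d)\<^esup>\<close>, and the
  ball of radius \<open>2\<^bsup>-j\<^esup>\<close> has measure proportional to \<open>2\<^bsup>-jd\<^esup>\<close>.  Bounding the integrand by the sum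
  over all balls, rather than over disjoint shells, still gives a geometric series.
\<close>

lemma nn_integral_near_origin_finite:
  fixes \<beta> :: real
  assumes "\<beta> > 0"
  shows "(\<integral>\<^sup>+w. ennreal (indicator (cball (0::'a::euclidean_space) 1) w * norm w powr (\<beta> - real DIM('a))) \<partial>lborel) < \<infinity>"
proof -
  let ?d = "real DIM('a)"
  define K where "K = 2 powr \<bar>\<beta> - ?d\<bar>"
  define c where "c j = K * (2 powr (- real j * (\<beta> - ?d)))" for j :: nat
  have c0: "c j \<ge> 0" for j by (simp add: c_def K_def)
  have le: "ennreal (indicator (cball 0 1) w * norm w powr (\<beta> - ?d)) \<le> (\<Sum>j. ennreal (c j) * indicator (cball 0 ((1/2) ^ j)) w)" for w :: 'a
  proof (cases "w \<in> cball 0 1 \<and> w \<noteq> 0")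
    case False
    then show ?thesis by (auto simp: indicator_def)
  next
    case True
    then have w: "0 < norm w" "norm w \<le> 1" by auto
    have ex: "\<exists>n. (1/2 :: real) ^ n < norm w" using real_arch_pow_inv[OF w(1), of "1/2"] by simp
    define n where "n = (LEAST n. (1/2 :: real) ^ n < norm w)"
    have n: "(1/2) ^ n < norm w" unfolding n_def using ex by (rule LeastI_ex)
    have "n \<noteq> 0" using n w by (cases n) auto
    then obtain j where j: "n = Suc j" using not0_implies_Suc by blast
    have jw: "norm w \<le> (1/2) ^ j"
      using not_less_Least[of j "\<lambda>n. (1/2 :: real) ^ n < norm w"] j by (simp add: n_def not_less)
    have pj: "(1/2 :: real) ^ j = 2 powr (- real j)" by (simp add: powr_minus powr_realpow power_one_over inverse_eq_divide)
    define \<rho> where "\<rho> = norm w / (1/2) ^ j"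
    have \<rho>: "1/2 \<le> \<rho>" "\<rho> \<le> 1" using n jw j by (simp_all add: \<rho>_def field_simps)
    have wr: "norm w = \<rho> * 2 powr (- real j)" by (simp add: \<rho>_def pj[symmetric])
    have "\<rho> powr (\<beta> - ?d) \<le> K"
    proof (cases "\<beta> - ?d \<ge> 0")
      case True
      have "\<rho> powr (\<beta> - ?d) \<le> 1" using \<rho> True by (intro powr_le1) auto
      also have "1 \<le> K" unfolding K_def by (rule ge_one_powr_ge_zero) auto
      finally show ?thesis .
    next
      case False
      have "\<rho> powr (\<beta> - ?d) \<le> (1/2) powr (\<beta> - ?d)" using \<rho> False by (intro powr_mono2') auto
      also have "\<dots> = K" using False by (simp add: K_def powr_divide powr_minus_divide[symmetric])
      finally show ?thesis .
    qed
    then have "norm w powr (\<beta> - ?d) \<le> c j"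
      unfolding wr c_def using \<rho> by (simp add: powr_mult powr_powr mult_right_mono)
    then have "ennreal (indicator (cball 0 1) w * norm w powr (\<beta> - ?d)) \<le> ennreal (c j) * indicator (cball 0 ((1/2) ^ j)) w"
      using w jw by (simp add: indicator_def ennreal_leI)
    also have "\<dots> \<le> (\<Sum>j. ennreal (c j) * indicator (cball 0 ((1/2) ^ j)) w)"
      by (rule term_le_suminf_ennreal)
    finally show ?thesis .
  qed
  have cb[measurable]: "cball (0::'a) ((1/2) ^ j) \<in> sets borel" for j :: nat by simp
  have "(\<integral>\<^sup>+w. ennreal (indicator (cball (0::'a) 1) w * norm w powr (\<beta> - ?d)) \<partial>lborel)
    \<le> (\<integral>\<^sup>+w. (\<Sum>j. ennreal (c j) * indicator (cball (0::'a) ((1/2) ^ j)) w) \<partial>lborel)"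
    by (rule nn_integral_mono) (rule le)
  also have "\<dots> = (\<Sum>j. \<integral>\<^sup>+w. ennreal (c j) * indicator (cball (0::'a) ((1/2) ^ j)) w \<partial>lborel)"
    by (rule nn_integral_suminf) measurable
  also have "\<dots> = (\<Sum>j. ennreal (K * unit_ball_vol ?d * (2 powr (- \<beta>)) ^ j))"
  proof (rule suminf_cong)
    fix j
    have "(\<integral>\<^sup>+w. ennreal (c j) * indicator (cball (0::'a) ((1/2) ^ j)) w \<partial>lborel) = ennreal (c j) * emeasure lborel (cball (0::'a) ((1/2) ^ j))"
      by (rule nn_integral_cmult_indicator) simp
    also have "\<dots> = ennreal (c j * (unit_ball_vol ?d * ((1/2) ^ j) ^ DIM('a)))"
      by (subst emeasure_cball) (simp_all add: ennreal_mult c0)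
    also have "c j * (unit_ball_vol ?d * ((1/2) ^ j) ^ DIM('a)) = K * unit_ball_vol ?d * (2 powr (- \<beta>)) ^ j"
    proof -
      have "((1/2 :: real) ^ j) ^ DIM('a) = 2 powr (- real j * ?d)"
        by (simp add: power_mult[symmetric] powr_minus powr_realpow power_one_over inverse_eq_divide flip: of_nat_mult)
      moreover have "(2 powr (- \<beta>)) ^ j = 2 powr (- real j * \<beta>)"
        by (simp add: powr_realpow[symmetric] powr_powr mult.commute)
      moreover have "2 powr (- real j * (\<beta> - ?d)) * 2 powr (- real j * ?d) = 2 powr (- real j * \<beta>)"
        by (simp add: powr_add[symmetric] algebra_simps)
      ultimately show ?thesis by (simp add: c_def algebra_simps)
    qed
    finally show "(\<integral>\<^sup>+w. ennreal (c j) * indicator (cball (0::'a) ((1/2) ^ j)) w \<partial>lborel) = ennreal (K * unit_ball_vol ?d * (2 powr (- \<beta>)) ^ j)" .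
  qed
  also have "\<dots> < \<infinity>"
  proof -
    have "2 powr (- \<beta>) < (1 :: real)" using assms by (simp add: powr_minus_divide)
    then have "summable (\<lambda>j. K * unit_ball_vol ?d * (2 powr (- \<beta>)) ^ j)"
      by (intro summable_mult summable_geometric) simp
    then show ?thesis
      by (subst suminf_ennreal2) (auto simp: K_def)
  qed
  finally show ?thesis .
qed

text \<open>
  The same decomposition outside the unit ball, into the regions \<open>2\<^sup>j < \<bar>w\<bar> \<le> 2\<^bsup>j+1\<^esup>\<close>.
\<close>

lemma nn_integral_far_finite:
  fixes \<gamma> :: real
  assumes "\<gamma> > 0"
  shows "(\<integral>\<^sup>+w. ennreal (indicator (- cball (0::'a::euclidean_space) 1) w * norm w powr (- (real DIM('a) + \<gamma>))) \<partial>lborel) < \<infinity>"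
proof -
  let ?d = "real DIM('a)"
  define c where "c j = 2 powr (- real j * (?d + \<gamma>))" for j :: nat
  have c0: "c j \<ge> 0" for j by (simp add: c_def)
  have le: "ennreal (indicator (- cball 0 1) w * norm w powr (- (?d + \<gamma>))) \<le> (\<Sum>j. ennreal (c j) * indicator (cball 0 (2 ^ Suc j)) w)" for w :: 'a
  proof (cases "w \<in> cball 0 1")
    case True
    then show ?thesis by (auto simp: indicator_def)
  next
    case False
    then have w: "1 < norm w" by auto
    have ex: "\<exists>n. norm w \<le> (2 :: real) ^ n" using real_arch_pow[of 2 "norm w"] less_imp_le by auto
    define n where "n = (LEAST n. norm w \<le> (2 :: real) ^ n)"
    have n: "norm w \<le> 2 ^ n" unfolding n_def using ex by (rule LeastI_ex)
    have "n \<noteq> 0" using n w by (cases n) auto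
    then obtain j where j: "n = Suc j" using not0_implies_Suc by blast
    have jw: "2 ^ j < norm w"
      using not_less_Least[of j "\<lambda>n. norm w \<le> (2 :: real) ^ n"] j by (simp add: n_def not_le)
    have "norm w powr (- (?d + \<gamma>)) \<le> (2 ^ j) powr (- (?d + \<gamma>))"
      using jw assms by (intro powr_mono2') auto
    also have "\<dots> = c j"
      by (simp add: c_def powr_realpow[symmetric] powr_powr algebra_simps)
    finally have "ennreal (indicator (- cball 0 1) w * norm w powr (- (?d + \<gamma>))) \<le> ennreal (c j) * indicator (cball 0 (2 ^ Suc j)) w"
      using w n j by (simp add: indicator_def ennreal_leI)
    also have "\<dots> \<le> (\<Sum>j. ennreal (c j) * indicator (cball 0 (2 ^ Suc j)) w)"
      by (rule term_le_suminf_ennreal)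
    finally show ?thesis .
  qed
  have cb[measurable]: "cball (0::'a) (2 ^ Suc j) \<in> sets borel" for j :: nat by simp
  have "(\<integral>\<^sup>+w. ennreal (indicator (- cball (0::'a) 1) w * norm w powr (- (?d + \<gamma>))) \<partial>lborel)
    \<le> (\<integral>\<^sup>+w. (\<Sum>j. ennreal (c j) * indicator (cball (0::'a) (2 ^ Suc j)) w) \<partial>lborel)"
    by (rule nn_integral_mono) (rule le)
  also have "\<dots> = (\<Sum>j. \<integral>\<^sup>+w. ennreal (c j) * indicator (cball (0::'a) (2 ^ Suc j)) w \<partial>lborel)"
    by (rule nn_integral_suminf) measurable
  also have "\<dots> = (\<Sum>j. ennreal (2 powr ?d * unit_ball_vol ?d * (2 powr (- \<gamma>)) ^ j))"
  proof (rule suminf_cong)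
    fix j
    have "(\<integral>\<^sup>+w. ennreal (c j) * indicator (cball (0::'a) (2 ^ Suc j)) w \<partial>lborel) = ennreal (c j) * emeasure lborel (cball (0::'a) (2 ^ Suc j))"
      by (rule nn_integral_cmult_indicator) simp
    also have "\<dots> = ennreal (c j * (unit_ball_vol ?d * (2 ^ Suc j) ^ DIM('a)))"
      by (subst emeasure_cball) (simp_all add: ennreal_mult c0 del: power_Suc)
    also have "c j * (unit_ball_vol ?d * (2 ^ Suc j) ^ DIM('a)) = 2 powr ?d * unit_ball_vol ?d * (2 powr (- \<gamma>)) ^ j"
    proof -
      have "((2 :: real) ^ Suc j) ^ DIM('a) = 2 powr ((1 + real j) * ?d)"
      proof -
        have "(1 + real j) * ?d = real (Suc j * DIM('a))" by (simp add: distrib_right)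
        then show ?thesis by (simp only: powr_realpow zero_less_numeral power_mult)
      qed
      moreover have "(2 powr (- \<gamma>)) ^ j = 2 powr (- real j * \<gamma>)"
        by (simp add: powr_realpow[symmetric] powr_powr mult.commute)
      moreover have "2 powr (- real j * (?d + \<gamma>)) * 2 powr ((1 + real j) * ?d) = 2 powr ?d * 2 powr (- real j * \<gamma>)"
        by (simp add: powr_add[symmetric] algebra_simps)
      ultimately show ?thesis by (simp add: c_def algebra_simps)
    qed
    finally show "(\<integral>\<^sup>+w. ennreal (c j) * indicator (cball (0::'a) (2 ^ Suc j)) w \<partial>lborel) = ennreal (2 powr ?d * unit_ball_vol ?d * (2 powr (- \<gamma>)) ^ j)" .
  qed
  also have "\<dots> < \<infinity>"
  proof -
    have "2 powr (- \<gamma>) < (1 :: real)" using assms by (simp add: powr_minus_divide)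
    then have "summable (\<lambda>j. 2 powr ?d * unit_ball_vol ?d * (2 powr (- \<gamma>)) ^ j)"
      by (intro summable_mult summable_geometric) simp
    then show ?thesis
      by (subst suminf_ennreal2) auto
  qed
  finally show ?thesis .
qed

section \<open>From a translation estimate to the Slobodetskii space\<close>

text \<open>
  Distinguish whether \<open>a\<close> exceeds \<open>\<tau>\<^bsup>1/N\<^esup>\<close>.  This pointwise inequality replaces Hoelder's inequality in
  the passage from the exponent \<open>N\<close> to the exponent \<open>q\<close>.
\<close>

lemma powr_le_Young:
  fixes a \<tau> q :: real
  assumes "0 \<le> a" "0 < \<tau>" "1 \<le> N" "0 \<le> q" "q \<le> real N"
  shows "a powr q \<le> \<tau> powr (q / N) + \<tau> powr (q / N - 1) * a ^ N"
proof (cases "a \<le> \<tau> powr (1 / N)")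
  case True
  have "a powr q \<le> (\<tau> powr (1 / N)) powr q" using assms True by (intro powr_mono2) auto
  also have "\<dots> = \<tau> powr (q / N)" by (simp add: powr_powr)
  finally show ?thesis using assms by (simp add: add_increasing2)
next
  case False
  then have "\<tau> powr (1 / N) < a" by simp
  then have a: "a > 0" "\<tau> powr (1 / N) \<le> a" using powr_ge_zero[of \<tau> "1 / N"] by linarith+
  have "a powr q = a powr (q - N) * a ^ N" using a by (simp add: powr_realpow[symmetric] powr_add[symmetric])
  also have "a powr (q - N) \<le> (\<tau> powr (1 / N)) powr (q - N)" using assms a by (intro powr_mono2') auto
  also have "(\<tau> powr (1 / N)) powr (q - N) = \<tau> powr (q / N - 1)" using assms by (simp add: powr_powr diff_divide_distrib)
  finally have "a powr q \<le> \<tau> powr (q / N - 1) * a ^ N" using a by simp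
  then show ?thesis by (simp add: add_increasing)
qed

text \<open>
  After the substitution \<open>z = y + w\<close> the seminorm is \<open>\<integral> I(w) \<bar>w\<bar>\<^bsup>-(d+sq)\<^esup> dw\<close>, where \<open>I(w)\<close> is the
  \<open>q\<close>-th power of the \<open>L\<^sup>q\<close> norm of the increment of \<open>v\<close> by \<open>w\<close>.  By \<open>powr_le_Young\<close> with \<open>\<tau> = \<bar>w\<bar>\<close>,
  \<open>I(w)\<close> is of the order \<open>\<bar>w\<bar>\<^bsup>q/N\<^esup>\<close> near the origin, and \<open>I\<close> is bounded; both parts of the integral are
  finite since \<open>0 < s < 1/N\<close>.
\<close>

lemma in_Wsq_if_Nikolskii:
  fixes v :: "'a::euclidean_space \<Rightarrow> real"
  assumes v: "bdd_borel v" and bs: "bounded {x. v x \<noteq> 0}"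
    and N: "1 \<le> N" and est: "\<And>z. norm z \<le> 1 \<Longrightarrow> (LINT y|lborel. \<bar>v (y + z) - v y\<bar> ^ N) \<le> C * norm z"
    and q: "1 \<le> q" "q \<le> real N" and s: "0 < s" "s * real N < 1"
  shows "in_Wsq s q v"
proof -
  obtain M where M: "M \<ge> 0" "\<And>x. \<bar>v x\<bar> \<le> M" using bdd_borel_bound[OF v] by blast
  obtain R where R: "\<And>x. v x \<noteq> 0 \<Longrightarrow> norm x \<le> R" using bs by (auto simp: bounded_iff)
  have vm[measurable]: "v \<in> borel_measurable borel" using v by (rule bdd_borel_measurable)
  let ?d = "real DIM('a)"
  define a where "a = ?d + s * q"
  define B where "B = cball (0::'a) (R + 1)"
  have Bm[measurable]: "B \<in> sets borel" by (simp add: B_def)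
  have Bfin: "emeasure lborel B < \<infinity>" unfolding B_def by (rule emeasure_bounded_finite[OF bounded_cball])
  define m where "m = measure lborel B"
  have eB: "emeasure lborel B = ennreal m" using Bfin by (simp add: m_def emeasure_eq_ennreal_measure)
  have m0: "m \<ge> 0" by (simp add: m_def)
  have vz: "v y = 0" if "y \<notin> B" for y using R[of y] that by (force simp: B_def)
  define I where "I w = (\<integral>\<^sup>+y. ennreal (\<bar>v (y + w) - v y\<bar> powr q) \<partial>lborel)" for w
  have I_near: "I w \<le> ennreal ((m + \<bar>C\<bar>) * norm w powr (q / N))" if w: "norm w \<le> 1" "w \<noteq> 0" for w
  proof -
    have w0: "norm w > 0" using w by simp
    have bb: "bdd_borel (\<lambda>y. \<bar>v (y + w) - v y\<bar> ^ N)"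
    proof (rule bdd_borelI[of _ "(2 * M) ^ N"])
      fix y
      have "\<bar>v (y + w) - v y\<bar> \<le> 2 * M" using M(2)[of y] M(2)[of "y + w"] by linarith
      from power_mono[OF this, of N] show "\<bar>\<bar>v (y + w) - v y\<bar> ^ N\<bar> \<le> (2 * M) ^ N" by simp
    qed measurable
    have sup: "y \<in> B" if "v (y + w) - v y \<noteq> 0" for y
    proof -
      from that consider "v (y + w) \<noteq> 0" | "v y \<noteq> 0" by fastforce
      then have "norm y \<le> R + 1"
      proof cases
        case 1
        from R[OF this] show ?thesis using w(1) norm_triangle_ineq4[of "y + w" w] by simp
      next
        case 2
        from R[OF this] show ?thesis by simp
      qed
      then show ?thesis by (simp add: B_def)
    qed
    have i: "integrable lborel (\<lambda>y. \<bar>v (y + w) - v y\<bar> ^ N)"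
    proof (rule integrable_bounded_support[OF bb], rule bounded_subset)
      show "bounded B" by (simp add: B_def)
      show "{y. \<bar>v (y + w) - v y\<bar> ^ N \<noteq> 0} \<subseteq> B" using sup N by auto
    qed
    have "I w \<le> (\<integral>\<^sup>+y. ennreal (norm w powr (q / N)) * indicator B y + ennreal (norm w powr (q / N - 1)) * ennreal (\<bar>v (y + w) - v y\<bar> ^ N) \<partial>lborel)"
      unfolding I_def
    proof (rule nn_integral_mono)
      fix y
      show "ennreal (\<bar>v (y + w) - v y\<bar> powr q) \<le> ennreal (norm w powr (q / N)) * indicator B y + ennreal (norm w powr (q / N - 1)) * ennreal (\<bar>v (y + w) - v y\<bar> ^ N)"
      proof (cases "y \<in> B")
        case True
        have "ennreal (\<bar>v (y + w) - v y\<bar> powr q) \<le> ennreal (norm w powr (q / N) + norm w powr (q / N - 1) * \<bar>v (y + w) - v y\<bar> ^ N)"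
          using powr_le_Young[OF _ w0 N, of "\<bar>v (y + w) - v y\<bar>" q] q by (intro ennreal_leI) simp
        then show ?thesis using True by (simp add: ennreal_plus ennreal_mult)
      next
        case False
        then have "v (y + w) - v y = 0" using sup by blast
        then show ?thesis by simp
      qed
    qed
    also have "\<dots> = ennreal (norm w powr (q / N)) * emeasure lborel B + ennreal (norm w powr (q / N - 1)) * (\<integral>\<^sup>+y. ennreal (\<bar>v (y + w) - v y\<bar> ^ N) \<partial>lborel)"
      by (subst nn_integral_add) (simp_all add: nn_integral_cmult)
    also have "(\<integral>\<^sup>+y. ennreal (\<bar>v (y + w) - v y\<bar> ^ N) \<partial>lborel) = ennreal (LINT y|lborel. \<bar>v (y + w) - v y\<bar> ^ N)"
      by (rule nn_integral_eq_integral[OF i]) simp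
    also have "ennreal (norm w powr (q / N)) * emeasure lborel B + ennreal (norm w powr (q / N - 1)) * ennreal (LINT y|lborel. \<bar>v (y + w) - v y\<bar> ^ N)
      \<le> ennreal (norm w powr (q / N)) * ennreal m + ennreal (norm w powr (q / N - 1)) * ennreal (\<bar>C\<bar> * norm w)"
    proof (intro add_mono mult_left_mono)
      have "(LINT y|lborel. \<bar>v (y + w) - v y\<bar> ^ N) \<le> C * norm w" by (rule est[OF w(1)])
      also have "\<dots> \<le> \<bar>C\<bar> * norm w" by (intro mult_right_mono) auto
      finally show "ennreal (LINT y|lborel. \<bar>v (y + w) - v y\<bar> ^ N) \<le> ennreal (\<bar>C\<bar> * norm w)" by (rule ennreal_leI)
    qed (simp_all add: eB)
    also have "\<dots> = ennreal (norm w powr (q / N) * m + norm w powr (q / N - 1) * (\<bar>C\<bar> * norm w))"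
      using m0 by (simp add: ennreal_plus ennreal_mult)
    also have "norm w powr (q / N) * m + norm w powr (q / N - 1) * (\<bar>C\<bar> * norm w) = (m + \<bar>C\<bar>) * norm w powr (q / N)"
    proof -
      have "norm w powr (q / N - 1) * norm w = norm w powr (q / N)"
        using w0 powr_add[of "norm w" "q / N - 1" 1] by simp
      then show ?thesis by (simp add: algebra_simps)
    qed
    finally show ?thesis .
  qed
  have I_far: "I w \<le> ennreal (2 * ((2 * M) powr q * m))" for w
  proof -
    have "I w \<le> (\<integral>\<^sup>+y. ennreal ((2 * M) powr q) * indicator B (y + w) + ennreal ((2 * M) powr q) * indicator B y \<partial>lborel)"
      unfolding I_def
    proof (rule nn_integral_mono)
      fix y
      have "\<bar>v (y + w) - v y\<bar> \<le> 2 * M" using M(2)[of y] M(2)[of "y + w"] by linarith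
      then have "\<bar>v (y + w) - v y\<bar> powr q \<le> (2 * M) powr q" using q by (intro powr_mono2) auto
      then have le: "ennreal (\<bar>v (y + w) - v y\<bar> powr q) \<le> ennreal ((2 * M) powr q)" by (rule ennreal_leI)
      show "ennreal (\<bar>v (y + w) - v y\<bar> powr q) \<le> ennreal ((2 * M) powr q) * indicator B (y + w) + ennreal ((2 * M) powr q) * indicator B y"
      proof (cases "y \<in> B \<or> y + w \<in> B")
        case True
        then show ?thesis using le by (auto simp: indicator_def add_increasing add_increasing2)
      next
        case False
        then show ?thesis using vz[of y] vz[of "y + w"] by simp
      qed
    qed
    also have "\<dots> = ennreal ((2 * M) powr q) * (\<integral>\<^sup>+y. indicator B (y + w) \<partial>lborel) + ennreal ((2 * M) powr q) * emeasure lborel B"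
      by (subst nn_integral_add) (simp_all add: nn_integral_cmult)
    also have "(\<integral>\<^sup>+y. indicator B (y + w) \<partial>lborel) = emeasure lborel B"
      using nn_integral_lborel_shift[of "indicator B" w] by simp
    also have "ennreal ((2 * M) powr q) * emeasure lborel B + ennreal ((2 * M) powr q) * emeasure lborel B = ennreal (2 * ((2 * M) powr q * m))"
      using m0 unfolding eB by (simp add: ennreal_mult[symmetric] ennreal_plus[symmetric] del: ennreal_plus)
    finally show ?thesis .
  qed
  let ?F = "\<lambda>y z. ennreal (\<bar>v y - v z\<bar> powr q * norm (y - z) powr (- (?d + s * q)))"
  have "(\<integral>\<^sup>+y. \<integral>\<^sup>+z. ?F y z \<partial>lebesgue \<partial>lebesgue) = (\<integral>\<^sup>+y. \<integral>\<^sup>+z. ?F y z \<partial>lborel \<partial>lborel)"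
    by (simp add: nn_integral_completion)
  also have "\<dots> = (\<integral>\<^sup>+y. \<integral>\<^sup>+w. ennreal (\<bar>v (y + w) - v y\<bar> powr q * norm w powr (- a)) \<partial>lborel \<partial>lborel)"
  proof (rule nn_integral_cong)
    fix y
    have "(\<integral>\<^sup>+z. ?F y z \<partial>lborel) = (\<integral>\<^sup>+w. ?F y (w + y) \<partial>lborel)"
      by (rule nn_integral_lborel_shift[symmetric]) measurable
    then show "(\<integral>\<^sup>+z. ?F y z \<partial>lborel) = (\<integral>\<^sup>+w. ennreal (\<bar>v (y + w) - v y\<bar> powr q * norm w powr (- a)) \<partial>lborel)"
      by (simp add: a_def add.commute abs_minus_commute)
  qed
  also have "\<dots> = (\<integral>\<^sup>+w. \<integral>\<^sup>+y. ennreal (\<bar>v (y + w) - v y\<bar> powr q * norm w powr (- a)) \<partial>lborel \<partial>lborel)"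
    by (rule lborel_pair.Fubini'[symmetric]) measurable
  also have "\<dots> = (\<integral>\<^sup>+w. ennreal (norm w powr (- a)) * I w \<partial>lborel)"
  proof (rule nn_integral_cong)
    fix w
    have "(\<integral>\<^sup>+y. ennreal (\<bar>v (y + w) - v y\<bar> powr q * norm w powr (- a)) \<partial>lborel) = (\<integral>\<^sup>+y. ennreal (norm w powr (- a)) * ennreal (\<bar>v (y + w) - v y\<bar> powr q) \<partial>lborel)"
      by (simp add: ennreal_mult mult.commute)
    also have "\<dots> = ennreal (norm w powr (- a)) * I w" unfolding I_def by (rule nn_integral_cmult) measurable
    finally show "(\<integral>\<^sup>+y. ennreal (\<bar>v (y + w) - v y\<bar> powr q * norm w powr (- a)) \<partial>lborel) = ennreal (norm w powr (- a)) * I w" .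
  qed
  also have "\<dots> \<le> (\<integral>\<^sup>+w. ennreal (m + \<bar>C\<bar>) * ennreal (indicator (cball (0::'a) 1) w * norm w powr ((q / N - s * q) - ?d))
      + ennreal (2 * ((2 * M) powr q * m)) * ennreal (indicator (- cball 0 1) w * norm w powr (- (?d + s * q))) \<partial>lborel)"
  proof (rule nn_integral_mono)
    fix w :: 'a
    consider "w = 0" | "w \<noteq> 0" "norm w \<le> 1" | "norm w > 1" by linarith
    then show "ennreal (norm w powr (- a)) * I w \<le> ennreal (m + \<bar>C\<bar>) * ennreal (indicator (cball 0 1) w * norm w powr ((q / N - s * q) - ?d))
      + ennreal (2 * ((2 * M) powr q * m)) * ennreal (indicator (- cball 0 1) w * norm w powr (- (?d + s * q)))"
    proof cases
      case 1 then show ?thesis by simp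
    next
      case 2
      have "ennreal (norm w powr (- a)) * I w \<le> ennreal (norm w powr (- a)) * ennreal ((m + \<bar>C\<bar>) * norm w powr (q / N))"
        by (intro mult_left_mono I_near 2) auto
      also have "\<dots> = ennreal (norm w powr (- a) * ((m + \<bar>C\<bar>) * norm w powr (q / N)))"
        by (rule ennreal_mult[symmetric]) (use m0 in auto)
      also have "norm w powr (- a) * ((m + \<bar>C\<bar>) * norm w powr (q / N)) = (m + \<bar>C\<bar>) * norm w powr ((q / N - s * q) - ?d)"
        using powr_add[of "norm w" "- a" "q / N"] by (simp add: a_def algebra_simps)
      finally show ?thesis using 2 m0 by (simp add: ennreal_mult)
    next
      case 3
      have "ennreal (norm w powr (- a)) * I w \<le> ennreal (norm w powr (- a)) * ennreal (2 * ((2 * M) powr q * m))"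
        by (intro mult_left_mono I_far) auto
      then show ?thesis using 3 by (simp add: a_def mult.commute)
    qed
  qed
  also have "\<dots> = ennreal (m + \<bar>C\<bar>) * (\<integral>\<^sup>+w. ennreal (indicator (cball (0::'a) 1) w * norm w powr ((q / N - s * q) - ?d)) \<partial>lborel)
      + ennreal (2 * ((2 * M) powr q * m)) * (\<integral>\<^sup>+w. ennreal (indicator (- cball (0::'a) 1) w * norm w powr (- (?d + s * q))) \<partial>lborel)"
  proof -
    have [measurable]: "cball (0::'a) 1 \<in> sets borel" "- cball (0::'a) 1 \<in> sets borel" by simp_all
    have m1: "(\<lambda>w::'a. ennreal (indicator (cball 0 1) w * norm w powr ((q / N - s * q) - ?d))) \<in> borel_measurable lborel"
      by measurable
    have m2: "(\<lambda>w::'a. ennreal (indicator (- cball 0 1) w * norm w powr (- (?d + s * q)))) \<in> borel_measurable lborel"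
      by measurable
    show ?thesis
      unfolding nn_integral_cmult[OF m1, symmetric] nn_integral_cmult[OF m2, symmetric]
      by (rule nn_integral_add) measurable
  qed
  also have "\<dots> < \<infinity>"
  proof -
    have "q / N - s * q > 0" using q s N by (simp add: field_simps)
    then have 1: "(\<integral>\<^sup>+w. ennreal (indicator (cball (0::'a) 1) w * norm w powr ((q / N - s * q) - ?d)) \<partial>lborel) < \<infinity>"
      by (rule nn_integral_near_origin_finite)
    have "s * q > 0" using q s by simp
    then have 2: "(\<integral>\<^sup>+w. ennreal (indicator (- cball (0::'a) 1) w * norm w powr (- (?d + s * q))) \<partial>lborel) < \<infinity>"
      by (rule nn_integral_far_finite)
    show ?thesis using 1 2 by (simp add: ennreal_mult_less_top)
  qed
  finally have fin: "(\<integral>\<^sup>+y. \<integral>\<^sup>+z. ?F y z \<partial>lebesgue \<partial>lebesgue) < \<infinity>" .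
  have "integrable lborel (\<lambda>x. \<bar>v x\<bar> powr q)"
  proof (rule integrable_bounded_support)
    show "bdd_borel (\<lambda>x. \<bar>v x\<bar> powr q)"
      by (rule bdd_borelI[of _ "M powr q"]) (use M q in \<open>auto intro!: powr_mono2\<close>)
    show "bounded {x. \<bar>v x\<bar> powr q \<noteq> 0}" by (rule bounded_subset[OF bs]) auto
  qed
  then have "integrable lebesgue (\<lambda>x. \<bar>v x\<bar> powr q)" by (subst integrable_completion) auto
  moreover have "v \<in> borel_measurable lebesgue" by (rule measurable_completion) simp
  ultimately show ?thesis using fin by (simp add: in_Wsq_def in_Lp_def)
qed

lemma in_Wsq_cong_AE:
  fixes v w :: "'a::euclidean_space \<Rightarrow> real"
  assumes w: "in_Wsq s q w" and vm: "v \<in> borel_measurable lebesgue" and ae: "AE x in lebesgue. v x = w x"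
  shows "in_Wsq s q v"
proof -
  have wm: "w \<in> borel_measurable lebesgue" and wi: "integrable lebesgue (\<lambda>x. \<bar>w x\<bar> powr q)"
    using w by (auto simp: in_Wsq_def in_Lp_def)
  have "integrable lebesgue (\<lambda>x. \<bar>v x\<bar> powr q) \<longleftrightarrow> integrable lebesgue (\<lambda>x. \<bar>w x\<bar> powr q)"
  proof (rule integrable_cong_AE)
    show "(\<lambda>x. \<bar>v x\<bar> powr q) \<in> borel_measurable lebesgue"
      by (intro powr_real_measurable borel_measurable_abs vm borel_measurable_const)
    show "(\<lambda>x. \<bar>w x\<bar> powr q) \<in> borel_measurable lebesgue"
      by (intro powr_real_measurable borel_measurable_abs wm borel_measurable_const)
    show "AE x in lebesgue. \<bar>v x\<bar> powr q = \<bar>w x\<bar> powr q" using ae by eventually_elim simp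
  qed
  with wi have "integrable lebesgue (\<lambda>x. \<bar>v x\<bar> powr q)" by simp
  moreover have "(\<integral>\<^sup>+y. \<integral>\<^sup>+z. ennreal (\<bar>v y - v z\<bar> powr q * norm (y - z) powr (- (real DIM('a) + s * q))) \<partial>lebesgue \<partial>lebesgue)
    = (\<integral>\<^sup>+y. \<integral>\<^sup>+z. ennreal (\<bar>w y - w z\<bar> powr q * norm (y - z) powr (- (real DIM('a) + s * q))) \<partial>lebesgue \<partial>lebesgue)"
  proof (rule nn_integral_cong_AE)
    have inner: "(\<integral>\<^sup>+z. ennreal (\<bar>c - v z\<bar> powr q * norm (y - z) powr (- (real DIM('a) + s * q))) \<partial>lebesgue)
      = (\<integral>\<^sup>+z. ennreal (\<bar>c - w z\<bar> powr q * norm (y - z) powr (- (real DIM('a) + s * q))) \<partial>lebesgue)" for c and y :: 'a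
    proof (rule nn_integral_cong_AE)
      show "AE z in lebesgue. ennreal (\<bar>c - v z\<bar> powr q * norm (y - z) powr (- (real DIM('a) + s * q)))
        = ennreal (\<bar>c - w z\<bar> powr q * norm (y - z) powr (- (real DIM('a) + s * q)))"
        using ae by eventually_elim simp
    qed
    show "AE y in lebesgue. (\<integral>\<^sup>+z. ennreal (\<bar>v y - v z\<bar> powr q * norm (y - z) powr (- (real DIM('a) + s * q))) \<partial>lebesgue)
      = (\<integral>\<^sup>+z. ennreal (\<bar>w y - w z\<bar> powr q * norm (y - z) powr (- (real DIM('a) + s * q))) \<partial>lebesgue)"
      using ae by eventually_elim (simp only: inner)
  qed
  ultimately show ?thesis using w vm by (simp add: in_Wsq_def in_Lp_def)
qed

text \<open>
  The cutoffs may be pulled out of the increments at the price of an error that is linear in the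
  increment of the cutoff.
\<close>

lemma localized_square_expansion:
  fixes a b c a0 b0 c0 \<zeta>p \<zeta>q M Z :: real
  assumes "\<bar>a\<bar> \<le> M" "\<bar>b\<bar> \<le> M" "\<bar>c\<bar> \<le> M" "\<bar>a0\<bar> \<le> M" "\<bar>b0\<bar> \<le> M" "\<bar>c0\<bar> \<le> M" "\<bar>\<zeta>p\<bar> \<le> Z" "\<bar>\<zeta>q\<bar> \<le> Z"
  shows "\<zeta>q\<^sup>2 * ((a - a0) * (b - b0) - (c - c0)\<^sup>2)
    \<le> ((a * \<zeta>p - a0 * \<zeta>q) * (b * \<zeta>p - b0 * \<zeta>q) - (c * \<zeta>p - c0 * \<zeta>q) * (c * \<zeta>p - c0 * \<zeta>q)) + 12 * M\<^sup>2 * Z * \<bar>\<zeta>p - \<zeta>q\<bar>"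
proof -
  have M: "M \<ge> 0" and Z: "Z \<ge> 0" using assms by linarith+
  define \<delta> where "\<delta> = \<zeta>p - \<zeta>q"
  have \<delta>: "\<bar>\<delta>\<bar> \<le> 2 * Z" using assms by (simp add: \<delta>_def)
  have bd: "\<bar>\<zeta>q * (x - x0) * y + \<zeta>q * (y - y0) * x + x * y * \<delta>\<bar> \<le> 6 * (M\<^sup>2 * Z)"
    if "\<bar>x\<bar> \<le> M" "\<bar>y\<bar> \<le> M" "\<bar>x0\<bar> \<le> M" "\<bar>y0\<bar> \<le> M" for x y x0 y0
  proof -
    have z: "\<bar>\<zeta>q\<bar> \<le> Z" by (rule assms(8))
    have x: "\<bar>x - x0\<bar> \<le> 2 * M" using that(1,3) by linarith
    have y: "\<bar>y - y0\<bar> \<le> 2 * M" using that(2,4) by linarith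
    have prod3: "\<bar>f * g * h\<bar> \<le> F * G * H" if "\<bar>f\<bar> \<le> F" "\<bar>g\<bar> \<le> G" "\<bar>h\<bar> \<le> H" for f g h F G H :: real
    proof -
      have "0 \<le> F" "0 \<le> G" "0 \<le> H" using that by linarith+
      then show ?thesis unfolding abs_mult using that by (intro mult_mono) simp_all
    qed
    have 1: "\<bar>\<zeta>q * (x - x0) * y\<bar> \<le> Z * (2 * M) * M" by (rule prod3[OF z x that(2)])
    have 2: "\<bar>\<zeta>q * (y - y0) * x\<bar> \<le> Z * (2 * M) * M" by (rule prod3[OF z y that(1)])
    have 3: "\<bar>x * y * \<delta>\<bar> \<le> M * M * (2 * Z)" by (rule prod3[OF that(1,2) \<delta>])
    have "\<bar>\<zeta>q * (x - x0) * y + \<zeta>q * (y - y0) * x + x * y * \<delta>\<bar> \<le> Z * (2 * M) * M + Z * (2 * M) * M + M * M * (2 * Z)"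
      using 1 2 3 by linarith
    also have "\<dots> = 6 * (M\<^sup>2 * Z)" by (simp add: power2_eq_square)
    finally show ?thesis .
  qed
  let ?E1 = "\<zeta>q * (a - a0) * b + \<zeta>q * (b - b0) * a + a * b * \<delta>"
  let ?E2 = "\<zeta>q * (c - c0) * c + \<zeta>q * (c - c0) * c + c * c * \<delta>"
  have eq: "\<zeta>q\<^sup>2 * ((a - a0) * (b - b0) - (c - c0)\<^sup>2)
    = ((a * \<zeta>p - a0 * \<zeta>q) * (b * \<zeta>p - b0 * \<zeta>q) - (c * \<zeta>p - c0 * \<zeta>q) * (c * \<zeta>p - c0 * \<zeta>q)) - \<delta> * ?E1 + \<delta> * ?E2"
    by (simp add: \<delta>_def power2_eq_square algebra_simps)
  have "\<bar>?E1\<bar> \<le> 6 * (M\<^sup>2 * Z)" "\<bar>?E2\<bar> \<le> 6 * (M\<^sup>2 * Z)"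
    by (rule bd[OF assms(1,2,4,5)], rule bd[OF assms(3,3,6,6)])
  then have "\<bar>\<delta> * ?E1\<bar> \<le> \<bar>\<delta>\<bar> * (6 * (M\<^sup>2 * Z))" "\<bar>\<delta> * ?E2\<bar> \<le> \<bar>\<delta>\<bar> * (6 * (M\<^sup>2 * Z))"
    unfolding abs_mult by (intro mult_left_mono; simp)+
  moreover have "\<bar>\<delta>\<bar> * (6 * (M\<^sup>2 * Z)) + \<bar>\<delta>\<bar> * (6 * (M\<^sup>2 * Z)) = 12 * M\<^sup>2 * Z * \<bar>\<delta>\<bar>" by simp
  ultimately show ?thesis unfolding eq \<delta>_def[symmetric] by linarith
qed

section \<open>The translation estimate for a truncated solution\<close>

lemma power_add_le: "0 \<le> a \<Longrightarrow> 0 \<le> b \<Longrightarrow> (a + b) ^ N \<le> 2 ^ N * (a ^ N + b ^ N)" for a b :: real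
proof -
  assume ab: "0 \<le> a" "0 \<le> b"
  have "(a + b) ^ N \<le> (2 * max a b) ^ N" using ab by (intro power_mono) auto
  also have "\<dots> = 2 ^ N * (max a b) ^ N" by (rule power_mult_distrib)
  also have "(max a b) ^ N \<le> a ^ N + b ^ N" using ab by (simp add: max_def)
  finally show ?thesis by simp
qed

lemma bdd_borel_pow_prim:
  assumes "bdd_borel U" shows "bdd_borel (\<lambda>p. pow_prim m (U p))"
proof -
  obtain M where M: "M \<ge> 0" "\<And>x. \<bar>U x\<bar> \<le> M" using bdd_borel_bound[OF assms] by blast
  have [measurable]: "U \<in> borel_measurable borel" using assms by (rule bdd_borel_measurable)
  show ?thesis
  proof (rule bdd_borelI)
    show "(\<lambda>p. pow_prim m (U p)) \<in> borel_measurable borel" unfolding pow_prim_def by measurable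
    show "\<bar>pow_prim m (U p)\<bar> \<le> M ^ (m + 1) / real (m + 1)" for p
      using power_mono[OF M(2) abs_ge_zero, of p "m + 1"]
      by (simp add: pow_prim_def power_abs abs_mult divide_right_mono del: power_Suc)
  qed
qed

text \<open>
  Where \<open>\<phi>\<close> does not vanish, \<open>\<zeta> \<ge> 1\<close>; so \<open>\<bar>\<phi>\<bar>\<^sup>N \<bar>\<Delta>U\<bar>\<^sup>N\<close> is controlled by \<open>\<zeta>\<^sup>2\<close> times the deficit, and
  thus by the integrand of the commutator estimate.  The increments of \<open>\<zeta>\<close> and \<open>\<phi>\<close> contribute errors
  of the order \<open>\<bar>z\<bar>\<close> in a fixed ball.
\<close>

lemma (in cutoff) Nikolskii_estimate:
  assumes U: "bdd_borel U" and k: "even k" and l: "1 \<le> l"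
    and est: "\<exists>C. \<forall>z. (LINT q|lborel.
      (pow_prim k (U (q + z)) * \<zeta> (q + z) - pow_prim k (U q) * \<zeta> q) * (pow_prim (k + 2 * l) (U (q + z)) * \<zeta> (q + z) - pow_prim (k + 2 * l) (U q) * \<zeta> q)
    - (pow_prim (k + l) (U (q + z)) * \<zeta> (q + z) - pow_prim (k + l) (U q) * \<zeta> q) * (pow_prim (k + l) (U (q + z)) * \<zeta> (q + z) - pow_prim (k + l) (U q) * \<zeta> q)) \<le> C * norm z"
    and \<phi>: "\<phi> \<in> Cinf_compact" "\<And>x. \<phi> x \<noteq> 0 \<Longrightarrow> 1 \<le> \<zeta> x"
  shows "\<exists>C. \<forall>z. norm z \<le> 1 \<longrightarrow>
    (LINT y|lborel. \<bar>\<phi> (y + z) * U (y + z) - \<phi> y * U y\<bar> ^ (2 * k + 2 * l + 2)) \<le> C * norm z"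
proof -
  let ?N = "2 * k + 2 * l + 2"
  let ?A = "\<lambda>p. pow_prim k (U p)" and ?B = "\<lambda>p. pow_prim (k + 2 * l) (U p)" and ?D = "\<lambda>p. pow_prim (k + l) (U p)"
  note bA = bdd_borel_pow_prim[OF U, of k] and bB = bdd_borel_pow_prim[OF U, of "k + 2 * l"] and bD = bdd_borel_pow_prim[OF U, of "k + l"]
  obtain M0 where M0: "M0 \<ge> 0" "\<And>x. \<bar>U x\<bar> \<le> M0" using bdd_borel_bound[OF U] by blast
  obtain MA where MA: "MA \<ge> 0" "\<And>x. \<bar>?A x\<bar> \<le> MA" using bdd_borel_bound[OF bA] by blast
  obtain MB where MB: "MB \<ge> 0" "\<And>x. \<bar>?B x\<bar> \<le> MB" using bdd_borel_bound[OF bB] by blast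
  obtain MD where MD: "MD \<ge> 0" "\<And>x. \<bar>?D x\<bar> \<le> MD" using bdd_borel_bound[OF bD] by blast
  define M where "M = MA + MB + MD"
  have M: "\<bar>?A x\<bar> \<le> M" "\<bar>?B x\<bar> \<le> M" "\<bar>?D x\<bar> \<le> M" for x
    using MA(2)[of x] MB(2)[of x] MD(2)[of x] MA(1) MB(1) MD(1) unfolding M_def by linarith+
  obtain Z where Z: "Z \<ge> 0" "\<And>x. \<bar>\<zeta> x\<bar> \<le> Z" using bdd_borel_bound[OF Cinf_compact_bdd_borel[OF \<zeta>C]] by blast
  obtain C\<phi> where C\<phi>: "C\<phi> \<ge> 0" "\<And>x. \<bar>\<phi> x\<bar> \<le> C\<phi>" using bdd_borel_bound[OF Cinf_compact_bdd_borel[OF \<phi>(1)]] by blast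
  obtain L where L: "L \<ge> 0" "\<And>x z. \<bar>\<zeta> (x + z) - \<zeta> x\<bar> \<le> L * norm z" using Cinf_compact_lipschitz[OF \<zeta>C] by blast
  obtain L\<phi> where L\<phi>: "L\<phi> \<ge> 0" "\<And>x z. \<bar>\<phi> (x + z) - \<phi> x\<bar> \<le> L\<phi> * norm z" using Cinf_compact_lipschitz[OF \<phi>(1)] by blast
  obtain C where C: "\<And>z. (LINT q|lborel. (?A (q + z) * \<zeta> (q + z) - ?A q * \<zeta> q) * (?B (q + z) * \<zeta> (q + z) - ?B q * \<zeta> q)
    - (?D (q + z) * \<zeta> (q + z) - ?D q * \<zeta> q) * (?D (q + z) * \<zeta> (q + z) - ?D q * \<zeta> q)) \<le> C * norm z"
    using est by blast
  have "bounded {x. \<zeta> x \<noteq> 0}" using \<zeta>C by (simp add: Cinf_compact_iff)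
  then obtain R where R: "\<And>x. \<zeta> x \<noteq> 0 \<Longrightarrow> norm x \<le> R" by (auto simp: bounded_iff)
  have R\<phi>: "norm x \<le> R" if "\<phi> x \<noteq> 0" for x using \<phi>(2)[OF that] R[of x] by auto
  define B where "B = cball (0::'a) (R + 1)"
  have Bi: "integrable lborel (indicator B :: 'a \<Rightarrow> real)"
    using emeasure_bounded_finite[OF bounded_cball, of "0 :: 'a" "R + 1"] by (auto simp: B_def)
  define m where "m = measure lborel B"
  have inB: "y \<in> B" if "norm z \<le> 1" "f (y + z) - f y \<noteq> 0" "\<And>x. f x \<noteq> 0 \<Longrightarrow> norm x \<le> R" for f :: "'a \<Rightarrow> real" and y z
  proof -
    from that(2) consider "f (y + z) \<noteq> 0" | "f y \<noteq> 0" by fastforce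
    then have "norm y \<le> R + 1"
    proof cases
      case 1
      from that(3)[OF this] show ?thesis using that(1) norm_triangle_ineq4[of "y + z" z] by simp
    next
      case 2
      from that(3)[OF this] show ?thesis by simp
    qed
    then show ?thesis by (simp add: B_def)
  qed
  define K1 where "K1 = 2 ^ ?N * (C\<phi> ^ ?N * 12 ^ ?N)"
  define K2 where "K2 = K1 * (12 * M\<^sup>2 * Z * L) + 2 ^ ?N * (M0 ^ ?N * L\<phi> ^ ?N)"
  have K1: "K1 \<ge> 0" using C\<phi>(1) by (simp add: K1_def)
  have K2: "K2 \<ge> 0" using K1 Z(1) L(1) L\<phi>(1) M0(1) by (simp add: K2_def)
  define G where "G z q = (?A (q + z) * \<zeta> (q + z) - ?A q * \<zeta> q) * (?B (q + z) * \<zeta> (q + z) - ?B q * \<zeta> q)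
    - (?D (q + z) * \<zeta> (q + z) - ?D q * \<zeta> q) * (?D (q + z) * \<zeta> (q + z) - ?D q * \<zeta> q)" for z q
  have Gi: "integrable lborel (G z)" for z
    unfolding G_def[abs_def]
    by (intro Bochner_Integration.integrable_diff correlation_difference(1) loc_bdd loc_bounded_support bA bB bD)
  have pt: "\<bar>\<phi> (y + z) * U (y + z) - \<phi> y * U y\<bar> ^ ?N \<le> K1 * G z y + K2 * norm z * indicator B y" if z: "norm z \<le> 1" for y z
  proof -
    have \<zeta>d: "\<bar>\<zeta> (y + z) - \<zeta> y\<bar> \<le> L * norm z * indicator B y"
    proof (cases "\<zeta> (y + z) - \<zeta> y = 0")
      case True then show ?thesis using L(1) by simp
    next
      case False
      then have "y \<in> B" using inB[of z \<zeta> y] R z by blast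
      then show ?thesis using L(2)[of y z] by simp
    qed
    have \<phi>d: "\<bar>\<phi> (y + z) - \<phi> y\<bar> ^ ?N \<le> L\<phi> ^ ?N * (norm z * indicator B y)"
    proof (cases "\<phi> (y + z) - \<phi> y = 0")
      case True then show ?thesis using L\<phi>(1) by simp
    next
      case False
      then have yB: "y \<in> B" using inB[of z \<phi> y] R\<phi> z by blast
      have "\<bar>\<phi> (y + z) - \<phi> y\<bar> ^ ?N \<le> (L\<phi> * norm z) ^ ?N" by (rule power_mono[OF L\<phi>(2)]) simp
      also have "\<dots> = L\<phi> ^ ?N * norm z ^ ?N" by (rule power_mult_distrib)
      also have "norm z ^ ?N \<le> norm z ^ 1" by (rule power_decreasing) (use z in auto)
      finally show ?thesis using yB L\<phi>(1) by (simp add: mult_left_mono)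
    qed
    have "\<bar>\<phi> y\<bar> ^ ?N * \<bar>U (y + z) - U y\<bar> ^ ?N \<le> C\<phi> ^ ?N * 12 ^ ?N * (G z y + 12 * M\<^sup>2 * Z * (L * norm z * indicator B y))"
    proof -
      let ?g = "gap k l (U y) (U (y + z))"
      have g: "(\<bar>U (y + z) - U y\<bar> / 12) ^ ?N \<le> ?g" by (rule gap_lower[OF k l])
      have g0: "0 \<le> (\<bar>U (y + z) - U y\<bar> / 12) ^ ?N" by (intro zero_le_power) simp
      have "(\<zeta> y)\<^sup>2 * ?g \<le> G z y + 12 * M\<^sup>2 * Z * \<bar>\<zeta> (y + z) - \<zeta> y\<bar>"
        unfolding gap_def G_def by (rule localized_square_expansion[OF M(1,2,3) M(1,2,3) Z(2) Z(2)])
      also have "\<dots> \<le> G z y + 12 * M\<^sup>2 * Z * (L * norm z * indicator B y)"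
        by (intro add_left_mono mult_left_mono \<zeta>d) (use Z(1) in simp)
      finally have gG: "(\<zeta> y)\<^sup>2 * ?g \<le> G z y + 12 * M\<^sup>2 * Z * (L * norm z * indicator B y)" .
      have "\<bar>\<phi> y\<bar> ^ ?N * \<bar>U (y + z) - U y\<bar> ^ ?N = \<bar>\<phi> y\<bar> ^ ?N * (12 ^ ?N * (\<bar>U (y + z) - U y\<bar> / 12) ^ ?N)"
        by (simp add: power_mult_distrib[symmetric])
      also have "\<dots> \<le> (C\<phi> ^ ?N * (\<zeta> y)\<^sup>2) * (12 ^ ?N * (\<bar>U (y + z) - U y\<bar> / 12) ^ ?N)"
      proof (rule mult_right_mono)
        show "\<bar>\<phi> y\<bar> ^ ?N \<le> C\<phi> ^ ?N * (\<zeta> y)\<^sup>2"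
        proof (cases "\<phi> y = 0")
          case False
          have "\<bar>\<phi> y\<bar> ^ ?N * 1 \<le> C\<phi> ^ ?N * (\<zeta> y)\<^sup>2"
            using power_mono[OF C\<phi>(2)[of y] abs_ge_zero, of ?N] one_le_power[OF \<phi>(2)[OF False], of 2] C\<phi>(1)
            by (intro mult_mono) simp_all
          then show ?thesis by simp
        qed (use C\<phi>(1) in simp)
        show "0 \<le> 12 ^ ?N * (\<bar>U (y + z) - U y\<bar> / 12) ^ ?N" using g0 by simp
      qed
      also have "\<dots> \<le> (C\<phi> ^ ?N * (\<zeta> y)\<^sup>2) * (12 ^ ?N * ?g)"
        by (intro mult_left_mono g) (use C\<phi>(1) in auto)
      also have "\<dots> = C\<phi> ^ ?N * 12 ^ ?N * ((\<zeta> y)\<^sup>2 * ?g)" by simp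
      also have "\<dots> \<le> C\<phi> ^ ?N * 12 ^ ?N * (G z y + 12 * M\<^sup>2 * Z * (L * norm z * indicator B y))"
        by (rule mult_left_mono[OF gG]) (use C\<phi>(1) in auto)
      finally show ?thesis .
    qed
    moreover have "\<bar>U (y + z)\<bar> ^ ?N * \<bar>\<phi> (y + z) - \<phi> y\<bar> ^ ?N \<le> M0 ^ ?N * (L\<phi> ^ ?N * (norm z * indicator B y))"
      by (rule mult_mono[OF power_mono[OF M0(2)] \<phi>d]) (use M0(1) in auto)
    moreover have "\<bar>\<phi> (y + z) * U (y + z) - \<phi> y * U y\<bar> ^ ?N
      \<le> 2 ^ ?N * (\<bar>\<phi> y\<bar> ^ ?N * \<bar>U (y + z) - U y\<bar> ^ ?N + \<bar>U (y + z)\<bar> ^ ?N * \<bar>\<phi> (y + z) - \<phi> y\<bar> ^ ?N)"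
    proof -
      have "\<phi> (y + z) * U (y + z) - \<phi> y * U y = \<phi> y * (U (y + z) - U y) + U (y + z) * (\<phi> (y + z) - \<phi> y)"
        by (simp add: algebra_simps)
      then have "\<bar>\<phi> (y + z) * U (y + z) - \<phi> y * U y\<bar> \<le> \<bar>\<phi> y\<bar> * \<bar>U (y + z) - U y\<bar> + \<bar>U (y + z)\<bar> * \<bar>\<phi> (y + z) - \<phi> y\<bar>"
        using abs_triangle_ineq[of "\<phi> y * (U (y + z) - U y)" "U (y + z) * (\<phi> (y + z) - \<phi> y)"] by (simp only: abs_mult)
      from power_mono[OF this abs_ge_zero, of ?N]
      have "\<bar>\<phi> (y + z) * U (y + z) - \<phi> y * U y\<bar> ^ ?N \<le> (\<bar>\<phi> y\<bar> * \<bar>U (y + z) - U y\<bar> + \<bar>U (y + z)\<bar> * \<bar>\<phi> (y + z) - \<phi> y\<bar>) ^ ?N" .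
      also have "\<dots> \<le> 2 ^ ?N * ((\<bar>\<phi> y\<bar> * \<bar>U (y + z) - U y\<bar>) ^ ?N + (\<bar>U (y + z)\<bar> * \<bar>\<phi> (y + z) - \<phi> y\<bar>) ^ ?N)"
        by (rule power_add_le) auto
      finally show ?thesis by (simp only: power_mult_distrib)
    qed
    ultimately have "\<bar>\<phi> (y + z) * U (y + z) - \<phi> y * U y\<bar> ^ ?N
      \<le> 2 ^ ?N * (C\<phi> ^ ?N * 12 ^ ?N * (G z y + 12 * M\<^sup>2 * Z * (L * norm z * indicator B y)) + M0 ^ ?N * (L\<phi> ^ ?N * (norm z * indicator B y)))"
      by (meson add_mono mult_left_mono order_trans zero_le_numeral zero_le_power)
    also have "\<dots> = K1 * G z y + K2 * norm z * indicator B y"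
      unfolding K1_def K2_def by (simp only: distrib_left distrib_right ac_simps)
    finally show ?thesis .
  qed
  have "(LINT y|lborel. \<bar>\<phi> (y + z) * U (y + z) - \<phi> y * U y\<bar> ^ ?N) \<le> (K1 * C + K2 * m) * norm z" if z: "norm z \<le> 1" for z
  proof -
    have i2: "integrable lborel (\<lambda>y. K2 * norm z * indicator B y)" using Bi by simp
    have i1: "integrable lborel (\<lambda>y. K1 * G z y)" using Gi by simp
    have "(LINT y|lborel. \<bar>\<phi> (y + z) * U (y + z) - \<phi> y * U y\<bar> ^ ?N) \<le> (LINT y|lborel. K1 * G z y + K2 * norm z * indicator B y)"
    proof (rule integral_mono_AE')
      show "integrable lborel (\<lambda>y. K1 * G z y + K2 * norm z * indicator B y)"
        by (rule Bochner_Integration.integrable_add[OF i1 i2])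
      show "AE y in lborel. \<bar>\<phi> (y + z) * U (y + z) - \<phi> y * U y\<bar> ^ ?N \<le> K1 * G z y + K2 * norm z * indicator B y"
        by (rule AE_I2) (rule pt[OF z])
      show "AE y in lborel. 0 \<le> K1 * G z y + K2 * norm z * indicator B y"
        by (rule AE_I2) (rule order_trans[OF _ pt[OF z]], intro zero_le_power abs_ge_zero)
    qed
    also have "\<dots> = K1 * (LINT y|lborel. G z y) + K2 * norm z * m"
      unfolding Bochner_Integration.integral_add[OF i1 i2] by (simp add: m_def)
    also have "\<dots> \<le> K1 * (C * norm z) + K2 * norm z * m"
      using C[of z] K1 unfolding G_def by (intro add_right_mono mult_left_mono)
    finally show ?thesis by (simp add: algebra_simps)
  qed
  then show ?thesis by blast
qed

section \<open>Entropy solutions\<close>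

lemma exists_antiderivative:
  fixes f :: "real \<Rightarrow> real"
  assumes "continuous_on UNIV f"
  obtains F where "\<And>a. (F has_real_derivative f a) (at a)" "F 0 = 0"
proof -
  have "\<exists>F. \<forall>x :: real. -\<infinity> < ereal x \<longrightarrow> ereal x < \<infinity> \<longrightarrow> (F has_vector_derivative f x) (at x)"
    by (rule einterval_antiderivative) (use assms in \<open>auto simp: continuous_on_eq_continuous_at\<close>)
  then obtain F where F: "\<And>a. (F has_real_derivative f a) (at a)"
    by (auto simp: has_real_derivative_iff_has_vector_derivative)
  have "((\<lambda>a. F a - F 0) has_real_derivative f a) (at a)" for a
    using DERIV_diff[OF F[of a] DERIV_const[of "F 0"]] by simp
  then show ?thesis by (rule that) simp
qed

lemma antiderivative_unique:
  fixes F G :: "real \<Rightarrow> real"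
  assumes "\<And>a. (F has_real_derivative f a) (at a)" "\<And>a. (G has_real_derivative f a) (at a)" "F 0 = G 0"
  shows "F = G"
proof
  fix a
  have "((\<lambda>a. F a - G a) has_real_derivative 0) (at a)" for a using DERIV_diff[OF assms(1,2), of a] by simp
  then have "F a - G a = F 0 - G 0" by (intro DERIV_isconst_all) blast
  then show "F a = G a" using assms(3) by simp
qed

lemma DERIV_continuous_on_UNIV: "(\<And>a. (F has_real_derivative f a) (at a)) \<Longrightarrow> continuous_on A F"
  by (meson DERIV_continuous_on has_field_derivative_at_within)

text \<open>
  The chain rule of an entropy solution is stated for \<open>Sigma_psi\<close>; this lemma makes it available for
  every antiderivative of a function \<open>\<surd>\<psi> \<cdot> \<bar>a\<bar>\<^bsup>n/2\<^esup>\<close>.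
\<close>

lemma Sigma_psi_eq_antiderivative:
  assumes c: "continuous_on UNIV \<psi>" and F: "\<And>a. (F has_real_derivative sqrt (\<psi> a) * \<bar>a\<bar> powr (real n / 2)) (at a)" "F 0 = 0" and n: "1 \<le> n"
  shows "Sigma_psi n \<psi> = F"
proof
  fix a
  have cont: "continuous_on A (\<lambda>a. sqrt (\<psi> a) * \<bar>a\<bar> powr (real n / 2))" for A
    using continuous_on_subset[OF c] n
    by (intro continuous_intros continuous_on_powr') auto
  have "(LBINT w=ereal 0..ereal a. sqrt (\<psi> w) * \<bar>w\<bar> powr (real n / 2)) = F a - F 0"
    by (rule interval_integral_FTC_finite[OF cont])
       (use F(1) in \<open>auto simp: has_real_derivative_iff_has_vector_derivative intro: has_vector_derivative_at_within\<close>)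
  then show "Sigma_psi n \<psi> a = F a" using F(2) by (simp add: Sigma_psi_def)
qed

lemma halfspace_open: "open halfspace"
  unfolding halfspace_def by (intro open_Times open_greaterThan open_UNIV)

lemma halfspace_borel[measurable]: "halfspace \<in> sets borel"
  using halfspace_open by (rule borel_open)

lemma halfspace_lebesgue: "halfspace \<inter> space lebesgue \<in> sets lebesgue"
  using halfspace_borel by simp

lemma exists_borel_version:
  fixes f :: "txx \<Rightarrow> real"
  assumes "f \<in> borel_measurable (lebesgue_on halfspace)"
  obtains F where "F \<in> borel_measurable borel" "AE p in lebesgue. p \<in> halfspace \<longrightarrow> F p = f p" "\<And>p. p \<notin> halfspace \<Longrightarrow> F p = 0"
proof -
  have "(\<lambda>p. indicator halfspace p *\<^sub>R f p) \<in> borel_measurable lebesgue"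
    using assms borel_measurable_restrict_space_iff[OF halfspace_lebesgue] by blast
  then obtain G where G: "G \<in> borel_measurable lborel" "AE p in lborel. indicator halfspace p *\<^sub>R f p = G p"
    using completion_ex_borel_measurable_real by blast
  show ?thesis
  proof (rule that[of "\<lambda>p. indicator halfspace p * G p"])
    show "(\<lambda>p. indicator halfspace p * G p) \<in> borel_measurable borel" using G(1) by measurable
    have "AE p in lebesgue. indicator halfspace p *\<^sub>R f p = G p" using G(2) by (simp only: AE_completion_iff)
    then show "AE p in lebesgue. p \<in> halfspace \<longrightarrow> indicator halfspace p * G p = f p"
      by eventually_elim (auto simp: indicator_def)
  qed simp
qed

lemma halfspace_integral_eq:
  fixes H H' :: "txx \<Rightarrow> real"
  assumes m: "(\<lambda>p. indicator halfspace p *\<^sub>R H p) \<in> borel_measurable lebesgue" and H': "H' \<in> borel_measurable borel"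
    and eq: "AE p in lebesgue. p \<in> halfspace \<longrightarrow> H p = H' p" and out: "\<And>p. p \<notin> halfspace \<Longrightarrow> H' p = 0"
  shows "(LINT p:halfspace|lebesgue. H p) = (LINT p|lborel. H' p)"
proof -
  have "(LINT p:halfspace|lebesgue. H p) = (LINT p|lebesgue. indicator halfspace p *\<^sub>R H p)"
    by (simp add: set_lebesgue_integral_def)
  also have "\<dots> = (LINT p|lebesgue. H' p)"
  proof (rule integral_cong_AE[OF m])
    show "H' \<in> borel_measurable lebesgue" using H' by (intro measurable_completion) simp
    show "AE p in lebesgue. indicator halfspace p *\<^sub>R H p = H' p"
      using eq by eventually_elim (use out in \<open>auto simp: indicator_def\<close>)
  qed
  also have "\<dots> = (LINT p|lborel. H' p)" by (rule integral_completion) (use H' in simp)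
  finally show ?thesis .
qed

text \<open>
  The data of an entropy solution \<open>u\<close> with \<open>g = D \<Sigma>(u)\<close>, together with everywhere defined Borel
  versions \<open>U\<close> and \<open>G\<close>.  Iterated integrals over \<open>\<real>\<^sup>3 \<times> \<real>\<^sup>3\<close> need Borel functions, because the map
  \<open>(q, z) \<mapsto> u(q + z)\<close> need not be measurable for the product of the completed sigma algebras.
\<close>

locale solution =
  fixes n l :: nat and u0 :: "real \<times> real \<Rightarrow> real" and u U g G :: "txx \<Rightarrow> real"
  assumes n: "1 \<le> n"
    and um: "u \<in> borel_measurable (lebesgue_on halfspace)"
    and gm: "g \<in> borel_measurable (lebesgue_on halfspace)"
    and U: "bdd_borel U" "AE p in lebesgue. p \<in> halfspace \<longrightarrow> U p = u p"
    and G: "L2 G" "AE p in lebesgue. p \<in> halfspace \<longrightarrow> G p = g p"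
    and chain: "\<And>\<psi>. continuous_on UNIV \<psi> \<Longrightarrow> (\<And>w. 0 \<le> \<psi> w) \<Longrightarrow>
           weak_dir_deriv_on halfspace e_D (\<lambda>p. Sigma_psi n \<psi> (u p)) (\<lambda>p. sqrt (\<psi> (u p)) * g p)"
    and entropy: "\<And>S S' S'' Q R. convex_on UNIV S \<Longrightarrow>
        (\<And>a. (S has_real_derivative S' a) (at a)) \<Longrightarrow>
        (\<And>a. (S' has_real_derivative S'' a) (at a)) \<Longrightarrow>
        continuous_on UNIV S'' \<Longrightarrow>
        (\<And>a. (Q has_real_derivative S' a * a ^ l) (at a)) \<Longrightarrow>
        (\<And>a. (R has_real_derivative S' a * \<bar>a\<bar> ^ n) (at a)) \<Longrightarrow>
        \<exists>h. entropy_ineq S Q R h u0 u"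
begin

lemma um': "(\<lambda>p. indicator halfspace p *\<^sub>R u p) \<in> borel_measurable lebesgue"
  using um borel_measurable_restrict_space_iff[OF halfspace_lebesgue] by blast

lemma gm': "(\<lambda>p. indicator halfspace p *\<^sub>R g p) \<in> borel_measurable lebesgue"
  using gm borel_measurable_restrict_space_iff[OF halfspace_lebesgue] by blast

lemma comp_measurable:
  assumes "continuous_on UNIV F" shows "(\<lambda>p. F (indicator halfspace p *\<^sub>R u p)) \<in> borel_measurable lebesgue"
  by (rule measurable_compose[OF um' borel_measurable_continuous_onI[OF assms]])

lemma test_measurable: "\<phi> \<in> Cinf_compact \<Longrightarrow> \<phi> \<in> borel_measurable lebesgue"
  using bdd_borel_measurable[OF Cinf_compact_bdd_borel] by (intro measurable_completion) simp

lemma comp_borel: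
  assumes "continuous_on UNIV F" shows "(\<lambda>p. F (U p)) \<in> borel_measurable borel"
  by (rule measurable_compose[OF bdd_borel_measurable[OF U(1)] borel_measurable_continuous_onI[OF assms]])

lemma comp_bdd_borel:
  assumes "continuous_on UNIV F" shows "bdd_borel (\<lambda>p. F (U p))"
proof -
  obtain M where M: "\<And>p. \<bar>U p\<bar> \<le> M" using bdd_borel_bound[OF U(1)] by blast
  have "compact (F ` {-M..M})" by (rule compact_continuous_image[OF continuous_on_subset[OF assms]]) auto
  then have "bounded (F ` {-M..M})" by (rule compact_imp_bounded)
  then obtain C where C: "\<And>a. a \<in> {-M..M} \<Longrightarrow> \<bar>F a\<bar> \<le> C"
    unfolding bounded_iff real_norm_def by blast
  show ?thesis
  proof (rule bdd_borelI[OF comp_borel[OF assms]])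
    fix p show "\<bar>F (U p)\<bar> \<le> C" using C[of "U p"] M[of p] by (simp add: abs_le_iff)
  qed
qed

lemma weakD_Sigma:
  assumes c: "continuous_on UNIV \<psi>" "\<And>w. 0 \<le> \<psi> w" and F: "Sigma_psi n \<psi> = F" "continuous_on UNIV F"
  shows "weakD halfspace e_D (\<lambda>p. F (U p)) (\<lambda>p. sqrt (\<psi> (U p)) * G p)"
  unfolding weakD_def
proof
  fix \<phi> :: "txx \<Rightarrow> real" assume \<phi>: "\<phi> \<in> test_functions halfspace"
  have \<phi>C: "\<phi> \<in> Cinf_compact" using \<phi> by (simp add: test_functions_iff)
  note D = test_functions_dir_deriv[OF \<phi>]
  have DC: "dir_deriv e_D \<phi> \<in> Cinf_compact" by (rule Cinf_compact_dir_deriv[OF \<phi>C])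
  have cs: "continuous_on UNIV (\<lambda>a. sqrt (\<psi> a))" by (intro continuous_intros c)
  note [measurable] = comp_borel[OF F(2)] comp_borel[OF cs] L2_measurable[OF G(1)]
    bdd_borel_measurable[OF Cinf_compact_bdd_borel[OF \<phi>C]] bdd_borel_measurable[OF Cinf_compact_bdd_borel[OF DC]]
  have "(LINT p:halfspace|lebesgue. F (u p) * dir_deriv e_D \<phi> p) = (LINT p|lborel. F (U p) * dir_deriv e_D \<phi> p)"
  proof (rule halfspace_integral_eq)
    have "(\<lambda>p. F (indicator halfspace p *\<^sub>R u p) * dir_deriv e_D \<phi> p) \<in> borel_measurable lebesgue"
      by (intro borel_measurable_times comp_measurable F(2) test_measurable DC)
    moreover have "(\<lambda>p. F (indicator halfspace p *\<^sub>R u p) * dir_deriv e_D \<phi> p) = (\<lambda>p. indicator halfspace p *\<^sub>R (F (u p) * dir_deriv e_D \<phi> p))"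
      by (rule ext) (simp add: indicator_def test_functions_outside[OF D])
    ultimately show "(\<lambda>p. indicator halfspace p *\<^sub>R (F (u p) * dir_deriv e_D \<phi> p)) \<in> borel_measurable lebesgue" by simp
    show "AE p in lebesgue. p \<in> halfspace \<longrightarrow> F (u p) * dir_deriv e_D \<phi> p = F (U p) * dir_deriv e_D \<phi> p"
      using U(2) by eventually_elim simp
  qed (measurable, simp add: test_functions_outside[OF D])
  moreover have "(LINT p:halfspace|lebesgue. sqrt (\<psi> (u p)) * g p * \<phi> p) = (LINT p|lborel. sqrt (\<psi> (U p)) * G p * \<phi> p)"
  proof (rule halfspace_integral_eq)
    have "(\<lambda>p. sqrt (\<psi> (indicator halfspace p *\<^sub>R u p)) * (indicator halfspace p *\<^sub>R g p) * \<phi> p) \<in> borel_measurable lebesgue"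
      by (intro borel_measurable_times comp_measurable[OF cs] gm' test_measurable \<phi>C)
    moreover have "(\<lambda>p. sqrt (\<psi> (indicator halfspace p *\<^sub>R u p)) * (indicator halfspace p *\<^sub>R g p) * \<phi> p)
      = (\<lambda>p. indicator halfspace p *\<^sub>R (sqrt (\<psi> (u p)) * g p * \<phi> p))"
      by (rule ext) (simp add: indicator_def)
    ultimately show "(\<lambda>p. indicator halfspace p *\<^sub>R (sqrt (\<psi> (u p)) * g p * \<phi> p)) \<in> borel_measurable lebesgue" by simp
    show "AE p in lebesgue. p \<in> halfspace \<longrightarrow> sqrt (\<psi> (u p)) * g p * \<phi> p = sqrt (\<psi> (U p)) * G p * \<phi> p"
      using U(2) G(2) by eventually_elim simp
  qed (measurable, simp add: test_functions_outside[OF \<phi>])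
  moreover have "(LINT p:halfspace|lebesgue. F (u p) * dir_deriv e_D \<phi> p) = - (LINT p:halfspace|lebesgue. sqrt (\<psi> (u p)) * g p * \<phi> p)"
    using chain[OF c] \<phi> unfolding weak_dir_deriv_on_def F(1) by blast
  ultimately show "(LINT p|lborel. F (U p) * dir_deriv e_D \<phi> p) = - (LINT p|lborel. sqrt (\<psi> (U p)) * G p * \<phi> p)"
    by simp
qed

lemma powr_half: "\<bar>a\<bar> powr (real n / 2) * \<bar>a\<bar> powr (real n / 2) = \<bar>a\<bar> ^ n"
  using n by (cases "a = 0") (simp_all add: powr_add[symmetric] powr_realpow)

lemma powr_half_continuous: "continuous_on A (\<lambda>a. \<bar>a\<bar> powr (real n / 2))"
  using n by (intro continuous_intros continuous_on_powr') auto

text \<open>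
  The chain rule with \<open>\<psi> = (c \<bar>a\<bar>\<^bsup>n/2\<^esup>)\<^sup>2\<close>.
\<close>

lemma weakD_nonneg:
  assumes c: "continuous_on UNIV c" "\<And>a. 0 \<le> c a" and F: "\<And>a. (F has_real_derivative c a * \<bar>a\<bar> ^ n) (at a)" "F 0 = 0"
  shows "weakD halfspace e_D (\<lambda>p. F (U p)) (\<lambda>p. c (U p) * \<bar>U p\<bar> powr (real n / 2) * G p)"
proof -
  let ?w = "\<lambda>a. \<bar>a\<bar> powr (real n / 2)"
  \<comment> \<open>One factor \<open>\<bar>a\<bar>\<^bsup>n/2\<^esup>\<close> is part of \<open>Sigma_psi\<close>, the other one is put into \<open>\<psi>\<close>.\<close>
  define \<psi> where "\<psi> a = (c a * ?w a)\<^sup>2" for a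
  have sq: "sqrt (\<psi> a) = c a * ?w a" for a using c(2)[of a] by (simp add: \<psi>_def)
  have \<psi>: "continuous_on UNIV \<psi>" unfolding \<psi>_def by (intro continuous_intros powr_half_continuous c)
  have F': "(F has_real_derivative sqrt (\<psi> a) * ?w a) (at a)" for a
    using F(1)[of a] by (simp add: sq mult.assoc powr_half)
  have "Sigma_psi n \<psi> = F" by (rule Sigma_psi_eq_antiderivative[OF \<psi> F' F(2) n])
  from weakD_Sigma[OF \<psi> _ this DERIV_continuous_on_UNIV[OF F(1)]]
  show ?thesis unfolding sq by (simp add: \<psi>_def)
qed

text \<open>
  If \<open>F'\<close> is divisible by \<open>\<bar>a\<bar>\<^sup>n\<close>, then \<open>D F(u) = c(u) \<bar>u\<bar>\<^bsup>n/2\<^esup> g\<close> is square integrable.  The chain rule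
  covers only \<open>c \<ge> 0\<close>, so \<open>c\<close> is split into its positive and its negative part.
\<close>

lemma D_regular_comp:
  assumes c: "continuous_on UNIV c" and F: "\<And>a. (F has_real_derivative c a * \<bar>a\<bar> ^ n) (at a)" "F 0 = 0"
  shows "D_regular halfspace e_D (\<lambda>p. F (U p))"
proof -
  let ?w = "\<lambda>a. \<bar>a\<bar> powr (real n / 2)"
  define cp cm where "cp a = max (c a) 0" and "cm a = max (- c a) 0" for a
  have cp: "continuous_on UNIV cp" "\<And>a. 0 \<le> cp a" and cm: "continuous_on UNIV cm" "\<And>a. 0 \<le> cm a"
    unfolding cp_def cm_def using c by (auto intro!: continuous_intros)
  have ca: "c a = cp a - cm a" for a by (simp add: cp_def cm_def)
  have cFp: "continuous_on UNIV (\<lambda>a. cp a * \<bar>a\<bar> ^ n)" and cFm: "continuous_on UNIV (\<lambda>a. cm a * \<bar>a\<bar> ^ n)"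
    by (intro continuous_intros cp cm)+
  obtain Fp where Fp: "\<And>a. (Fp has_real_derivative cp a * \<bar>a\<bar> ^ n) (at a)" "Fp 0 = 0"
    using exists_antiderivative[OF cFp] by blast
  obtain Fm where Fm: "\<And>a. (Fm has_real_derivative cm a * \<bar>a\<bar> ^ n) (at a)" "Fm 0 = 0"
    using exists_antiderivative[OF cFm] by blast
  have "F = (\<lambda>a. Fp a - Fm a)"
  proof (rule antiderivative_unique[OF F(1)])
    fix a show "((\<lambda>a. Fp a - Fm a) has_real_derivative c a * \<bar>a\<bar> ^ n) (at a)"
      using DERIV_diff[OF Fp(1) Fm(1), of a] by (simp add: ca left_diff_distrib)
  qed (simp add: F(2) Fp(2) Fm(2))
  then have Feq: "F a = Fp a - Fm a" for a by simp
  note wp = weakD_nonneg[OF cp Fp] and wm = weakD_nonneg[OF cm Fm]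
  have cpw: "continuous_on UNIV (\<lambda>a. cp a * ?w a)" and cmw: "continuous_on UNIV (\<lambda>a. cm a * ?w a)"
    by (intro continuous_intros powr_half_continuous cp cm)+
  have Lp: "L2 (\<lambda>p. cp (U p) * ?w (U p) * G p)" by (rule L2_bdd_mult[OF comp_bdd_borel[OF cpw] G(1)])
  have Lm: "L2 (\<lambda>p. cm (U p) * ?w (U p) * G p)" by (rule L2_bdd_mult[OF comp_bdd_borel[OF cmw] G(1)])
  note bp = comp_bdd_borel[OF DERIV_continuous_on_UNIV[OF Fp(1)]] and bm = comp_bdd_borel[OF DERIV_continuous_on_UNIV[OF Fm(1)]]
  let ?f = "\<lambda>p. cp (U p) * ?w (U p) * G p + - (cm (U p) * ?w (U p) * G p)"
  have "weakD halfspace e_D (\<lambda>p. F (U p)) ?f"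
    unfolding weakD_def
  proof
    fix \<phi> :: "txx \<Rightarrow> real" assume \<phi>: "\<phi> \<in> test_functions halfspace"
    have \<phi>C: "\<phi> \<in> Cinf_compact" using \<phi> by (simp add: test_functions_iff)
    have DC: "dir_deriv e_D \<phi> \<in> Cinf_compact" by (rule Cinf_compact_dir_deriv[OF \<phi>C])
    have "(LINT p|lborel. F (U p) * dir_deriv e_D \<phi> p) = (LINT p|lborel. Fp (U p) * dir_deriv e_D \<phi> p - Fm (U p) * dir_deriv e_D \<phi> p)"
      by (simp add: Feq left_diff_distrib)
    also have "\<dots> = (LINT p|lborel. Fp (U p) * dir_deriv e_D \<phi> p) - (LINT p|lborel. Fm (U p) * dir_deriv e_D \<phi> p)"
      by (intro Bochner_Integration.integral_diff integrable_bdd_mult_Cinf bp bm DC)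
    also have "\<dots> = - ((LINT p|lborel. cp (U p) * ?w (U p) * G p * \<phi> p) - (LINT p|lborel. cm (U p) * ?w (U p) * G p * \<phi> p))"
      using wp wm \<phi> by (simp add: weakD_def)
    also have "(LINT p|lborel. cp (U p) * ?w (U p) * G p * \<phi> p) - (LINT p|lborel. cm (U p) * ?w (U p) * G p * \<phi> p)
      = (LINT p|lborel. cp (U p) * ?w (U p) * G p * \<phi> p - cm (U p) * ?w (U p) * G p * \<phi> p)"
      by (intro Bochner_Integration.integral_diff[symmetric] L2_mult_integrable Lp Lm Cinf_compact_L2 \<phi>C)
    also have "\<dots> = (LINT p|lborel. ?f p * \<phi> p)" by (simp add: left_diff_distrib)
    finally show "(LINT p|lborel. F (U p) * dir_deriv e_D \<phi> p) = - (LINT p|lborel. ?f p * \<phi> p)" .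
  qed
  moreover have "L2 ?f" by (intro L2_add L2_uminus Lp Lm)
  moreover have "bdd_borel (\<lambda>p. F (U p))" by (rule comp_bdd_borel[OF DERIV_continuous_on_UNIV[OF F(1)]])
  ultimately show ?thesis unfolding D_regular_def by blast
qed

text \<open>
  The entropy inequality for test functions supported in \<open>t > 0\<close>: the initial term vanishes, and the
  parabolic dissipation is nonnegative and may be dropped.
\<close>

lemma dissipative_entropy:
  assumes S: "\<And>a. (S has_real_derivative S' a) (at a)" "\<And>a. (S' has_real_derivative S'' a) (at a)"
      "continuous_on UNIV S''" "\<And>a. 0 \<le> S'' a"
    and Q: "\<And>a. (Q has_real_derivative S' a * a ^ l) (at a)" and R: "\<And>a. (R has_real_derivative S' a * \<bar>a\<bar> ^ n) (at a)"
  shows "dissipative halfspace e_t (e_1 + e_2) e_D (\<lambda>p. S (U p)) (\<lambda>p. Q (U p)) (\<lambda>p. R (U p))"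
proof -
  note cS = DERIV_continuous_on_UNIV[OF S(1)] and cQ = DERIV_continuous_on_UNIV[OF Q] and cR = DERIV_continuous_on_UNIV[OF R]
  have "convex_on UNIV S" by (rule f''_ge0_imp_convex[OF convex_UNIV S(1,2,4)])
  from entropy[OF this S(1,2,3) Q R] obtain h where h: "entropy_ineq S Q R h u0 u" by blast
  have "0 \<le> (LINT p|lborel. dual_op e_t (e_1 + e_2) e_D (\<lambda>p. S (U p)) (\<lambda>p. Q (U p)) (\<lambda>p. R (U p)) \<phi> p)"
    if \<phi>: "\<phi> \<in> test_functions halfspace" and pos: "\<forall>p. 0 \<le> \<phi> p" for \<phi>
  proof -
    have \<phi>C: "\<phi> \<in> Cinf_compact" using \<phi> by (simp add: test_functions_iff)
    have s: "smooth \<phi>" by (rule Cinf_compact_smooth[OF \<phi>C])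
    note D = test_functions_dir_deriv[OF \<phi>] and DD = test_functions_dir_deriv[OF test_functions_dir_deriv[OF \<phi>]]
    have DC: "dir_deriv v \<phi> \<in> Cinf_compact" "dir_deriv e_D (dir_deriv e_D \<phi>) \<in> Cinf_compact" for v
      by (intro Cinf_compact_dir_deriv \<phi>C)+
    note Db = bdd_borel_measurable[OF Cinf_compact_bdd_borel[OF DC(1)]] bdd_borel_measurable[OF Cinf_compact_bdd_borel[OF DC(2)]]
    let ?H = "\<lambda>p. S (u p) * dir_deriv e_t \<phi> p + Q (u p) * (dir_deriv e_1 \<phi> p + dir_deriv e_2 \<phi> p)
      + R (u p) * dir_deriv e_D (dir_deriv e_D \<phi>) p"
    let ?H' = "dual_op e_t (e_1 + e_2) e_D (\<lambda>p. S (U p)) (\<lambda>p. Q (U p)) (\<lambda>p. R (U p)) \<phi>"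
    have vec: "dir_deriv (e_1 + e_2) \<phi> p = dir_deriv e_1 \<phi> p + dir_deriv e_2 \<phi> p" for p
      by (rule dir_deriv_add_vec[OF s])
    have "(LINT p:halfspace|lebesgue. ?H p) = (LINT p|lborel. ?H' p)"
    proof (rule halfspace_integral_eq)
      let ?u = "\<lambda>p. indicator halfspace p *\<^sub>R u p"
      have "(\<lambda>p. S (?u p) * dir_deriv e_t \<phi> p + Q (?u p) * (dir_deriv e_1 \<phi> p + dir_deriv e_2 \<phi> p)
        + R (?u p) * dir_deriv e_D (dir_deriv e_D \<phi>) p) \<in> borel_measurable lebesgue"
        by (intro borel_measurable_add borel_measurable_times comp_measurable cS cQ cR test_measurable DC)
      moreover have "(\<lambda>p. S (?u p) * dir_deriv e_t \<phi> p + Q (?u p) * (dir_deriv e_1 \<phi> p + dir_deriv e_2 \<phi> p)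
        + R (?u p) * dir_deriv e_D (dir_deriv e_D \<phi>) p) = (\<lambda>p. indicator halfspace p *\<^sub>R ?H p)"
      proof
        fix p
        show "S (?u p) * dir_deriv e_t \<phi> p + Q (?u p) * (dir_deriv e_1 \<phi> p + dir_deriv e_2 \<phi> p)
          + R (?u p) * dir_deriv e_D (dir_deriv e_D \<phi>) p = indicator halfspace p *\<^sub>R ?H p"
          by (cases "p \<in> halfspace") (simp_all add: test_functions_outside[OF D] test_functions_outside[OF DD])
      qed
      ultimately show "(\<lambda>p. indicator halfspace p *\<^sub>R ?H p) \<in> borel_measurable lebesgue" by simp
      show "?H' \<in> borel_measurable borel"
        unfolding dual_op_def[abs_def]
        by (intro borel_measurable_add borel_measurable_times comp_borel cS cQ cR Db)
      show "AE p in lebesgue. p \<in> halfspace \<longrightarrow> ?H p = ?H' p"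
        using U(2)
      proof eventually_elim
        case (elim p)
        show ?case
        proof
          assume "p \<in> halfspace"
          with elim have "U p = u p" by simp
          then show "?H p = ?H' p" by (simp only: dual_op_def vec)
        qed
      qed
      show "?H' p = 0" if "p \<notin> halfspace" for p
        unfolding dual_op_def by (simp only: test_functions_outside[OF D that] test_functions_outside[OF DD that] mult_zero_right add_0_right)
    qed
    moreover have "(LINT p:halfspace|lebesgue. (h p)\<^sup>2 * \<phi> p) \<le> (LINT p:halfspace|lebesgue. ?H p) + (LINT x|lebesgue. S (u0 x) * \<phi> (0, x))"
      using h \<phi>C pos unfolding entropy_ineq_def by blast
    moreover have "0 \<le> (LINT p:halfspace|lebesgue. (h p)\<^sup>2 * \<phi> p)"
      unfolding set_lebesgue_integral_def 
      by (rule Bochner_Integration.integral_nonneg, intro scaleR_nonneg_nonneg mult_nonneg_nonneg pos[rule_format]) auto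
    moreover have "\<phi> (0, x) = 0" for x
      by (rule test_functions_outside[OF \<phi>]) (simp add: halfspace_def)
    ultimately show ?thesis by simp
  qed
  then show ?thesis
    unfolding dissipative_def using comp_bdd_borel[OF cS] comp_bdd_borel[OF cQ] comp_bdd_borel[OF cR] by blast
qed

text \<open>
  An entropy with \<open>S''\<close> of varying sign is the difference of two convex ones: \<open>P\<close> with
  \<open>P'' = max(S'', 0)\<close>, and \<open>P - S\<close>.
\<close>

lemma balanced_entropy:
  assumes S: "\<And>a. (S has_real_derivative S' a) (at a)" "\<And>a. (S' has_real_derivative S'' a) (at a)"
      "continuous_on UNIV S''"
    and Q: "\<And>a. (Q has_real_derivative S' a * a ^ l) (at a)" and R: "\<And>a. (R has_real_derivative S' a * \<bar>a\<bar> ^ n) (at a)"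
  shows "balanced halfspace e_t (e_1 + e_2) e_D (\<lambda>p. S (U p)) (\<lambda>p. Q (U p)) (\<lambda>p. R (U p))"
proof -
  define P'' where "P'' a = max (S'' a) 0" for a
  have cP'': "continuous_on UNIV P''" unfolding P''_def by (intro continuous_intros S(3))
  obtain P' where P': "\<And>a. (P' has_real_derivative P'' a) (at a)" using exists_antiderivative[OF cP''] by blast
  note cP' = DERIV_continuous_on_UNIV[OF P']
  obtain P where P: "\<And>a. (P has_real_derivative P' a) (at a)" using exists_antiderivative[OF cP'] by blast
  have cPQ: "continuous_on UNIV (\<lambda>a. P' a * a ^ l)" and cPR: "continuous_on UNIV (\<lambda>a. P' a * \<bar>a\<bar> ^ n)"
    by (intro continuous_intros cP')+
  obtain PQ where PQ: "\<And>a. (PQ has_real_derivative P' a * a ^ l) (at a)" using exists_antiderivative[OF cPQ] by blast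
  obtain PR where PR: "\<And>a. (PR has_real_derivative P' a * \<bar>a\<bar> ^ n) (at a)" using exists_antiderivative[OF cPR] by blast
  have d1: "dissipative halfspace e_t (e_1 + e_2) e_D (\<lambda>p. P (U p)) (\<lambda>p. PQ (U p)) (\<lambda>p. PR (U p))"
    by (rule dissipative_entropy[OF P P' cP'' _ PQ PR]) (simp add: P''_def)
  have d2: "dissipative halfspace e_t (e_1 + e_2) e_D (\<lambda>p. P (U p) - S (U p)) (\<lambda>p. PQ (U p) - Q (U p)) (\<lambda>p. PR (U p) - R (U p))"
  proof (rule dissipative_entropy[where S = "\<lambda>a. P a - S a" and Q = "\<lambda>a. PQ a - Q a" and R = "\<lambda>a. PR a - R a"
      and S' = "\<lambda>a. P' a - S' a" and S'' = "\<lambda>a. P'' a - S'' a"])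
    fix a
    show "((\<lambda>a. P a - S a) has_real_derivative P' a - S' a) (at a)" by (rule DERIV_diff[OF P S(1)])
    show "((\<lambda>a. P' a - S' a) has_real_derivative P'' a - S'' a) (at a)" by (rule DERIV_diff[OF P' S(2)])
    show "((\<lambda>a. PQ a - Q a) has_real_derivative (P' a - S' a) * a ^ l) (at a)"
      unfolding left_diff_distrib by (rule DERIV_diff[OF PQ Q])
    show "((\<lambda>a. PR a - R a) has_real_derivative (P' a - S' a) * \<bar>a\<bar> ^ n) (at a)"
      unfolding left_diff_distrib by (rule DERIV_diff[OF PR R])
    show "0 \<le> P'' a - S'' a" by (simp add: P''_def)
  qed (intro continuous_intros cP'' S(3))
  show ?thesis unfolding balanced_def
  proof (intro exI conjI)
    show "dissipative halfspace e_t (e_1 + e_2) e_D (\<lambda>p. P (U p)) (\<lambda>p. PQ (U p)) (\<lambda>p. PR (U p))" by (rule d1)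
    show "dissipative halfspace e_t (e_1 + e_2) e_D (\<lambda>p. P (U p) - S (U p)) (\<lambda>p. PQ (U p) - Q (U p)) (\<lambda>p. PR (U p) - R (U p))" by (rule d2)
  qed auto
qed

text \<open>
  The weight \<open>a\<^bsup>2n\<^esup>\<close> of the entropies was chosen for this: it supplies the factor \<open>\<bar>a\<bar>\<^sup>n\<close>, and what is left
  is continuous.
\<close>

lemma D_regular_pow_prim: "D_regular halfspace e_D (\<lambda>p. pow_prim (2 * n + j) (U p))"
proof (rule D_regular_comp)
  show "continuous_on UNIV (\<lambda>a :: real. \<bar>a\<bar> ^ n * a ^ j)" by (intro continuous_intros)
  fix a :: real
  have "\<bar>a\<bar> ^ n * \<bar>a\<bar> ^ n = a ^ (2 * n)"
    by (simp add: power_mult_distrib[symmetric] power_mult power2_eq_square)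
  then have "a ^ (2 * n + j) = \<bar>a\<bar> ^ n * a ^ j * \<bar>a\<bar> ^ n" by (simp add: power_add)
  then show "(pow_prim (2 * n + j) has_real_derivative \<bar>a\<bar> ^ n * a ^ j * \<bar>a\<bar> ^ n) (at a)"
    using pow_prim_deriv[of "2 * n + j" a] by simp
qed (simp add: pow_prim_def)

lemma balanced_pow_prim:
  obtains R where "balanced halfspace e_t (e_1 + e_2) e_D (\<lambda>p. pow_prim (2 * n + j) (U p)) (\<lambda>p. pow_prim (2 * n + j + l) (U p)) R"
    "D_regular halfspace e_D R"
proof -
  let ?m = "2 * n + j"
  have "continuous_on UNIV (\<lambda>a :: real. a ^ ?m * \<bar>a\<bar> ^ n)" by (intro continuous_intros)
  from exists_antiderivative[OF this]
  obtain R where R: "\<And>a. (R has_real_derivative a ^ ?m * \<bar>a\<bar> ^ n) (at a)" "R 0 = 0" by blast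
  have "balanced halfspace e_t (e_1 + e_2) e_D (\<lambda>p. pow_prim ?m (U p)) (\<lambda>p. pow_prim (?m + l) (U p)) (\<lambda>p. R (U p))"
  proof (rule balanced_entropy[OF pow_prim_deriv _ _ _ R(1)])
    show "((\<lambda>a. a ^ ?m) has_real_derivative real ?m * a ^ (?m - 1)) (at a)" for a
      using DERIV_pow[of ?m a UNIV] by simp
    show "continuous_on UNIV (\<lambda>a :: real. real ?m * a ^ (?m - 1))" by (intro continuous_intros)
    show "(pow_prim (?m + l) has_real_derivative a ^ ?m * a ^ l) (at a)" for a
      using pow_prim_deriv[of "?m + l" a] by (simp only: power_add)
  qed
  moreover have "D_regular halfspace e_D (\<lambda>p. R (U p))"
    by (rule D_regular_comp[OF _ R]) (intro continuous_intros)
  ultimately show ?thesis by (rule that)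
qed

lemma span_txx:
  fixes v :: txx
  shows "\<exists>\<alpha> \<beta> \<gamma>. v = \<alpha> *\<^sub>R e_t + \<beta> *\<^sub>R (e_1 + e_2) + \<gamma> *\<^sub>R e_D \<and> \<bar>\<alpha>\<bar> \<le> norm v \<and> \<bar>\<beta>\<bar> \<le> norm v \<and> \<bar>\<gamma>\<bar> \<le> norm v"
proof -
  obtain a b c where v: "v = (a, b, c)" by (cases v)
  have a: "\<bar>a\<bar> \<le> norm v" using norm_fst_le[of a "(b, c)"] by (simp add: v)
  have bc: "norm (b, c) \<le> norm v" using norm_snd_le[of "(b, c)" a] by (simp add: v)
  have b: "\<bar>b\<bar> \<le> norm v" using norm_fst_le[of b c] bc by simp
  have c: "\<bar>c\<bar> \<le> norm v" using norm_snd_le[of c b] bc by simp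
  show ?thesis
  proof (intro exI conjI)
    show "v = a *\<^sub>R e_t + ((b + c) / 2) *\<^sub>R (e_1 + e_2) + ((b - c) / 2) *\<^sub>R e_D" by (simp add: v field_simps)
    show "\<bar>a\<bar> \<le> norm v" by (rule a)
    have "\<bar>b + c\<bar> \<le> 2 * norm v" "\<bar>b - c\<bar> \<le> 2 * norm v"
      using b c abs_triangle_ineq[of b c] abs_triangle_ineq4[of b c] by auto
    then show "\<bar>(b + c) / 2\<bar> \<le> norm v" "\<bar>(b - c) / 2\<bar> \<le> norm v" by simp_all
  qed
qed

lemma local_Nikolskii:
  assumes l: "1 \<le> l" and \<phi>: "\<phi> \<in> test_functions halfspace"
  shows "\<exists>C. \<forall>z. norm z \<le> 1 \<longrightarrow>
    (LINT y|lborel. \<bar>\<phi> (y + z) * U (y + z) - \<phi> y * U y\<bar> ^ (4 * n + 2 * l + 2)) \<le> C * norm z"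
proof -
  have \<phi>C: "\<phi> \<in> Cinf_compact" and supp: "closure {x. \<phi> x \<noteq> 0} \<subseteq> halfspace"
    using \<phi> by (auto simp: test_functions_iff)
  have "compact (closure {x. \<phi> x \<noteq> 0})" using \<phi>C by (simp add: Cinf_compact_def)
  from exists_cutoff[OF this halfspace_open supp]
  obtain \<zeta> where cut: "\<zeta> \<in> test_functions halfspace" "\<And>x. 0 \<le> \<zeta> x" "\<And>x. x \<in> closure {x. \<phi> x \<noteq> 0} \<Longrightarrow> 1 \<le> \<zeta> x" by blast
  interpret cutoff halfspace \<zeta> e_t "e_1 + e_2" e_D by standard (use cut in auto)
  obtain R1 where R1: "balanced halfspace e_t (e_1 + e_2) e_D (\<lambda>p. pow_prim (2 * n) (U p)) (\<lambda>p. pow_prim (2 * n + l) (U p)) R1"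
    "D_regular halfspace e_D R1" using balanced_pow_prim[of 0] by auto
  obtain R2 where R2: "balanced halfspace e_t (e_1 + e_2) e_D (\<lambda>p. pow_prim (2 * n + l) (U p)) (\<lambda>p. pow_prim (2 * n + l + l) (U p)) R2"
    "D_regular halfspace e_D R2" using balanced_pow_prim[of l] by auto
  have ll: "2 * n + l + l = 2 * n + 2 * l" by simp
  have r0: "D_regular halfspace e_D (\<lambda>p. pow_prim (2 * n) (U p))" using D_regular_pow_prim[of 0] by simp
  note est = commutator_estimate[OF R1(1) r0 D_regular_pow_prim[of l] R1(2) R2(1)[unfolded ll] D_regular_pow_prim[of l] D_regular_pow_prim[of "2 * l"] R2(2) span_txx]
  have one: "1 \<le> \<zeta> x" if "\<phi> x \<noteq> 0" for x
    using cut(3)[of x] closure_subset[of "{x. \<phi> x \<noteq> 0}"] that by auto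
  have "2 * (2 * n) + 2 * l + 2 = 4 * n + 2 * l + 2" by simp
  with Nikolskii_estimate[OF U(1) _ l est \<phi>C one] show ?thesis by simp
qed

end

section \<open>The regularity theorem\<close>

text \<open>
  Since \<open>\<alpha> n \<le> 1\<close> and \<open>\<alpha> l \<le> 1/2\<close>, we have \<open>2\<alpha>(4n + 2l + 2) \<le> 10 + 4\<alpha> \<le> 6\<alpha> + 72\<close>.
\<close>

lemma exponent_bounds:
  fixes \<alpha> q s :: real
  assumes "1 \<le> n" "1 \<le> l" "\<alpha> = min (1 / (2 * real l)) (1 / real n)"
    and "q < (\<alpha> + 12) / (\<alpha> + 6)" "s < 2 * (\<alpha> / (6 * \<alpha> + 72))"
  shows "q \<le> real (4 * n + 2 * l + 2)" "s * real (4 * n + 2 * l + 2) < 1"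
proof -
  have \<alpha>0: "\<alpha> > 0" using assms by simp
  have "\<alpha> \<le> 1 / (2 * real l)" "\<alpha> \<le> 1 / real n" using assms(3) by auto
  then have al: "\<alpha> * real l \<le> 1 / 2" "\<alpha> * real n \<le> 1" using assms(1,2) by (simp_all add: field_simps)
  have "\<alpha> \<le> \<alpha> * real l" using \<alpha>0 assms(2) by simp
  then have al2: "\<alpha> \<le> 1 / 2" using al by linarith
  have "(\<alpha> + 12) / (\<alpha> + 6) \<le> 2" using \<alpha>0 by (simp add: field_simps)
  then show "q \<le> real (4 * n + 2 * l + 2)" using assms(1,2,4) by simp
  have "2 * \<alpha> * real (4 * n + 2 * l + 2) = 8 * (\<alpha> * real n) + 4 * (\<alpha> * real l) + 4 * \<alpha>"
    by (simp add: algebra_simps)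
  then have "2 * \<alpha> * real (4 * n + 2 * l + 2) \<le> 6 * \<alpha> + 72"
    using al al2 \<alpha>0 by linarith
  then have "2 * (\<alpha> / (6 * \<alpha> + 72)) * real (4 * n + 2 * l + 2) \<le> 1"
    using \<alpha>0 by (simp add: field_simps)
  moreover have "s * real (4 * n + 2 * l + 2) < 2 * (\<alpha> / (6 * \<alpha> + 72)) * real (4 * n + 2 * l + 2)"
    by (rule mult_strict_right_mono[OF assms(5)]) simp
  ultimately show "s * real (4 * n + 2 * l + 2) < 1" by linarith
qed

theorem corollary4p1:
  fixes n l :: nat
    and u0 :: "real \<times> real \<Rightarrow> real"
    and u :: "real \<times> real \<times> real \<Rightarrow> real"
    and \<alpha> q_star s_star q s :: real
  assumes "1 \<le> n" and "1 \<le> l"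
    and "integrable lebesgue u0" and "in_Linf lebesgue u0"
    and "entropy_solution l n u0 u"
    and "\<alpha> = min (1 / (2 * real l)) (1 / real n)"
    and "q_star = (\<alpha> + 12) / (\<alpha> + 6)"
    and "s_star = \<alpha> / (6 * \<alpha> + 72)"
    and "1 < q" and "q < q_star"
    and "0 < s" and "s < 2 * s_star"
  shows "in_Wsq_loc s q halfspace u"
proof -
  note sol = assms(5)[unfolded entropy_solution_def]
  have um: "u \<in> borel_measurable (lebesgue_on halfspace)" and ub: "\<exists>C. AE p in lebesgue_on halfspace. \<bar>u p\<bar> \<le> C"
    using sol by (auto simp: in_Linf_def)
  obtain g where g: "in_Lp 2 (lebesgue_on halfspace) g"
    "\<And>\<psi>. continuous_on UNIV \<psi> \<Longrightarrow> (\<And>w. 0 \<le> \<psi> w) \<Longrightarrow>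
           weak_dir_deriv_on halfspace e_D (\<lambda>p. Sigma_psi n \<psi> (u p)) (\<lambda>p. sqrt (\<psi> (u p)) * g p)"
    using sol by blast
  have gm: "g \<in> borel_measurable (lebesgue_on halfspace)" using g(1) by (simp add: in_Lp_def)
  obtain C where "AE p in lebesgue_on halfspace. \<bar>u p\<bar> \<le> C" using ub by blast
  then have C: "AE p in lebesgue. p \<in> halfspace \<longrightarrow> \<bar>u p\<bar> \<le> C"
    using AE_restrict_space_iff[OF halfspace_lebesgue] by auto
  obtain U0 where U0: "U0 \<in> borel_measurable borel" "AE p in lebesgue. p \<in> halfspace \<longrightarrow> U0 p = u p"
    using exists_borel_version[OF um] by blast
  \<comment> \<open>Truncation makes the essential bound hold everywhere.\<close>
  define U where "U p = max (- \<bar>C\<bar>) (min \<bar>C\<bar> (U0 p))" for p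
  have Ub: "bdd_borel U"
  proof (rule bdd_borelI[of _ "\<bar>C\<bar>"])
    show "U \<in> borel_measurable borel"
      unfolding U_def[abs_def] by (intro borel_measurable_max borel_measurable_min borel_measurable_const U0(1))
    show "\<bar>U p\<bar> \<le> \<bar>C\<bar>" for p by (simp add: U_def abs_le_iff)
  qed
  have Uae: "AE p in lebesgue. p \<in> halfspace \<longrightarrow> U p = u p"
    using C U0(2)
  proof eventually_elim
    case (elim p)
    show ?case
    proof
      assume "p \<in> halfspace"
      then have "U0 p = u p" "\<bar>u p\<bar> \<le> \<bar>C\<bar>" using elim by auto
      then show "U p = u p" by (auto simp: U_def)
    qed
  qed
  obtain G where G: "G \<in> borel_measurable borel" "AE p in lebesgue. p \<in> halfspace \<longrightarrow> G p = g p" "\<And>p. p \<notin> halfspace \<Longrightarrow> G p = 0"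
    using exists_borel_version[OF gm] by blast
  have "integrable lebesgue (\<lambda>p. indicator halfspace p *\<^sub>R (\<bar>g p\<bar> powr 2))"
    using g(1) unfolding in_Lp_def integrable_restrict_space[OF halfspace_lebesgue] by blast
  moreover have "integrable lebesgue (\<lambda>p. indicator halfspace p *\<^sub>R (\<bar>g p\<bar> powr 2)) \<longleftrightarrow> integrable lebesgue (\<lambda>p. (G p)\<^sup>2)"
  proof (rule integrable_cong_AE)
    show "(\<lambda>p. indicator halfspace p *\<^sub>R (\<bar>g p\<bar> powr 2)) \<in> borel_measurable lebesgue"
      using calculation by (rule borel_measurable_integrable)
    show "(\<lambda>p. (G p)\<^sup>2) \<in> borel_measurable lebesgue" using G(1) by (intro measurable_completion) simp
    show "AE p in lebesgue. indicator halfspace p *\<^sub>R (\<bar>g p\<bar> powr 2) = (G p)\<^sup>2"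
      using G(2) by eventually_elim (use G(3) in \<open>auto simp: indicator_def powr_numeral\<close>)
  qed
  ultimately have "integrable lborel (\<lambda>p. (G p)\<^sup>2)"
    using integrable_completion[of "\<lambda>p. (G p)\<^sup>2" lborel] G(1) by simp
  then have GL: "L2 G" using G(1) by (simp add: L2_def)
  interpret solution n l u0 u U g G
  proof
    fix S S' S'' Q R :: "real \<Rightarrow> real"
    assume "convex_on UNIV S" "\<And>a. (S has_real_derivative S' a) (at a)" "\<And>a. (S' has_real_derivative S'' a) (at a)"
      "continuous_on UNIV S''" "\<And>a. (Q has_real_derivative S' a * a ^ l) (at a)"
      "\<And>a. (R has_real_derivative S' a * \<bar>a\<bar> ^ n) (at a)"
    then show "\<exists>h. entropy_ineq S Q R h u0 u" using sol by blast
  qed (fact assms(1) um gm Ub Uae GL G(2) g(2))+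
  show ?thesis
    unfolding in_Wsq_loc_def
  proof
    fix \<phi> :: "txx \<Rightarrow> real" assume \<phi>: "\<phi> \<in> test_functions halfspace"
    have \<phi>C: "\<phi> \<in> Cinf_compact" using \<phi> by (simp add: test_functions_iff)
    let ?N = "4 * n + 2 * l + 2"
    note e = exponent_bounds[OF assms(1,2,6) assms(10)[unfolded assms(7)] assms(12)[unfolded assms(8)]]
    obtain C where C: "\<And>z. norm z \<le> 1 \<Longrightarrow> (LINT y|lborel. \<bar>\<phi> (y + z) * U (y + z) - \<phi> y * U y\<bar> ^ ?N) \<le> C * norm z"
      using local_Nikolskii[OF assms(2) \<phi>] by blast
    have "in_Wsq s q (\<lambda>x. \<phi> x * U x)"
    proof (rule in_Wsq_if_Nikolskii[OF _ _ _ C _ e(1) _ e(2)])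
      show "bdd_borel (\<lambda>x. \<phi> x * U x)" by (rule bdd_borel_mult[OF Cinf_compact_bdd_borel[OF \<phi>C] Ub])
      show "bounded {x. \<phi> x * U x \<noteq> 0}"
        by (rule bounded_subset[of "{x. \<phi> x \<noteq> 0}"]) (use \<phi>C in \<open>auto simp: Cinf_compact_iff\<close>)
    qed (use assms in auto)
    then show "in_Wsq s q (\<lambda>x. \<phi> x * u x)"
    proof (rule in_Wsq_cong_AE)
      have "(\<lambda>x. \<phi> x * (indicator halfspace x *\<^sub>R u x)) \<in> borel_measurable lebesgue"
        by (intro borel_measurable_times test_measurable \<phi>C um')
      moreover have "(\<lambda>x. \<phi> x * (indicator halfspace x *\<^sub>R u x)) = (\<lambda>x. \<phi> x * u x)"
      proof
        fix x show "\<phi> x * (indicator halfspace x *\<^sub>R u x) = \<phi> x * u x"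
          by (cases "x \<in> halfspace") (simp_all add: test_functions_outside[OF \<phi>])
      qed
      ultimately show "(\<lambda>x. \<phi> x * u x) \<in> borel_measurable lebesgue" by simp
      show "AE x in lebesgue. \<phi> x * u x = \<phi> x * U x"
        using Uae
      proof eventually_elim
        case (elim x)
        then show ?case by (cases "x \<in> halfspace") (simp_all add: test_functions_outside[OF \<phi>])
      qed
    qed
  qed
qed

end
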